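(* Let $\mathcal{H}=\mathcal{H}_{k_1}\otimes\cdots\otimes\mathcal{H}_{k_n}$ be an analytic Hilbert module over $\mathbb{C}[z_1,\dots,z_n]$, and let $\mathcal{Q}=\mathcal{Q}_1\otimes\cdots\otimes\mathcal{Q}_n$ be a doubly commuting quotient module of $\mathcal{H}$, where $\mathcal{Q}_i$ is a quotient module of $\mathcal{H}_{k_i}$ for each $i$. Then the following are equivalent: (i) The identity representation of $C^*(\mathcal{Q})$ is a boundary representation relative to $B(\mathcal{Q})$. (ii) The identity representation of $C^*(\mathcal{Q}_i)$ is a boundary representation relative to $B(\mathcal{Q}_i)$ for all $i=1,\dots,n$.
   Context: Let $k:\mathbb{D}\times\mathbb{D}\to\mathbb{C}$ be a positive definite function, analytic in the first variable and anti-analytic in the second, with reproducing kernel Hilbert space $\mathcal{H}_k$ of holomorphic functions on the open unit disc $\mathbb{D}$. $\mathcal{H}_k$ is an analytic Hilbert module over $\mathbb{C}[z]$ if multiplication $M_z$ by the coordinate is bounded on $\mathcal{H}_k$ and $k^{-1}(z,w)=1/k(z,w)$ is a polynomial in $z$ and $\bar w$. An analytic Hilbert module over $\mathbb{C}[z_1,\dots,z_n]$ is a Hilbert space tensor product $\mathcal{H}_{k_1}\otimes\cdots\otimes\mathcal{H}_{k_n}$ in which each $\mathcal{H}_{k_i}$ is an analytic Hilbert module over $\mathbb{C}[z]$; $M_{z_i}$ is $M_z$ acting in the $i$-th tensor factor (identity in the others). A quotient module is a closed subspace $\mathcal{Q}$ whose orthogonal complement is invariant under all $M_{z_i}$; put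 $C_{z_i}=P_{\mathcal{Q}}M_{z_i}|_{\mathcal{Q}}$. $\mathcal{Q}$ is doubly commuting if $[C_{z_i},C_{z_j}^*]=0$ for all $1\le i<j\le n$; it is known that this holds if and only if $\mathcal{Q}=\mathcal{Q}_1\otimes\cdots\otimes\mathcal{Q}_n$ for some quotient modules $\mathcal{Q}_i$ of $\mathcal{H}_{k_i}$. $B(\mathcal{Q})$ and $C^*(\mathcal{Q})$ are, respectively, the norm-closed (Banach) algebra and the $C^*$-algebra generated by $I_{\mathcal{Q}},C_{z_1},\dots,C_{z_n}$ (for $\mathcal{Q}_i$: by $I_{\mathcal{Q}_i}$ and the single operator $C_z=P_{\mathcal{Q}_i}M_z|_{\mathcal{Q}_i}$). For a unital operator algebra $A$ with generated $C^*$-algebra $C^*(A)$, an irreducible (in particular nonzero) representation $\omega$ of $C^*(A)$ is a boundary representation relative to $A$ if $\omega|_A$ has a unique completely positive extension to $C^*(A)$ (namely $\omega$ itself). The identity representation is the inclusion of $C^*(\mathcal{Q})$ in the bounded operators on $\mathcal{Q}$. *)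

theory Defs
  imports "HOL-Analysis.Analysis" "HOL-Library.Function_Algebras"
begin

text \<open>
  A Hilbert space is a carrier inside a complex vector space together with an inner product,
  so that many different Hilbert spaces of functions can live in one type.
\<close>

class scaleC =
  fixes scaleC :: "complex \<Rightarrow> 'a \<Rightarrow> 'a"  (infixr \<open>*\<^sub>C\<close> 75)

class complex_vector = ab_group_add + scaleC +
  assumes scaleC_add_right: "a *\<^sub>C (x + y) = a *\<^sub>C x + a *\<^sub>C y"
    and scaleC_add_left: "(a + b) *\<^sub>C x = a *\<^sub>C x + b *\<^sub>C x"
    and scaleC_scaleC: "a *\<^sub>C (b *\<^sub>C x) = (a * b) *\<^sub>C x"
    and scaleC_one: "1 *\<^sub>C x = x"

global_interpretation complex_vector:
  vector_space "scaleC :: complex \<Rightarrow> 'a \<Rightarrow> 'a::complex_vector"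
  defines csubspace = complex_vector.subspace
  by unfold_locales
    (simp_all add: scaleC_add_right scaleC_add_left scaleC_scaleC scaleC_one)

instantiation complex :: complex_vector
begin
definition scaleC_complex :: "complex \<Rightarrow> complex \<Rightarrow> complex" where
  "scaleC_complex c z = c * z"
instance by standard (simp_all add: scaleC_complex_def algebra_simps)
end

instantiation "fun" :: (type, complex_vector) complex_vector
begin
definition scaleC_fun :: "complex \<Rightarrow> ('a \<Rightarrow> 'b) \<Rightarrow> 'a \<Rightarrow> 'b" where
  "scaleC_fun c f = (\<lambda>x. c *\<^sub>C f x)"
instance
  by standard
    (simp_all add: scaleC_fun_def fun_eq_iff scaleC_add_right scaleC_add_left scaleC_scaleC scaleC_one)
end


section \<open>Hilbert spaces and bounded operators\<close>

record 'a hspace =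
  carr :: "'a set"
  ip :: "'a \<Rightarrow> 'a \<Rightarrow> complex"

definition hnorm :: "('a, 'm) hspace_scheme \<Rightarrow> 'a \<Rightarrow> real" where
  "hnorm H x = sqrt (Re (ip H x x))"

locale hilbert =
  fixes H :: "'a::complex_vector hspace"
  assumes subspace: "csubspace (carr H)"
    and ip_add: "\<lbrakk>x \<in> carr H; y \<in> carr H; z \<in> carr H\<rbrakk> \<Longrightarrow> ip H (x + y) z = ip H x z + ip H y z"
    and ip_scale: "\<lbrakk>x \<in> carr H; z \<in> carr H\<rbrakk> \<Longrightarrow> ip H (c *\<^sub>C x) z = c * ip H x z"
    and ip_cnj: "\<lbrakk>x \<in> carr H; y \<in> carr H\<rbrakk> \<Longrightarrow> ip H y x = cnj (ip H x y)"
    and ip_nonneg: "x \<in> carr H \<Longrightarrow> ip H x x \<in> \<real>\<^sub>\<ge>\<^sub>0"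
    and ip_eq_0: "\<lbrakk>x \<in> carr H; ip H x x = 0\<rbrakk> \<Longrightarrow> x = 0"
    and complete:
      "\<lbrakk>\<And>m. X m \<in> carr H; \<And>e. e > 0 \<Longrightarrow> \<exists>N. \<forall>p\<ge>N. \<forall>q\<ge>N. hnorm H (X p - X q) < e\<rbrakk>
        \<Longrightarrow> \<exists>l\<in>carr H. (\<lambda>m. hnorm H (X m - l)) \<longlonglongrightarrow> 0"

definition hclosed :: "'a::complex_vector hspace \<Rightarrow> 'a set \<Rightarrow> bool" where
  "hclosed H S \<longleftrightarrow> S \<subseteq> carr H \<and>
     (\<forall>X l. (\<forall>m. X m \<in> S) \<and> l \<in> carr H \<and> (\<lambda>m. hnorm H (X m - l)) \<longlonglongrightarrow> 0 \<longrightarrow> l \<in> S)"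

definition closed_csubspace :: "'a::complex_vector hspace \<Rightarrow> 'a set \<Rightarrow> bool" where
  "closed_csubspace H V \<longleftrightarrow> csubspace V \<and> hclosed H V"

definition closed_cspan :: "'a::complex_vector hspace \<Rightarrow> 'a set \<Rightarrow> 'a set" where
  "closed_cspan H S = \<Inter>{V. closed_csubspace H V \<and> S \<subseteq> V}"

definition orth :: "'a hspace \<Rightarrow> 'a set \<Rightarrow> 'a set" where
  "orth H S = {x \<in> carr H. \<forall>y\<in>S. ip H x y = 0}"

definition sub_hspace :: "'a hspace \<Rightarrow> 'a set \<Rightarrow> 'a hspace" where
  "sub_hspace H S = H\<lparr>carr := S\<rparr>"

text \<open>
  An operator is a function on the whole type that is zero off the carrier; hence two operators
  are equal as functions iff they agree on the carrier, and sums, scalar multiples and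
  composites of operators are the ones of the function type.
\<close>

definition bop :: "'a::complex_vector hspace \<Rightarrow> 'b::complex_vector hspace \<Rightarrow> ('a \<Rightarrow> 'b) set" where
  "bop H K = {A. (\<forall>x\<in>carr H. A x \<in> carr K) \<and>
     (\<forall>x\<in>carr H. \<forall>y\<in>carr H. A (x + y) = A x + A y) \<and>
     (\<forall>c. \<forall>x\<in>carr H. A (c *\<^sub>C x) = c *\<^sub>C A x) \<and>
     (\<exists>B. \<forall>x\<in>carr H. hnorm K (A x) \<le> B * hnorm H x) \<and>
     (\<forall>x. x \<notin> carr H \<longrightarrow> A x = 0)}"

definition opnorm :: "'a::complex_vector hspace \<Rightarrow> 'b::complex_vector hspace \<Rightarrow> ('a \<Rightarrow> 'b) \<Rightarrow> real" where
  "opnorm H K A = Sup {hnorm K (A x) | x. x \<in> carr H \<and> hnorm H x \<le> 1}"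

definition idop :: "'a::complex_vector hspace \<Rightarrow> 'a \<Rightarrow> 'a" where
  "idop H = (\<lambda>x. if x \<in> carr H then x else 0)"

definition adj :: "'a::complex_vector hspace \<Rightarrow> 'b::complex_vector hspace \<Rightarrow> ('a \<Rightarrow> 'b) \<Rightarrow> 'b \<Rightarrow> 'a" where
  "adj H K A = (THE B. B \<in> bop K H \<and> (\<forall>x\<in>carr H. \<forall>y\<in>carr K. ip K (A x) y = ip H x (B y)))"

definition proj :: "'a::complex_vector hspace \<Rightarrow> 'a set \<Rightarrow> 'a \<Rightarrow> 'a" where
  "proj H S = (\<lambda>x. if x \<in> carr H then THE p. p \<in> S \<and> x - p \<in> orth H S else 0)"

definition compression :: "'a::complex_vector hspace \<Rightarrow> 'a set \<Rightarrow> ('a \<Rightarrow> 'a) \<Rightarrow> 'a \<Rightarrow> 'a" where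
  "compression H S A = (\<lambda>x. if x \<in> S then proj H S (A x) else 0)"


section \<open>Operator algebras and boundary representations\<close>

definition banach_algebra :: "'a::complex_vector hspace \<Rightarrow> ('a \<Rightarrow> 'a) set \<Rightarrow> bool" where
  "banach_algebra H A \<longleftrightarrow> A \<subseteq> bop H H \<and> csubspace A \<and> (\<forall>a\<in>A. \<forall>b\<in>A. a \<circ> b \<in> A) \<and>
     (\<forall>X l. (\<forall>m. X m \<in> A) \<and> l \<in> bop H H \<and> (\<lambda>m. opnorm H H (X m - l)) \<longlonglongrightarrow> 0 \<longrightarrow> l \<in> A)"

definition cstar_algebra :: "'a::complex_vector hspace \<Rightarrow> ('a \<Rightarrow> 'a) set \<Rightarrow> bool" where
  "cstar_algebra H A \<longleftrightarrow> banach_algebra H A \<and> (\<forall>a\<in>A. adj H H a \<in> A)"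

definition banach_gen :: "'a::complex_vector hspace \<Rightarrow> ('a \<Rightarrow> 'a) set \<Rightarrow> ('a \<Rightarrow> 'a) set" where
  "banach_gen H S = \<Inter>{A. banach_algebra H A \<and> S \<subseteq> A}"

definition cstar_gen :: "'a::complex_vector hspace \<Rightarrow> ('a \<Rightarrow> 'a) set \<Rightarrow> ('a \<Rightarrow> 'a) set" where
  "cstar_gen H S = \<Inter>{A. cstar_algebra H A \<and> S \<subseteq> A}"

lemma cstar_gen_banach_gen: "cstar_gen H (banach_gen H S) = cstar_gen H S"
proof -
  have "cstar_algebra H A \<and> banach_gen H S \<subseteq> A \<longleftrightarrow> cstar_algebra H A \<and> S \<subseteq> A" for A
    unfolding banach_gen_def cstar_algebra_def by blast
  then show ?thesis unfolding cstar_gen_def by simp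
qed

definition linear_into_bop ::
  "('a \<Rightarrow> 'a) set \<Rightarrow> 'b hspace \<Rightarrow> (('a::complex_vector \<Rightarrow> 'a) \<Rightarrow> ('b::complex_vector \<Rightarrow> 'b)) \<Rightarrow> bool" where
  "linear_into_bop C K \<phi> \<longleftrightarrow> (\<forall>a\<in>C. \<phi> a \<in> bop K K) \<and>
     (\<forall>a\<in>C. \<forall>b\<in>C. \<phi> (a + b) = \<phi> a + \<phi> b) \<and> (\<forall>c. \<forall>a\<in>C. \<phi> (c *\<^sub>C a) = c *\<^sub>C \<phi> a)"

definition representation ::
  "'a hspace \<Rightarrow> ('a \<Rightarrow> 'a) set \<Rightarrow> 'b hspace \<Rightarrow> (('a::complex_vector \<Rightarrow> 'a) \<Rightarrow> ('b::complex_vector \<Rightarrow> 'b)) \<Rightarrow> bool" where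
  "representation H C K \<omega> \<longleftrightarrow> hilbert K \<and> linear_into_bop C K \<omega> \<and>
     (\<forall>a\<in>C. \<forall>b\<in>C. \<omega> (a \<circ> b) = \<omega> a \<circ> \<omega> b) \<and> (\<forall>a\<in>C. \<omega> (adj H H a) = adj K K (\<omega> a))"

definition irreducible_representation ::
  "'a hspace \<Rightarrow> ('a \<Rightarrow> 'a) set \<Rightarrow> 'b hspace \<Rightarrow> (('a::complex_vector \<Rightarrow> 'a) \<Rightarrow> ('b::complex_vector \<Rightarrow> 'b)) \<Rightarrow> bool" where
  "irreducible_representation H C K \<omega> \<longleftrightarrow> representation H C K \<omega> \<and> (\<exists>a\<in>C. \<omega> a \<noteq> 0) \<and>
     (\<forall>V. closed_csubspace K V \<and> (\<forall>a\<in>C. \<forall>x\<in>V. \<omega> a x \<in> V) \<longrightarrow> V = {0} \<or> V = carr K)"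

text \<open>
  Positivity of the operator on the \<open>m\<close>-fold direct sum of \<open>H\<close> given by an \<open>m \<times> m\<close> matrix of
  operators on \<open>H\<close>. For a matrix over a C*-algebra of operators on \<open>H\<close> this is the same as
  positivity in the C*-algebra of matrices.
\<close>

definition positive_matrix :: "'a::complex_vector hspace \<Rightarrow> nat \<Rightarrow> (nat \<Rightarrow> nat \<Rightarrow> 'a \<Rightarrow> 'a) \<Rightarrow> bool" where
  "positive_matrix H m a \<longleftrightarrow>
     (\<forall>x. (\<forall>i<m. x i \<in> carr H) \<longrightarrow> (\<Sum>i<m. \<Sum>j<m. ip H (a i j (x j)) (x i)) \<in> \<real>\<^sub>\<ge>\<^sub>0)"

definition completely_positive ::
  "'a hspace \<Rightarrow> ('a \<Rightarrow> 'a) set \<Rightarrow> 'b hspace \<Rightarrow> (('a::complex_vector \<Rightarrow> 'a) \<Rightarrow> ('b::complex_vector \<Rightarrow> 'b)) \<Rightarrow> bool" where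
  "completely_positive H C K \<phi> \<longleftrightarrow> linear_into_bop C K \<phi> \<and>
     (\<forall>m a. (\<forall>i<m. \<forall>j<m. a i j \<in> C) \<and> positive_matrix H m a
        \<longrightarrow> positive_matrix K m (\<lambda>i j. \<phi> (a i j)))"

text \<open>
  A map on the C*-algebra generated by \<open>A\<close> is a function on all of \<open>'a \<Rightarrow> 'a\<close> of which only the
  values on that algebra matter; uniqueness of the extension is meant in this sense.
\<close>

definition boundary_representation ::
  "'a hspace \<Rightarrow> ('a \<Rightarrow> 'a) set \<Rightarrow> 'b hspace \<Rightarrow> (('a::complex_vector \<Rightarrow> 'a) \<Rightarrow> ('b::complex_vector \<Rightarrow> 'b)) \<Rightarrow> bool" where
  "boundary_representation H A K \<omega> \<longleftrightarrow> (let C = cstar_gen H A in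
     irreducible_representation H C K \<omega> \<and>
     completely_positive H C K \<omega> \<and>
     (\<forall>\<phi>. completely_positive H C K \<phi> \<and> (\<forall>a\<in>A. \<phi> a = \<omega> a) \<longrightarrow> (\<forall>c\<in>C. \<phi> c = \<omega> c)))"


section \<open>Analytic Hilbert modules on the disc\<close>

abbreviation disc :: "complex set" where
  "disc \<equiv> ball 0 1"

definition positive_definite :: "'x set \<Rightarrow> ('x \<Rightarrow> 'x \<Rightarrow> complex) \<Rightarrow> bool" where
  "positive_definite X k \<longleftrightarrow>
     (\<forall>S c. finite S \<and> S \<subseteq> X \<longrightarrow> (\<Sum>z\<in>S. \<Sum>w\<in>S. cnj (c z) * c w * k z w) \<in> \<real>\<^sub>\<ge>\<^sub>0)"

text \<open>
  Functions on \<open>X\<close> are represented by functions on the type that vanish off \<open>X\<close>. The carrier of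
  the reproducing kernel Hilbert space, and the inner product on it, are determined by \<open>k\<close>.
\<close>

definition rkhs :: "'x set \<Rightarrow> ('x \<Rightarrow> 'x \<Rightarrow> complex) \<Rightarrow> ('x \<Rightarrow> complex) hspace \<Rightarrow> bool" where
  "rkhs X k H \<longleftrightarrow> hilbert H \<and> (\<forall>f\<in>carr H. \<forall>z. z \<notin> X \<longrightarrow> f z = 0) \<and>
     (\<forall>w\<in>X. let kw = (\<lambda>z. if z \<in> X then k z w else 0)
       in kw \<in> carr H \<and> (\<forall>f\<in>carr H. ip H f kw = f w))"

definition Mz :: "(complex \<Rightarrow> complex) hspace \<Rightarrow> (complex \<Rightarrow> complex) \<Rightarrow> complex \<Rightarrow> complex" where
  "Mz H f = (if f \<in> carr H then \<lambda>z. z * f z else 0)"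

definition analytic_hilbert_module ::
  "(complex \<Rightarrow> complex \<Rightarrow> complex) \<Rightarrow> (complex \<Rightarrow> complex) hspace \<Rightarrow> bool" where
  "analytic_hilbert_module k H \<longleftrightarrow>
     positive_definite disc k \<and>
     (\<forall>w\<in>disc. (\<lambda>z. k z w) holomorphic_on disc) \<and>
     (\<forall>z\<in>disc. (\<lambda>w. cnj (k z w)) holomorphic_on disc) \<and>
     rkhs disc k H \<and>
     (\<forall>f\<in>carr H. f holomorphic_on disc) \<and>
     Mz H \<in> bop H H \<and>
     (\<forall>z\<in>disc. \<forall>w\<in>disc. k z w \<noteq> 0) \<and>
     (\<exists>N c. \<forall>z\<in>disc. \<forall>w\<in>disc. 1 / k z w = (\<Sum>p\<le>N. \<Sum>q\<le>N. c p q * z ^ p * cnj w ^ q))"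


section \<open>Hilbert space tensor products\<close>

text \<open>
  \<open>T\<close> with the elementary tensors \<open>\<tau>\<close> is a Hilbert space tensor product of the family \<open>H\<close>; this
  determines \<open>(T, \<tau>)\<close> up to a unitary that respects elementary tensors.
\<close>

definition hilbert_tensor ::
  "'i set \<Rightarrow> ('i \<Rightarrow> 'a::complex_vector hspace) \<Rightarrow> 'b::complex_vector hspace \<Rightarrow> (('i \<Rightarrow> 'a) \<Rightarrow> 'b) \<Rightarrow> bool" where
  "hilbert_tensor I H T \<tau> \<longleftrightarrow> hilbert T \<and>
     (\<forall>f \<in> (\<Pi>\<^sub>E i\<in>I. carr (H i)). \<tau> f \<in> carr T) \<and>
     (\<forall>f \<in> (\<Pi>\<^sub>E i\<in>I. carr (H i)). \<forall>i\<in>I. \<forall>x\<in>carr (H i). \<forall>y\<in>carr (H i).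
        \<tau> (f(i := x + y)) = \<tau> (f(i := x)) + \<tau> (f(i := y))) \<and>
     (\<forall>f \<in> (\<Pi>\<^sub>E i\<in>I. carr (H i)). \<forall>i\<in>I. \<forall>c. \<forall>x\<in>carr (H i).
        \<tau> (f(i := c *\<^sub>C x)) = c *\<^sub>C \<tau> (f(i := x))) \<and>
     (\<forall>f \<in> (\<Pi>\<^sub>E i\<in>I. carr (H i)). \<forall>g \<in> (\<Pi>\<^sub>E i\<in>I. carr (H i)).
        ip T (\<tau> f) (\<tau> g) = (\<Prod>i\<in>I. ip (H i) (f i) (g i))) \<and>
     closed_cspan T (\<tau> ` (\<Pi>\<^sub>E i\<in>I. carr (H i))) = carr T"

definition tensor_subspace ::
  "'i set \<Rightarrow> 'b::complex_vector hspace \<Rightarrow> (('i \<Rightarrow> 'a) \<Rightarrow> 'b) \<Rightarrow> ('i \<Rightarrow> 'a set) \<Rightarrow> 'b set" where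
  "tensor_subspace I T \<tau> V = closed_cspan T (\<tau> ` (\<Pi>\<^sub>E i\<in>I. V i))"

text \<open>The operator \<open>A\<close> acting in the \<open>i\<close>-th tensor factor, and the identity in the others.\<close>

definition tensor_factor_op ::
  "'i set \<Rightarrow> ('i \<Rightarrow> 'a::complex_vector hspace) \<Rightarrow> 'b::complex_vector hspace \<Rightarrow> (('i \<Rightarrow> 'a) \<Rightarrow> 'b)
    \<Rightarrow> 'i \<Rightarrow> ('a \<Rightarrow> 'a) \<Rightarrow> 'b \<Rightarrow> 'b" where
  "tensor_factor_op I H T \<tau> i A =
     (THE B. B \<in> bop T T \<and> (\<forall>f \<in> (\<Pi>\<^sub>E j\<in>I. carr (H j)). B (\<tau> f) = \<tau> (f(i := A (f i)))))"

definition Mzi ::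
  "'i set \<Rightarrow> ('i \<Rightarrow> (complex \<Rightarrow> complex) hspace) \<Rightarrow> 'b::complex_vector hspace
    \<Rightarrow> (('i \<Rightarrow> complex \<Rightarrow> complex) \<Rightarrow> 'b) \<Rightarrow> 'i \<Rightarrow> 'b \<Rightarrow> 'b" where
  "Mzi I H T \<tau> i = tensor_factor_op I H T \<tau> i (Mz (H i))"


section \<open>Quotient modules\<close>

text \<open>
  Below, \<open>M\<close> is a family, indexed by \<open>I\<close>, of operators on \<open>H\<close>; for a module over the polynomials
  in one variable the index set is a singleton.
\<close>

definition quotient_module :: "'i set \<Rightarrow> 'a::complex_vector hspace \<Rightarrow> ('i \<Rightarrow> 'a \<Rightarrow> 'a) \<Rightarrow> 'a set \<Rightarrow> bool" where
  "quotient_module I H M Q \<longleftrightarrow> closed_csubspace H Q \<and> (\<forall>i\<in>I. \<forall>x\<in>orth H Q. M i x \<in> orth H Q)"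

definition doubly_commuting ::
  "'i::linorder set \<Rightarrow> 'a::complex_vector hspace \<Rightarrow> ('i \<Rightarrow> 'a \<Rightarrow> 'a) \<Rightarrow> 'a set \<Rightarrow> bool" where
  "doubly_commuting I H M Q \<longleftrightarrow>
     (let C = \<lambda>i. compression H Q (M i); star = adj (sub_hspace H Q) (sub_hspace H Q)
      in \<forall>i\<in>I. \<forall>j\<in>I. i < j \<longrightarrow> C i \<circ> star (C j) = star (C j) \<circ> C i)"

definition quotient_generators ::
  "'i set \<Rightarrow> 'a::complex_vector hspace \<Rightarrow> ('i \<Rightarrow> 'a \<Rightarrow> 'a) \<Rightarrow> 'a set \<Rightarrow> ('a \<Rightarrow> 'a) set" where
  "quotient_generators I H M Q =
     insert (idop (sub_hspace H Q)) ((\<lambda>i. compression H Q (M i)) ` I)"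

definition quotient_banach_algebra ::
  "'i set \<Rightarrow> 'a::complex_vector hspace \<Rightarrow> ('i \<Rightarrow> 'a \<Rightarrow> 'a) \<Rightarrow> 'a set \<Rightarrow> ('a \<Rightarrow> 'a) set" where
  "quotient_banach_algebra I H M Q = banach_gen (sub_hspace H Q) (quotient_generators I H M Q)"

definition quotient_cstar_algebra ::
  "'i set \<Rightarrow> 'a::complex_vector hspace \<Rightarrow> ('i \<Rightarrow> 'a \<Rightarrow> 'a) \<Rightarrow> 'a set \<Rightarrow> ('a \<Rightarrow> 'a) set" where
  "quotient_cstar_algebra I H M Q = cstar_gen (sub_hspace H Q) (quotient_generators I H M Q)"

lemma cstar_gen_quotient_banach_algebra:
  "cstar_gen (sub_hspace H Q) (quotient_banach_algebra I H M Q) = quotient_cstar_algebra I H M Q"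
  unfolding quotient_banach_algebra_def quotient_cstar_algebra_def by (rule cstar_gen_banach_gen)

text \<open>
  By the preceding lemma the algebra on which the following representation is considered is
  \<^const>\<open>quotient_cstar_algebra\<close>.
\<close>

definition identity_is_boundary ::
  "'i set \<Rightarrow> 'a::complex_vector hspace \<Rightarrow> ('i \<Rightarrow> 'a \<Rightarrow> 'a) \<Rightarrow> 'a set \<Rightarrow> bool" where
  "identity_is_boundary I H M Q \<longleftrightarrow>
     boundary_representation (sub_hspace H Q) (quotient_banach_algebra I H M Q) (sub_hspace H Q) (\<lambda>a. a)"

end

theory Submission
  imports Defs
begin

text \<open>
  Compression to \<open>Q\<close> turns the \<open>M\<^sub>z\<^sub>i\<close> into the amplifications \<open>C\<^sub>i \<otimes> 1\<close>, so only the tensor product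
  of the \<open>Q\<^sub>i\<close> as Hilbert spaces matters. Fix \<open>i\<close>, write the product as \<open>A \<otimes> K\<close> with \<open>A = Q\<^sub>i\<close>, and for
  \<open>\<xi>, \<eta> \<in> K\<close> let the slice of an operator \<open>x\<close> be \<open>W\<^sub>\<xi>\<^sup>* x W\<^sub>\<eta>\<close> with \<open>W\<^sub>\<eta> u = u \<otimes> \<eta>\<close>. Slices of elements of
  \<open>B(Q)\<close> and \<open>C\<^sup>*(Q)\<close> lie in \<open>B(Q\<^sub>i)\<close> and \<open>C\<^sup>*(Q\<^sub>i)\<close>. A completely positive extension \<open>\<phi>\<close> for \<open>Q\<^sub>i\<close>
  can therefore be applied to all slices of an operator, which amplifies it to one for \<open>Q\<close>. Conversely,
  the slices \<open>W\<^sub>\<xi>\<^sup>* \<Phi>(a \<otimes> 1) W\<^sub>\<xi>\<close> of an extension \<open>\<Phi>\<close> for \<open>Q\<close> are extensions for \<open>Q\<^sub>i\<close>, so \<open>\<Phi>\<close> fixes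
  \<open>a \<otimes> 1\<close> for all \<open>a \<in> C\<^sup>*(Q\<^sub>i)\<close>; by multiplicative domains it is the identity. Irreducibility is compared
  through commuting projections: by Schur's lemma the slices of such a projection are scalar.
\<close>

section \<open>Hilbert spaces on a carrier\<close>

text \<open>The C*-algebra of Q is never identified with a tensor product of the factor algebras,
  and no product theory of completely positive maps is used. The amplified map is prescribed by
  matrix coefficients: its value at x between u \<otimes> \<eta> and v \<otimes> \<xi> is that of
  \<phi> at a slice of x, between u and v. Complete positivity of \<phi> on matrices of slices makes
  this form positive; on the 2 by 2 block with diagonal M and off-diagonal entries x, adj x it gives
  the bound M, and a bounded form is an operator.

  Norm bounds for a \<otimes> 1 come from algebra: if M > 0 bounds a, then M^2 - adj a a = adj s s
  for some s, an identity kept by tensoring and by *-representations. The same square root gives the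
  absolute value of R - r in Schur's lemma, in place of a spectral theorem.

  Fixing a generator c does not yet put it in the multiplicative domain: adj c c and c adj c must be
  fixed too. They lie in the C*-algebra of one factor, which is where uniqueness for that factor
  applies.

  In both directions all factors are nonzero, so unit vectors exist to normalize the slices.\<close>

lemma closed_csubspace_csubspace: "closed_csubspace H V \<Longrightarrow> csubspace V"
  by (simp add: closed_csubspace_def)

lemma closed_csubspace_subset: "closed_csubspace H V \<Longrightarrow> V \<subseteq> carr H"
  by (simp add: closed_csubspace_def hclosed_def)

lemma closed_csubspace_lim:
  "closed_csubspace H V \<Longrightarrow> (\<And>m. X m \<in> V) \<Longrightarrow> l \<in> carr H \<Longrightarrow> (\<lambda>m. hnorm H (X m - l)) \<longlonglongrightarrow> 0 \<Longrightarrow> l \<in> V"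
  unfolding closed_csubspace_def hclosed_def by blast

context hilbert
begin

lemma zero_in [simp]: "0 \<in> carr H"
  using subspace by (rule complex_vector.subspace_0)

lemma add_in [simp]: "x \<in> carr H \<Longrightarrow> y \<in> carr H \<Longrightarrow> x + y \<in> carr H"
  using subspace by (rule complex_vector.subspace_add)

lemma scale_in [simp]: "x \<in> carr H \<Longrightarrow> c *\<^sub>C x \<in> carr H"
  using subspace by (rule complex_vector.subspace_scale)

lemma minus_in [simp]: "x \<in> carr H \<Longrightarrow> - x \<in> carr H"
  using subspace by (rule complex_vector.subspace_neg)

lemma diff_in [simp]: "x \<in> carr H \<Longrightarrow> y \<in> carr H \<Longrightarrow> x - y \<in> carr H"
  using subspace by (rule complex_vector.subspace_diff)

lemma sum_in [simp]: "(\<And>i. i \<in> I \<Longrightarrow> f i \<in> carr H) \<Longrightarrow> sum f I \<in> carr H"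
  using subspace by (rule complex_vector.subspace_sum)

lemma ip_zero_left [simp]: "x \<in> carr H \<Longrightarrow> ip H 0 x = 0"
  using ip_scale[of 0 x 0] by simp

lemma ip_zero_right [simp]: "x \<in> carr H \<Longrightarrow> ip H x 0 = 0"
  using ip_cnj[of 0 x] by simp

lemma ip_minus_left [simp]: "x \<in> carr H \<Longrightarrow> y \<in> carr H \<Longrightarrow> ip H (- x) y = - ip H x y"
  using ip_scale[of x y "-1"] by simp

lemma ip_diff_left: "x \<in> carr H \<Longrightarrow> y \<in> carr H \<Longrightarrow> z \<in> carr H \<Longrightarrow> ip H (x - y) z = ip H x z - ip H y z"
  using ip_add[of x "- y" z] by simp

lemma ip_add_right: "x \<in> carr H \<Longrightarrow> y \<in> carr H \<Longrightarrow> z \<in> carr H \<Longrightarrow> ip H x (y + z) = ip H x y + ip H x z"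
  by (metis add_in complex_cnj_add ip_add ip_cnj)

lemma ip_scale_right: "x \<in> carr H \<Longrightarrow> y \<in> carr H \<Longrightarrow> ip H x (c *\<^sub>C y) = cnj c * ip H x y"
  by (metis complex_cnj_mult ip_cnj ip_scale scale_in)

lemma ip_minus_right [simp]: "x \<in> carr H \<Longrightarrow> y \<in> carr H \<Longrightarrow> ip H x (- y) = - ip H x y"
  using ip_scale_right[of x y "-1"] by simp

lemma ip_diff_right: "x \<in> carr H \<Longrightarrow> y \<in> carr H \<Longrightarrow> z \<in> carr H \<Longrightarrow> ip H x (y - z) = ip H x y - ip H x z"
  using ip_add_right[of x y "- z"] by simp

lemma ip_sum_left: "(\<And>i. i \<in> I \<Longrightarrow> f i \<in> carr H) \<Longrightarrow> y \<in> carr H \<Longrightarrow> ip H (sum f I) y = (\<Sum>i\<in>I. ip H (f i) y)"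
  by (induction I rule: infinite_finite_induct) (auto simp: ip_add)

lemma ip_sum_right: "(\<And>i. i \<in> I \<Longrightarrow> f i \<in> carr H) \<Longrightarrow> y \<in> carr H \<Longrightarrow> ip H y (sum f I) = (\<Sum>i\<in>I. ip H y (f i))"
  by (induction I rule: infinite_finite_induct) (auto simp: ip_add_right)

lemmas ip_simps = ip_add ip_add_right ip_scale ip_scale_right ip_diff_left ip_diff_right

lemma ip_lincomb:
  assumes "\<And>s. s \<in> F \<Longrightarrow> x s \<in> carr H" "\<And>t. t \<in> G \<Longrightarrow> y t \<in> carr H"
  shows "ip H (\<Sum>s\<in>F. c s *\<^sub>C x s) (\<Sum>t\<in>G. d t *\<^sub>C y t) = (\<Sum>s\<in>F. \<Sum>t\<in>G. c s * cnj (d t) * ip H (x s) (y t))"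
proof -
  have "ip H (\<Sum>s\<in>F. c s *\<^sub>C x s) (\<Sum>t\<in>G. d t *\<^sub>C y t) = (\<Sum>s\<in>F. ip H (c s *\<^sub>C x s) (\<Sum>t\<in>G. d t *\<^sub>C y t))"
    using assms by (simp add: ip_sum_left)
  also have "\<dots> = (\<Sum>s\<in>F. \<Sum>t\<in>G. ip H (c s *\<^sub>C x s) (d t *\<^sub>C y t))"
    using assms by (intro sum.cong refl ip_sum_right) auto
  also have "\<dots> = (\<Sum>s\<in>F. \<Sum>t\<in>G. c s * cnj (d t) * ip H (x s) (y t))"
    using assms by (intro sum.cong refl) (simp add: ip_scale ip_scale_right)
  finally show ?thesis .
qed

section \<open>Norm, Cauchy-Schwarz and triangle inequality\<close>

lemma hnorm_ge_0 [simp]: "x \<in> carr H \<Longrightarrow> 0 \<le> hnorm H x"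
  using ip_nonneg[of x] by (auto simp: hnorm_def complex_nonneg_Reals_iff)

lemma ip_self: "x \<in> carr H \<Longrightarrow> ip H x x = complex_of_real ((hnorm H x)\<^sup>2)"
  using ip_nonneg[of x] by (auto simp: hnorm_def complex_nonneg_Reals_iff complex_eq_iff)

lemma hnorm_sq: "x \<in> carr H \<Longrightarrow> (hnorm H x)\<^sup>2 = Re (ip H x x)"
  by (simp add: ip_self)

lemma hnorm_zero [simp]: "hnorm H 0 = 0"
  by (simp add: hnorm_def)

lemma hnorm_eq_0: "x \<in> carr H \<Longrightarrow> hnorm H x = 0 \<longleftrightarrow> x = 0"
  using ip_self[of x] ip_eq_0[of x] by auto

lemma hnorm_scale: "x \<in> carr H \<Longrightarrow> hnorm H (c *\<^sub>C x) = cmod c * hnorm H x"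
proof -
  assume x: "x \<in> carr H"
  have "ip H (c *\<^sub>C x) (c *\<^sub>C x) = complex_of_real ((cmod c * hnorm H x)\<^sup>2)"
    using x ip_self[OF x] complex_norm_square[of c] ip_scale[OF x scale_in[OF x], of c c]
    by (simp add: ip_scale_right power_mult_distrib mult.assoc del: of_real_power)
  then have "hnorm H (c *\<^sub>C x) = sqrt ((cmod c * hnorm H x)\<^sup>2)" by (simp only: hnorm_def Re_complex_of_real)
  then show ?thesis using x by simp
qed

lemma hnorm_minus: "x \<in> carr H \<Longrightarrow> hnorm H (- x) = hnorm H x"
  using hnorm_scale[of x "-1"] by simp

lemma hnorm_diff_commute: "x \<in> carr H \<Longrightarrow> y \<in> carr H \<Longrightarrow> hnorm H (x - y) = hnorm H (y - x)"
  using hnorm_minus[of "x - y"] by simp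

lemma ex_unit:
  assumes "carr H \<noteq> {0}"
  shows "\<exists>e\<in>carr H. hnorm H e = 1"
proof -
  obtain x where x: "x \<in> carr H" "x \<noteq> 0" using assms zero_in by blast
  then have "hnorm H x > 0" using hnorm_eq_0[of x] hnorm_ge_0[of x] by linarith
  then show ?thesis using x
    by (intro bexI[of _ "of_real (1 / hnorm H x) *\<^sub>C x"]) (auto simp: hnorm_scale norm_divide)
qed

lemma hnorm_add_sq: "x \<in> carr H \<Longrightarrow> y \<in> carr H \<Longrightarrow>
    (hnorm H (x + y))\<^sup>2 = (hnorm H x)\<^sup>2 + 2 * Re (ip H x y) + (hnorm H y)\<^sup>2"
  by (simp add: hnorm_sq ip_simps ip_cnj[of x y])

lemma hnorm_diff_sq: "x \<in> carr H \<Longrightarrow> y \<in> carr H \<Longrightarrow>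
    (hnorm H (x - y))\<^sup>2 = (hnorm H x)\<^sup>2 - 2 * Re (ip H x y) + (hnorm H y)\<^sup>2"
  using hnorm_add_sq[of x "- y"] by (simp add: hnorm_minus)

lemma Cauchy_Schwarz:
  assumes x: "x \<in> carr H" and y: "y \<in> carr H"
  shows "cmod (ip H x y) \<le> hnorm H x * hnorm H y"
proof (cases "y = 0")
  case True then show ?thesis using x by simp
next
  case False
  then have ny: "hnorm H y > 0" using y hnorm_eq_0[of y] hnorm_ge_0[of y] by linarith
  \<comment> \<open>The orthogonal projection of \<open>x\<close> onto the line through
    \<open>y\<close> is \<open>c *\<^sub>C y\<close>; the inequality says that the remainder has
    nonnegative squared norm.\<close>
  define c where "c = ip H x y / complex_of_real ((hnorm H y)\<^sup>2)"
  have "0 \<le> (hnorm H (x - c *\<^sub>C y))\<^sup>2" by simp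
  also have "\<dots> = (hnorm H x)\<^sup>2 - 2 * Re (cnj c * ip H x y) + (cmod c * hnorm H y)\<^sup>2"
    using x y by (simp add: hnorm_diff_sq hnorm_scale ip_scale_right)
  also have "cnj c * ip H x y = complex_of_real ((cmod (ip H x y))\<^sup>2 / (hnorm H y)\<^sup>2)"
    unfolding c_def using complex_norm_square[of "ip H x y"] by (simp add: mult.commute)
  also have "(cmod c * hnorm H y)\<^sup>2 = (cmod (ip H x y))\<^sup>2 / (hnorm H y)\<^sup>2"
  proof -
    have "cmod c = cmod (ip H x y) / (hnorm H y)\<^sup>2" by (simp add: c_def norm_divide norm_power)
    then have "cmod c * hnorm H y = cmod (ip H x y) / hnorm H y" using ny by (simp add: power2_eq_square)
    then show ?thesis by (simp only: power_divide)
  qed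
  finally have "(cmod (ip H x y))\<^sup>2 / (hnorm H y)\<^sup>2 \<le> (hnorm H x)\<^sup>2" by simp
  then have "(cmod (ip H x y))\<^sup>2 \<le> (hnorm H x * hnorm H y)\<^sup>2"
    using ny by (simp add: pos_divide_le_eq power_mult_distrib)
  then show ?thesis using x y by (intro power2_le_imp_le[of "cmod (ip H x y)"]) auto
qed

lemma hnorm_triangle:
  assumes x: "x \<in> carr H" and y: "y \<in> carr H"
  shows "hnorm H (x + y) \<le> hnorm H x + hnorm H y"
proof (rule power2_le_imp_le)
  have "Re (ip H x y) \<le> hnorm H x * hnorm H y"
    using Cauchy_Schwarz[OF x y] complex_Re_le_cmod[of "ip H x y"] by linarith
  then show "(hnorm H (x + y))\<^sup>2 \<le> (hnorm H x + hnorm H y)\<^sup>2"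
    using x y by (simp add: hnorm_add_sq power2_sum)
qed (use x y in simp)

lemma hnorm_triangle_diff:
  assumes "x \<in> carr H" "y \<in> carr H" "z \<in> carr H"
  shows "hnorm H (x - z) \<le> hnorm H (x - y) + hnorm H (y - z)"
  using hnorm_triangle[of "x - y" "y - z"] assms by simp

lemma hnorm_triangle_le_abs:
  assumes "x \<in> carr H" "y \<in> carr H"
  shows "\<bar>hnorm H x - hnorm H y\<bar> \<le> hnorm H (x - y)"
  using hnorm_triangle[of "x - y" y] hnorm_triangle[of "y - x" x] hnorm_diff_commute[of x y] assms by simp

lemma parallelogram:
  assumes "x \<in> carr H" "y \<in> carr H"
  shows "(hnorm H (x - y))\<^sup>2 = 2 * (hnorm H x)\<^sup>2 + 2 * (hnorm H y)\<^sup>2 - (hnorm H (x + y))\<^sup>2"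
  using assms by (simp add: hnorm_diff_sq hnorm_add_sq)

section \<open>Limits in norm\<close>

lemma ip_tendsto_left:
  assumes X: "\<And>m. X m \<in> carr H" "l \<in> carr H" "(\<lambda>m. hnorm H (X m - l)) \<longlonglongrightarrow> 0" and y: "y \<in> carr H"
  shows "(\<lambda>m. ip H (X m) y) \<longlonglongrightarrow> ip H l y"
proof (rule LIM_zero_cancel, rule Lim_null_comparison)
  show "\<forall>\<^sub>F m in sequentially. norm (ip H (X m) y - ip H l y) \<le> hnorm H (X m - l) * hnorm H y"
    using Cauchy_Schwarz[of "X _ - l" y] X y by (simp add: ip_diff_left)
  show "(\<lambda>m. hnorm H (X m - l) * hnorm H y) \<longlonglongrightarrow> 0"
    using tendsto_mult_right[OF X(3), of "hnorm H y"] by simp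
qed

lemma ip_tendsto_right:
  assumes X: "\<And>m. X m \<in> carr H" "l \<in> carr H" "(\<lambda>m. hnorm H (X m - l)) \<longlonglongrightarrow> 0" and y: "y \<in> carr H"
  shows "(\<lambda>m. ip H y (X m)) \<longlonglongrightarrow> ip H y l"
  using tendsto_cnj[OF ip_tendsto_left[OF assms]] X(1,2) y by (simp add: ip_cnj[symmetric])

lemma ip_tendsto:
  assumes X: "\<And>m. X m \<in> carr H" "l \<in> carr H" "(\<lambda>m. hnorm H (X m - l)) \<longlonglongrightarrow> 0"
    and Y: "\<And>m. Y m \<in> carr H" "k \<in> carr H" "(\<lambda>m. hnorm H (Y m - k)) \<longlonglongrightarrow> 0"
  shows "(\<lambda>m. ip H (X m) (Y m)) \<longlonglongrightarrow> ip H l k"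
proof -
  \<comment> \<open>Joint continuity from separate continuity: expanding the product of differences
    gives \<open>ip H (X m) (Y m)\<close> up to terms whose limits are already known.\<close>
  have "(\<lambda>m. ip H (X m - l) (Y m - k)) \<longlonglongrightarrow> 0"
  proof (rule Lim_null_comparison)
    show "\<forall>\<^sub>F m in sequentially. norm (ip H (X m - l) (Y m - k)) \<le> hnorm H (X m - l) * hnorm H (Y m - k)"
      using Cauchy_Schwarz X Y by simp
    show "(\<lambda>m. hnorm H (X m - l) * hnorm H (Y m - k)) \<longlonglongrightarrow> 0"
      using tendsto_mult[OF X(3) Y(3)] by simp
  qed
  from tendsto_add[OF this tendsto_add[OF ip_tendsto_left[OF X Y(2)] ip_tendsto_right[OF Y X(2)]]]
  have "(\<lambda>m. ip H (X m) (Y m) + ip H l k) \<longlonglongrightarrow> ip H l k + ip H l k"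
    using X Y by (simp add: ip_diff_left ip_diff_right algebra_simps)
  from tendsto_diff[OF this tendsto_const[of "ip H l k"]] show ?thesis by simp
qed

lemma hnorm_tendsto:
  assumes X: "\<And>m. X m \<in> carr H" "l \<in> carr H" "(\<lambda>m. hnorm H (X m - l)) \<longlonglongrightarrow> 0"
  shows "(\<lambda>m. hnorm H (X m)) \<longlonglongrightarrow> hnorm H l"
  by (rule LIM_zero_cancel, rule Lim_null_comparison[OF _ X(3)])
    (use hnorm_triangle_le_abs X in auto)

lemma lim_unique:
  assumes "\<And>m. X m \<in> carr H" "l \<in> carr H" "(\<lambda>m. hnorm H (X m - l)) \<longlonglongrightarrow> 0"
    "k \<in> carr H" "(\<lambda>m. hnorm H (X m - k)) \<longlonglongrightarrow> 0"
  shows "l = k"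
proof -
  have "(\<lambda>m. ip H (X m) (l - k)) \<longlonglongrightarrow> ip H l (l - k)" "(\<lambda>m. ip H (X m) (l - k)) \<longlonglongrightarrow> ip H k (l - k)"
    using assms by (auto intro!: ip_tendsto_left)
  then have "ip H l (l - k) = ip H k (l - k)" by (rule LIMSEQ_unique)
  then have "ip H (l - k) (l - k) = 0" using assms by (simp add: ip_diff_left)
  then show ?thesis using ip_eq_0[of "l - k"] assms by simp
qed

lemma lim_add:
  assumes "\<And>m. X m \<in> carr H" "l \<in> carr H" "(\<lambda>m. hnorm H (X m - l)) \<longlonglongrightarrow> 0"
    "\<And>m. Y m \<in> carr H" "k \<in> carr H" "(\<lambda>m. hnorm H (Y m - k)) \<longlonglongrightarrow> 0"
  shows "(\<lambda>m. hnorm H (X m + Y m - (l + k))) \<longlonglongrightarrow> 0"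
proof (rule Lim_null_comparison)
  show "\<forall>\<^sub>F m in sequentially. norm (hnorm H (X m + Y m - (l + k))) \<le> hnorm H (X m - l) + hnorm H (Y m - k)"
    using hnorm_triangle[of "X _ - l" "Y _ - k"] assms by (simp add: add_diff_add)
  show "(\<lambda>m. hnorm H (X m - l) + hnorm H (Y m - k)) \<longlonglongrightarrow> 0"
    using tendsto_add[OF assms(3) assms(6)] by simp
qed

lemma lim_scale:
  assumes "\<And>m. X m \<in> carr H" "l \<in> carr H" "(\<lambda>m. hnorm H (X m - l)) \<longlonglongrightarrow> 0"
  shows "(\<lambda>m. hnorm H (c *\<^sub>C X m - c *\<^sub>C l)) \<longlonglongrightarrow> 0"
proof -
  have "hnorm H (c *\<^sub>C X m - c *\<^sub>C l) = cmod c * hnorm H (X m - l)" for m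
    using hnorm_scale[of "X m - l" c] assms by (simp add: complex_vector.scale_right_diff_distrib)
  then show ?thesis using tendsto_mult_left[OF assms(3), of "cmod c"] by simp
qed

lemma Cauchy_if_lim:
  assumes X: "\<And>m. X m \<in> carr H" "l \<in> carr H" "(\<lambda>m. hnorm H (X m - l)) \<longlonglongrightarrow> 0" and e: "e > 0"
  shows "\<exists>N. \<forall>p\<ge>N. \<forall>q\<ge>N. hnorm H (X p - X q) < e"
proof -
  obtain N where N: "\<And>p. p \<ge> N \<Longrightarrow> hnorm H (X p - l) < e / 2"
    using order_tendstoD(2)[OF X(3), of "e/2"] e by (auto simp: eventually_sequentially)
  have "hnorm H (X p - X q) < e" if "p \<ge> N" "q \<ge> N" for p q
    using hnorm_triangle_diff[of "X p" l "X q"] hnorm_diff_commute[of l "X q"] N[OF that(1)] N[OF that(2)] X by simp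
  then show ?thesis by blast
qed

section \<open>Closed subspaces and orthogonal projections\<close>

lemma closed_csubspaceI:
  assumes "V \<subseteq> carr H" "0 \<in> V" "\<And>x y. x \<in> V \<Longrightarrow> y \<in> V \<Longrightarrow> x + y \<in> V" "\<And>c x. x \<in> V \<Longrightarrow> c *\<^sub>C x \<in> V"
    "\<And>X l. (\<And>m. X m \<in> V) \<Longrightarrow> l \<in> carr H \<Longrightarrow> (\<lambda>m. hnorm H (X m - l)) \<longlonglongrightarrow> 0 \<Longrightarrow> l \<in> V"
  shows "closed_csubspace H V"
  unfolding closed_csubspace_def hclosed_def complex_vector.subspace_def using assms by blast

lemma closed_csubspace_carr: "closed_csubspace H (carr H)"
  by (rule closed_csubspaceI) auto

lemma orth_closed: "S \<subseteq> carr H \<Longrightarrow> closed_csubspace H (orth H S)"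
proof (rule closed_csubspaceI, goal_cases)
  case (5 X l)
  then have "ip H l y = 0" if "y \<in> S" for y
    using ip_tendsto_left[of X l y] that by (auto simp: orth_def subset_iff LIMSEQ_const_iff)
  with 5 show ?case by (auto simp: orth_def)
qed (auto simp: orth_def ip_simps subset_iff)

text \<open>A sequence in \<open>V\<close> whose distances to \<open>x\<close> approach the infimum
  is Cauchy by the parallelogram law; its limit is nearest to \<open>x\<close>, and minimality makes
  the error orthogonal to \<open>V\<close>.\<close>

lemma projection_exists:
  assumes V: "closed_csubspace H V" and x: "x \<in> carr H"
  shows "\<exists>p\<in>V. x - p \<in> orth H V"
proof -
  have sub: "csubspace V" and VH: "V \<subseteq> carr H" using V by (auto simp: closed_csubspace_def hclosed_def)
  note [simp] = complex_vector.subspace_0[OF sub] complex_vector.subspace_add[OF sub] complex_vector.subspace_scale[OF sub]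
  have VHD [simp]: "v \<in> carr H" if "v \<in> V" for v using VH that by auto
  define d where "d = Inf ((\<lambda>v. (hnorm H (x - v))\<^sup>2) ` V)"
  have bdd: "bdd_below ((\<lambda>v. (hnorm H (x - v))\<^sup>2) ` V)" by (rule bdd_belowI[of _ 0]) auto
  have ne: "(\<lambda>v. (hnorm H (x - v))\<^sup>2) ` V \<noteq> {}" using complex_vector.subspace_0[OF sub] by blast
  have dle: "d \<le> (hnorm H (x - v))\<^sup>2" if "v \<in> V" for v
    unfolding d_def using bdd that by (auto intro: cInf_lower)
  have "\<exists>v\<in>V. (hnorm H (x - v))\<^sup>2 < d + 1 / real (Suc m)" for m
    using cInf_lessD[OF ne, of "d + 1 / real (Suc m)"] unfolding d_def by auto
  then obtain X where XV: "\<And>m. X m \<in> V" and Xd: "\<And>m. (hnorm H (x - X m))\<^sup>2 < d + 1 / real (Suc m)"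
    by metis
  have est: "(hnorm H (X p - X q))\<^sup>2 \<le> 2 / real (Suc p) + 2 / real (Suc q)" for p q
  proof -
    \<comment> \<open>The midpoint stays in \<open>V\<close>, so its distance to \<open>x\<close> is
      bounded below by the infimum; this is the term subtracted in the parallelogram law.\<close>
    define h where "h = (1/2) *\<^sub>C (X p + X q)"
    have hV: "h \<in> V" using XV by (simp add: h_def)
    have "(x - X q) + (x - X p) = 2 *\<^sub>C (x - h)"
    proof -
      have "2 *\<^sub>C h = X p + X q" by (simp add: h_def scaleC_scaleC scaleC_one)
      moreover have "2 *\<^sub>C x = x + x" using scaleC_add_left[of 1 1 x] by (simp add: scaleC_one)
      ultimately show ?thesis by (simp add: complex_vector.scale_right_diff_distrib)
    qed
    then have "hnorm H ((x - X q) + (x - X p)) = 2 * hnorm H (x - h)"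
      using hV x by (simp add: hnorm_scale)
    then have "4 * d \<le> (hnorm H ((x - X q) + (x - X p)))\<^sup>2" using dle[OF hV] by (simp add: power_mult_distrib)
    then have "(hnorm H ((x - X q) - (x - X p)))\<^sup>2 \<le> 2 * (hnorm H (x - X q))\<^sup>2 + 2 * (hnorm H (x - X p))\<^sup>2 - 4 * d"
      using parallelogram[of "x - X q" "x - X p"] XV x by simp
    then show ?thesis using Xd[of p] Xd[of q] by simp
  qed
  have "\<exists>l\<in>carr H. (\<lambda>m. hnorm H (X m - l)) \<longlonglongrightarrow> 0"
  proof (rule complete)
    fix e :: real assume e: "e > 0"
    obtain N where N: "4 / e\<^sup>2 < real N" using reals_Archimedean2 by blast
    have "hnorm H (X p - X q) < e" if "p \<ge> N" "q \<ge> N" for p q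
    proof (rule power2_less_imp_less)
      have "4 < e\<^sup>2 * real N" using N e by (simp add: field_simps)
      have Np: "real N > 0" using N e by (smt (verit) divide_pos_pos zero_less_power)
      have "2 / real (Suc p) + 2 / real (Suc q) \<le> 2 / real N + 2 / real N"
        using that Np by (intro add_mono divide_left_mono) auto
      also have "\<dots> < e\<^sup>2" using \<open>4 < e\<^sup>2 * real N\<close> Np by (simp add: field_simps)
      finally show "(hnorm H (X p - X q))\<^sup>2 < e\<^sup>2" using est[of p q] by simp
    qed (use e in simp)
    then show "\<exists>N. \<forall>p\<ge>N. \<forall>q\<ge>N. hnorm H (X p - X q) < e" by blast
  qed (use XV in simp)
  then obtain l where l: "l \<in> carr H" "(\<lambda>m. hnorm H (X m - l)) \<longlonglongrightarrow> 0" by blast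
  have lV: "l \<in> V" using closed_csubspace_lim[OF V XV l] .
  have dl: "(hnorm H (x - l))\<^sup>2 \<le> d"
  proof (rule LIMSEQ_le)
    have "(\<lambda>m. hnorm H ((x - X m) - (x - l))) \<longlonglongrightarrow> 0"
      using l XV by (simp add: hnorm_diff_commute[of "l"])
    then show "(\<lambda>m. (hnorm H (x - X m))\<^sup>2) \<longlonglongrightarrow> (hnorm H (x - l))\<^sup>2"
      using XV x l by (intro tendsto_power hnorm_tendsto) auto
    show "(\<lambda>m. d + 1 / real (Suc m)) \<longlonglongrightarrow> d"
      using tendsto_add[OF tendsto_const[of d] LIMSEQ_inverse_real_of_nat] by (simp add: inverse_eq_divide)
    show "\<exists>N. \<forall>n\<ge>N. (hnorm H (x - X n))\<^sup>2 \<le> d + 1 / real (Suc n)" using Xd less_imp_le by blast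
  qed
  have "ip H (x - l) v = 0" if v: "v \<in> V" for v
  proof -
    define a where "a = ip H (x - l) v"
    \<comment> \<open>Moving the minimizer \<open>l\<close> by
      \<open>(of_real t * a) *\<^sub>C v\<close> cannot decrease the distance; the gain is of first
      order in \<open>t\<close>, the loss of second order.\<close>
    have key: "2 * (t * (cmod a)\<^sup>2) \<le> t\<^sup>2 * (cmod a)\<^sup>2 * (hnorm H v)\<^sup>2" for t :: real
    proof -
      have "d \<le> (hnorm H (x - (l + (of_real t * a) *\<^sub>C v)))\<^sup>2" using dle lV v by simp
      also have "x - (l + (of_real t * a) *\<^sub>C v) = (x - l) - (of_real t * a) *\<^sub>C v" by simp
      also have "(hnorm H \<dots>)\<^sup>2 = (hnorm H (x - l))\<^sup>2 - 2 * Re (cnj (of_real t * a) * a) + (\<bar>t\<bar> * cmod a * hnorm H v)\<^sup>2"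
        using x l(1) v by (subst hnorm_diff_sq) (auto simp: hnorm_scale ip_scale_right a_def norm_mult)
      also have "cnj (of_real t * a) * a = of_real (t * (cmod a)\<^sup>2)"
        using complex_norm_square[of a] by (simp add: mult.assoc mult.commute[of "cnj a"])
      finally show ?thesis using dl by (simp add: power_mult_distrib)
    qed
    have "a = 0"
    proof (rule ccontr)
      assume "a \<noteq> 0"
      then have a2: "(cmod a)\<^sup>2 > 0" by simp
      \<comment> \<open>Small enough that the second-order term in \<open>key\<close> cannot reach
        the first-order one; the summand 1 covers \<open>v = 0\<close>.\<close>
      define t where "t = 1 / (1 + (hnorm H v)\<^sup>2)"
      have t0: "t > 0" and tv: "t * (hnorm H v)\<^sup>2 < 1" by (auto simp: t_def add_pos_nonneg field_simps)
      have "2 \<le> t * (hnorm H v)\<^sup>2"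
      proof -
        have "(t * (cmod a)\<^sup>2) * 2 \<le> (t * (cmod a)\<^sup>2) * (t * (hnorm H v)\<^sup>2)"
          using key[of t] by (simp add: power2_eq_square mult_ac)
        then show ?thesis using a2 t0 by (simp only: mult_le_cancel_left_pos[OF mult_pos_pos[OF t0 a2]])
      qed
      then show False using tv by simp
    qed
    then show ?thesis by (simp add: a_def)
  qed
  then show ?thesis using lV x l by (auto simp: orth_def intro!: bexI[of _ l])
qed

lemma orth_decomp_unique:
  assumes V: "csubspace V" "V \<subseteq> carr H" and "x \<in> carr H" "p \<in> V" "x - p \<in> orth H V" "q \<in> V" "x - q \<in> orth H V"
  shows "p = q"
proof -
  have pq: "p - q \<in> V" using V assms complex_vector.subspace_diff by blast
  have "ip H (x - p) (p - q) = 0" "ip H (x - q) (p - q) = 0" using assms pq by (auto simp: orth_def)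
  then have "ip H ((x - q) - (x - p)) (p - q) = 0"
    using assms(3) subsetD[OF V(2) assms(4)] subsetD[OF V(2) assms(6)] by (subst ip_diff_left) auto
  then have "ip H (p - q) (p - q) = 0" by simp
  then show ?thesis using ip_eq_0[of "p - q"] pq V(2) by auto
qed

lemma proj_eqI:
  assumes V: "closed_csubspace H V" and "x \<in> carr H" "p \<in> V" "x - p \<in> orth H V"
  shows "proj H V x = p"
proof -
  have "csubspace V" "V \<subseteq> carr H" using V by (auto simp: closed_csubspace_def hclosed_def)
  then have "(THE p. p \<in> V \<and> x - p \<in> orth H V) = p" using assms by (intro the_equality) (auto dest: orth_decomp_unique)
  then show ?thesis using assms by (simp add: proj_def)
qed

lemma proj_props:
  assumes V: "closed_csubspace H V" and x: "x \<in> carr H"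
  shows "proj H V x \<in> V" "x - proj H V x \<in> orth H V"
  using projection_exists[OF assms] proj_eqI[OF assms] by auto

section \<open>Total sets and approximation from the algebraic span\<close>

lemma total_orth_zero:
  assumes tot: "closed_cspan H S = carr H" and S: "S \<subseteq> carr H" and y: "y \<in> carr H" "\<And>s. s \<in> S \<Longrightarrow> ip H y s = 0"
  shows "y = 0"
proof -
  have "S \<subseteq> orth H {y}" using S y by (auto simp: orth_def ip_cnj[of y])
  then have "carr H \<subseteq> orth H {y}" using orth_closed[of "{y}"] y(1) tot unfolding closed_cspan_def by blast
  then have "ip H y y = 0" using y by (auto simp: orth_def)
  then show ?thesis using ip_eq_0 y by blast
qed

lemma closed_csubspace_cspan:
  assumes "S \<subseteq> carr H" shows "closed_csubspace H (closed_cspan H S)"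
proof (rule closed_csubspaceI)
  show "closed_cspan H S \<subseteq> carr H" using closed_csubspace_carr assms by (auto simp: closed_cspan_def)
next
  fix X l assume "\<And>m. X m \<in> closed_cspan H S" "l \<in> carr H" "(\<lambda>m. hnorm H (X m - l)) \<longlonglongrightarrow> 0"
  then show "l \<in> closed_cspan H S" unfolding closed_cspan_def by (blast intro: closed_csubspace_lim)
qed (auto simp: closed_cspan_def closed_csubspace_def complex_vector.subspace_def)

text \<open>The part of a vector orthogonal to the closed span is orthogonal to \<open>S\<close>,
  hence zero.\<close>

lemma total_if_orth_zero:
  assumes S: "S \<subseteq> carr H" and *: "\<And>y. y \<in> carr H \<Longrightarrow> (\<And>s. s \<in> S \<Longrightarrow> ip H y s = 0) \<Longrightarrow> y = 0"
  shows "closed_cspan H S = carr H"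
proof -
  let ?V = "closed_cspan H S"
  have cl: "closed_csubspace H ?V" using closed_csubspace_cspan[OF S] .
  have sub: "S \<subseteq> ?V" by (auto simp: closed_cspan_def)
  have "x \<in> ?V" if x: "x \<in> carr H" for x
  proof -
    have p: "proj H ?V x \<in> ?V" "x - proj H ?V x \<in> orth H ?V" using proj_props[OF cl x] by auto
    then have "x - proj H ?V x = 0" using sub by (intro *) (auto simp: orth_def)
    with p show ?thesis by simp
  qed
  moreover have "?V \<subseteq> carr H" using cl by (auto simp: closed_csubspace_def hclosed_def)
  ultimately show ?thesis by blast
qed

text \<open>\<open>closed_cspan\<close> is an intersection and offers no approximants. The vectors
  approximable from the algebraic span form a closed subspace containing \<open>S\<close>, which
  supplies them.\<close>

lemma dense_span:
  assumes tot: "closed_cspan H S = carr H" and S: "S \<subseteq> carr H" and x: "x \<in> carr H"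
  shows "\<exists>X. (\<forall>m. X m \<in> complex_vector.span S) \<and> (\<lambda>m. hnorm H (X m - x)) \<longlonglongrightarrow> 0"
proof -
  let ?D = "complex_vector.span S"
  let ?V = "{x \<in> carr H. \<forall>e>0. \<exists>d\<in>?D. hnorm H (x - d) < e}"
  have DH: "?D \<subseteq> carr H" using S subspace by (rule complex_vector.span_minimal)
  note [simp] = subsetD[OF DH]
  have V: "closed_csubspace H ?V"
  proof (rule closed_csubspaceI, goal_cases)
    case 2
    then show ?case by (auto intro!: bexI[of _ 0] complex_vector.span_zero)
  next
    case (3 x y)
    have "\<exists>d\<in>?D. hnorm H (x + y - d) < e" if e: "e > 0" for e
    proof -
      obtain d d' where d: "d \<in> ?D" "hnorm H (x - d) < e/2" "d' \<in> ?D" "hnorm H (y - d') < e/2"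
        using 3 half_gt_zero[OF e] by blast
      then show ?thesis using hnorm_triangle[of "x - d" "y - d'"] 3
        by (intro bexI[of _ "d + d'"]) (auto simp: complex_vector.span_add add_diff_add)
    qed
    then show ?case using 3 by auto
  next
    case (4 c x)
    have "\<exists>d\<in>?D. hnorm H (c *\<^sub>C x - d) < e" if e: "e > 0" for e
    proof -
      obtain d where d: "d \<in> ?D" "hnorm H (x - d) < e / (cmod c + 1)"
        using 4 e by (smt (verit, ccfv_threshold) divide_pos_pos mem_Collect_eq norm_ge_zero)
      have "hnorm H (c *\<^sub>C (x - d)) \<le> (cmod c + 1) * hnorm H (x - d)"
        using d 4 by (subst hnorm_scale) (auto intro!: mult_right_mono)
      also have "\<dots> < e" using d(2) by (simp add: field_simps add_pos_nonneg)
      finally show ?thesis using d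
        by (intro bexI[of _ "c *\<^sub>C d"]) (auto simp: complex_vector.span_scale complex_vector.scale_right_diff_distrib)
    qed
    then show ?case using 4 by auto
  next
    case (5 X l)
    have "\<exists>d\<in>?D. hnorm H (l - d) < e" if e: "e > 0" for e
    proof -
      obtain m where m: "hnorm H (X m - l) < e/2"
        using order_tendstoD(2)[OF 5(3), of "e/2"] e by (auto simp: eventually_sequentially)
      obtain d where "d \<in> ?D" "hnorm H (X m - d) < e/2" using 5(1)[of m] half_gt_zero[OF e] by blast
      then show ?thesis using hnorm_triangle_diff[of l "X m" d] hnorm_diff_commute[of l "X m"] m 5(1)[of m] 5(2)
        by (intro bexI[of _ d]) auto
    qed
    then show ?case using 5 by auto
  qed auto
  have "S \<subseteq> ?V"
    using S by (auto intro!: bexI complex_vector.span_base)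
  then have "x \<in> ?V" using tot V x unfolding closed_cspan_def by blast
  then have "\<exists>d\<in>?D. hnorm H (x - d) < 1 / real (Suc m)" for m by auto
  then obtain X where X: "\<And>m. X m \<in> ?D" "\<And>m. hnorm H (x - X m) < 1 / real (Suc m)" by metis
  have "(\<lambda>m. hnorm H (X m - x)) \<longlonglongrightarrow> 0"
  proof (rule Lim_null_comparison)
    show "\<forall>\<^sub>F m in sequentially. norm (hnorm H (X m - x)) \<le> inverse (real (Suc m))"
      using X x by (simp add: hnorm_diff_commute[of _ x] less_imp_le inverse_eq_divide)
  qed (rule LIMSEQ_inverse_real_of_nat)
  with X show ?thesis by blast
qed

end

section \<open>Bounded operators\<close>

text \<open>Pairs are made a vector space so that the graph of an operator prescribed on a set has a
  linear span, as \<open>bop_extension\<close> requires.\<close>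

instantiation prod :: (complex_vector, complex_vector) complex_vector
begin
definition scaleC_prod :: "complex \<Rightarrow> 'a \<times> 'b \<Rightarrow> 'a \<times> 'b" where
  "scaleC_prod c p = (c *\<^sub>C fst p, c *\<^sub>C snd p)"
instance
  by standard (simp_all add: scaleC_prod_def scaleC_add_right scaleC_add_left scaleC_scaleC scaleC_one)
end

text \<open>The scalars as a Hilbert space, so that bounded functionals are elements of
  \<open>bop\<close> and share the lemmas on operators.\<close>

definition complex_hspace :: "complex hspace" where
  "complex_hspace = \<lparr>carr = UNIV, ip = \<lambda>x y. x * cnj y\<rparr>"

lemma hnorm_complex [simp]: "hnorm complex_hspace x = cmod x"
  using complex_norm_square[of x] by (simp add: hnorm_def complex_hspace_def cmod_def power2_eq_square)

lemma hilbert_complex: "hilbert complex_hspace"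
proof
  fix X :: "nat \<Rightarrow> complex" 
  assume "\<And>e. e > 0 \<Longrightarrow> \<exists>N. \<forall>p\<ge>N. \<forall>q\<ge>N. hnorm complex_hspace (X p - X q) < e"
  then have "Cauchy X" by (auto simp: Cauchy_def dist_norm)
  then obtain l where "X \<longlonglongrightarrow> l" using Cauchy_convergent convergent_def by blast
  then show "\<exists>l\<in>carr complex_hspace. (\<lambda>m. hnorm complex_hspace (X m - l)) \<longlonglongrightarrow> 0"
    by (auto simp: complex_hspace_def LIM_zero_iff tendsto_norm_zero_iff hnorm_complex[unfolded complex_hspace_def] intro!: exI[of _ l])
qed (auto simp: complex_hspace_def complex_vector.subspace_def algebra_simps scaleC_complex_def
      complex_norm_square[symmetric] complex_nonneg_Reals_iff)

section \<open>The algebra of bounded operators\<close>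

lemma bop_in: "A \<in> bop H K \<Longrightarrow> x \<in> carr H \<Longrightarrow> A x \<in> carr K"
  by (simp add: bop_def)

lemma bop_add: "A \<in> bop H K \<Longrightarrow> x \<in> carr H \<Longrightarrow> y \<in> carr H \<Longrightarrow> A (x + y) = A x + A y"
  by (simp add: bop_def)

lemma bop_scale: "A \<in> bop H K \<Longrightarrow> x \<in> carr H \<Longrightarrow> A (c *\<^sub>C x) = c *\<^sub>C A x"
  by (simp add: bop_def)

lemma bop_off: "A \<in> bop H K \<Longrightarrow> x \<notin> carr H \<Longrightarrow> A x = 0"
  by (simp add: bop_def)

lemma bop_zero: "hilbert H \<Longrightarrow> A \<in> bop H K \<Longrightarrow> A 0 = 0"
  using bop_scale[of A H K 0 0] hilbert.zero_in[of H] by simp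

lemma bop_minus: "A \<in> bop H K \<Longrightarrow> x \<in> carr H \<Longrightarrow> A (- x) = - A x"
  using bop_scale[of A H K x "-1"] by simp

lemma bop_diff: "hilbert H \<Longrightarrow> A \<in> bop H K \<Longrightarrow> x \<in> carr H \<Longrightarrow> y \<in> carr H \<Longrightarrow> A (x - y) = A x - A y"
  using bop_add[of A H K x "- y"] bop_minus[of A H K y] hilbert.minus_in[of H y] by simp

lemma bop_sum: "hilbert H \<Longrightarrow> A \<in> bop H K \<Longrightarrow> (\<And>i. i \<in> I \<Longrightarrow> f i \<in> carr H) \<Longrightarrow> A (sum f I) = (\<Sum>i\<in>I. A (f i))"
  by (induction I rule: infinite_finite_induct) (auto simp: bop_zero bop_add hilbert.sum_in)

lemma bop_boundE:
  assumes "A \<in> bop H K" "hilbert H"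
  obtains B where "B > 0" "\<And>x. x \<in> carr H \<Longrightarrow> hnorm K (A x) \<le> B * hnorm H x"
proof -
  obtain B where B: "\<forall>x\<in>carr H. hnorm K (A x) \<le> B * hnorm H x" using assms by (auto simp: bop_def)
  have "hnorm K (A x) \<le> (\<bar>B\<bar> + 1) * hnorm H x" if x: "x \<in> carr H" for x
  proof -
    have "B * hnorm H x \<le> (\<bar>B\<bar> + 1) * hnorm H x" using hilbert.hnorm_ge_0[OF assms(2) x] by (intro mult_right_mono) auto
    then show ?thesis using B x by force
  qed
  then show ?thesis using that[of "\<bar>B\<bar> + 1"] by force
qed

lemma bopI:
  assumes "\<And>x. x \<in> carr H \<Longrightarrow> A x \<in> carr K"
    "\<And>x y. x \<in> carr H \<Longrightarrow> y \<in> carr H \<Longrightarrow> A (x + y) = A x + A y"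
    "\<And>c x. x \<in> carr H \<Longrightarrow> A (c *\<^sub>C x) = c *\<^sub>C A x"
    "\<And>x. x \<in> carr H \<Longrightarrow> hnorm K (A x) \<le> B * hnorm H x"
    "\<And>x. x \<notin> carr H \<Longrightarrow> A x = 0"
  shows "A \<in> bop H K"
  unfolding bop_def using assms by blast

lemma bop_ext: "A \<in> bop H K \<Longrightarrow> B \<in> bop H K \<Longrightarrow> (\<And>x. x \<in> carr H \<Longrightarrow> A x = B x) \<Longrightarrow> A = B"
  by (rule ext) (metis bop_off)

lemma bop_idop: "hilbert H \<Longrightarrow> idop H \<in> bop H H"
  by (rule bopI[where B = 1]) (auto simp: idop_def hilbert.add_in hilbert.scale_in)

lemma idop_eq: "x \<in> carr H \<Longrightarrow> idop H x = x"
  by (simp add: idop_def)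

lemma scaleC_apply: "(c *\<^sub>C f) x = c *\<^sub>C f x"
  by (simp add: scaleC_fun_def)

lemma bop_zero_fun: "hilbert H \<Longrightarrow> hilbert K \<Longrightarrow> 0 \<in> bop H K"
  by (rule bopI[where B = 0]) (auto simp: hilbert.zero_in hilbert.hnorm_zero)

lemma bop_plus:
  assumes H: "hilbert H" and K: "hilbert K" and A: "A \<in> bop H K" and B: "B \<in> bop H K"
  shows "A + B \<in> bop H K"
proof -
  obtain a where a: "\<And>x. x \<in> carr H \<Longrightarrow> hnorm K (A x) \<le> a * hnorm H x" using bop_boundE[OF A H] by blast
  obtain b where b: "\<And>x. x \<in> carr H \<Longrightarrow> hnorm K (B x) \<le> b * hnorm H x" using bop_boundE[OF B H] by blast
  have "hnorm K (A x + B x) \<le> (a + b) * hnorm H x" if x: "x \<in> carr H" for x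
    using hilbert.hnorm_triangle[OF K bop_in[OF A x] bop_in[OF B x]] a[OF x] b[OF x] by (simp add: distrib_right)
  then show ?thesis
    by (intro bopI[where B = "a + b"])
      (auto simp: hilbert.add_in[OF K] bop_in[OF A] bop_in[OF B] bop_add[OF A] bop_add[OF B]
        bop_scale[OF A] bop_scale[OF B] scaleC_add_right bop_off[OF A] bop_off[OF B])
qed

lemma bop_scaleC:
  assumes H: "hilbert H" and K: "hilbert K" and A: "A \<in> bop H K"
  shows "c *\<^sub>C A \<in> bop H K"
proof -
  obtain a where a: "\<And>x. x \<in> carr H \<Longrightarrow> hnorm K (A x) \<le> a * hnorm H x" using bop_boundE[OF A H] by blast
  have "hnorm K (c *\<^sub>C A x) \<le> (cmod c * a) * hnorm H x" if x: "x \<in> carr H" for x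
    using mult_left_mono[OF a[OF x], of "cmod c"] bop_in[OF A x] by (simp add: hilbert.hnorm_scale[OF K] mult.assoc)
  then show ?thesis
    by (intro bopI[where B = "cmod c * a"])
      (auto simp: scaleC_fun_def hilbert.scale_in[OF K] bop_in[OF A] bop_add[OF A]
        bop_scale[OF A] scaleC_add_right bop_off[OF A] scaleC_scaleC mult.commute)
qed

lemma bop_csubspace: "hilbert H \<Longrightarrow> hilbert K \<Longrightarrow> csubspace (bop H K)"
  by (simp add: complex_vector.subspace_def bop_zero_fun bop_plus bop_scaleC)

lemma bop_diff_fun: "hilbert H \<Longrightarrow> hilbert K \<Longrightarrow> A \<in> bop H K \<Longrightarrow> B \<in> bop H K \<Longrightarrow> A - B \<in> bop H K"
  by (rule complex_vector.subspace_diff[OF bop_csubspace])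

lemma bop_comp:
  assumes H: "hilbert H" and K: "hilbert K" and L: "hilbert L" and A: "A \<in> bop K L" and B: "B \<in> bop H K"
  shows "A \<circ> B \<in> bop H L"
proof -
  obtain a where a: "a > 0" "\<And>x. x \<in> carr K \<Longrightarrow> hnorm L (A x) \<le> a * hnorm K x" using bop_boundE[OF A K] by blast
  obtain b where b: "\<And>x. x \<in> carr H \<Longrightarrow> hnorm K (B x) \<le> b * hnorm H x" using bop_boundE[OF B H] by blast
  have "hnorm L (A (B x)) \<le> (a * b) * hnorm H x" if x: "x \<in> carr H" for x
    using order_trans[OF a(2)[OF bop_in[OF B x]] mult_left_mono[OF b[OF x]]] a(1) by (simp add: mult.assoc)
  then show ?thesis
    by (intro bopI[where B = "a * b"])
      (auto simp: bop_in[OF A] bop_in[OF B] bop_add[OF A] bop_add[OF B] bop_scale[OF A] bop_scale[OF B]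
        bop_off[OF B] bop_zero[OF K A])
qed

lemma bop_comp_add_right:
  assumes "B \<in> bop H K" "C \<in> bop H K" "A \<in> bop K L" "hilbert K"
  shows "A \<circ> (B + C) = (A \<circ> B) + (A \<circ> C)"
proof
  fix x show "(A \<circ> (B + C)) x = ((A \<circ> B) + (A \<circ> C)) x"
    using assms by (cases "x \<in> carr H") (auto simp: bop_add bop_in bop_off bop_zero)
qed

lemma bop_comp_scale_right:
  assumes "B \<in> bop H K" "A \<in> bop K L" "hilbert K"
  shows "A \<circ> (c *\<^sub>C B) = c *\<^sub>C (A \<circ> B)"
proof
  fix x show "(A \<circ> (c *\<^sub>C B)) x = (c *\<^sub>C (A \<circ> B)) x"
    using assms by (cases "x \<in> carr H") (auto simp: bop_scale bop_in bop_off bop_zero scaleC_fun_def)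
qed

lemma comp_add_left: "(A + B) \<circ> C = (A \<circ> C) + (B \<circ> C)" for A B :: "'a \<Rightarrow> 'b::complex_vector"
  by (auto simp: fun_eq_iff)

lemma comp_scale_left: "(c *\<^sub>C A) \<circ> C = c *\<^sub>C (A \<circ> C)" for A :: "'a \<Rightarrow> 'b::complex_vector"
  by (auto simp: fun_eq_iff scaleC_fun_def)

lemma comp_diff_left: "(A - B) \<circ> C = (A \<circ> C) - (B \<circ> C)" for A B :: "'a \<Rightarrow> 'b::complex_vector"
  by (auto simp: fun_eq_iff)

lemma bop_comp_diff_right:
  assumes "B \<in> bop H K" "C \<in> bop H K" "A \<in> bop K L" "hilbert K"
  shows "A \<circ> (B - C) = (A \<circ> B) - (A \<circ> C)"
proof
  fix x show "(A \<circ> (B - C)) x = ((A \<circ> B) - (A \<circ> C)) x"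
    using assms by (cases "x \<in> carr H") (auto simp: bop_diff bop_in bop_off bop_zero)
qed

lemma idop_comp [simp]: "B \<in> bop H K \<Longrightarrow> hilbert K \<Longrightarrow> idop K \<circ> B = B"
  by (rule ext) (auto simp: idop_def bop_def hilbert.zero_in)

lemma comp_idop [simp]: "B \<in> bop H K \<Longrightarrow> hilbert H \<Longrightarrow> B \<circ> idop H = B"
  by (rule ext) (auto simp: idop_def bop_off bop_zero)

lemma bop_tendsto:
  assumes H: "hilbert H" and K: "hilbert K" and A: "A \<in> bop H K"
    and X: "\<And>m. X m \<in> carr H" "l \<in> carr H" "(\<lambda>m. hnorm H (X m - l)) \<longlonglongrightarrow> 0"
  shows "(\<lambda>m. hnorm K (A (X m) - A l)) \<longlonglongrightarrow> 0"
proof -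
  obtain a where a: "\<And>x. x \<in> carr H \<Longrightarrow> hnorm K (A x) \<le> a * hnorm H x" using bop_boundE[OF A H] by blast
  show ?thesis
  proof (rule Lim_null_comparison)
    have "hnorm K (A (X m) - A l) \<le> a * hnorm H (X m - l)" for m
      using a[of "X m - l"] X by (simp add: bop_diff[OF H A] hilbert.diff_in[OF H])
    then show "\<forall>\<^sub>F m in sequentially. norm (hnorm K (A (X m) - A l)) \<le> a * hnorm H (X m - l)"
      using X by (simp add: hilbert.hnorm_ge_0[OF K] hilbert.diff_in[OF K] bop_in[OF A])
    show "(\<lambda>m. a * hnorm H (X m - l)) \<longlonglongrightarrow> 0" using tendsto_mult_left[OF X(3), of a] by simp
  qed
qed

section \<open>The operator norm\<close>

lemma opnorm_bdd:
  assumes H: "hilbert H" and K: "hilbert K" and A: "A \<in> bop H K"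
  shows "bdd_above {hnorm K (A x) | x. x \<in> carr H \<and> hnorm H x \<le> 1}"
proof -
  obtain a where a: "a > 0" "\<And>x. x \<in> carr H \<Longrightarrow> hnorm K (A x) \<le> a * hnorm H x" using bop_boundE[OF A H] by blast
  have "hnorm K (A x) \<le> a" if "x \<in> carr H" "hnorm H x \<le> 1" for x
    using a(2)[OF that(1)] mult_left_mono[OF that(2), of a] a(1) by linarith
  then show ?thesis by (intro bdd_aboveI[of _ a]) auto
qed

lemma opnorm_ge_0:
  assumes H: "hilbert H" and K: "hilbert K" and A: "A \<in> bop H K"
  shows "0 \<le> opnorm H K A"
proof -
  have "hnorm K (A 0) \<le> opnorm H K A"
    unfolding opnorm_def by (rule cSup_upper[OF _ opnorm_bdd[OF assms]]) (use H in \<open>auto simp: hilbert.zero_in hilbert.hnorm_zero\<close>)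
  then show ?thesis using H K A by (simp add: bop_zero hilbert.hnorm_zero)
qed

lemma opnorm_bound:
  assumes H: "hilbert H" and K: "hilbert K" and A: "A \<in> bop H K" and x: "x \<in> carr H"
  shows "hnorm K (A x) \<le> opnorm H K A * hnorm H x"
proof (cases "x = 0")
  case True then show ?thesis using H K A by (simp add: bop_zero hilbert.hnorm_zero)
next
  case False
  then have n: "hnorm H x > 0" using hilbert.hnorm_eq_0[OF H x] hilbert.hnorm_ge_0[OF H x] by linarith
  let ?y = "complex_of_real (1 / hnorm H x) *\<^sub>C x"
  have "hnorm K (A ?y) \<le> opnorm H K A" unfolding opnorm_def
    by (rule cSup_upper[OF _ opnorm_bdd[OF H K A]], rule CollectI, rule exI[of _ ?y])
      (use x n in \<open>auto simp: hilbert.scale_in[OF H] hilbert.hnorm_scale[OF H] norm_divide\<close>)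
  also have "hnorm K (A ?y) = hnorm K (A x) / hnorm H x"
    using x n bop_in[OF A x] by (simp add: bop_scale[OF A x] hilbert.hnorm_scale[OF K] norm_divide)
  finally show ?thesis using n by (simp add: pos_divide_le_eq)
qed

lemma opnorm_le:
  assumes H: "hilbert H" and B: "\<And>x. x \<in> carr H \<Longrightarrow> hnorm K (A x) \<le> B * hnorm H x" "B \<ge> 0"
  shows "opnorm H K A \<le> B"
  unfolding opnorm_def
proof (rule cSup_least)
  show "{hnorm K (A x) |x. x \<in> carr H \<and> hnorm H x \<le> 1} \<noteq> {}"
    using hilbert.zero_in[OF H] hilbert.hnorm_zero[OF H] by force
  fix y assume "y \<in> {hnorm K (A x) |x. x \<in> carr H \<and> hnorm H x \<le> 1}"
  then obtain x where x: "x \<in> carr H" "hnorm H x \<le> 1" "y = hnorm K (A x)" by blast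
  then show "y \<le> B" using B(1)[OF x(1)] mult_left_mono[OF x(2) B(2)] by simp
qed

lemma opnorm_comp_le:
  assumes H: "hilbert H" and K: "hilbert K" and L: "hilbert L" and A: "A \<in> bop K L" and B: "B \<in> bop H K"
  shows "opnorm H L (A \<circ> B) \<le> opnorm K L A * opnorm H K B"
proof (rule opnorm_le[OF H])
  fix x assume x: "x \<in> carr H"
  show "hnorm L ((A \<circ> B) x) \<le> opnorm K L A * opnorm H K B * hnorm H x"
    using opnorm_bound[OF K L A bop_in[OF B x]] mult_left_mono[OF opnorm_bound[OF H K B x] opnorm_ge_0[OF K L A]]
    by (simp add: mult.assoc)
qed (use assms in \<open>simp add: opnorm_ge_0\<close>)

lemma opnorm_tendsto_pointwise:
  assumes H: "hilbert H" and K: "hilbert K" and X: "\<And>m. X m \<in> bop H K" "l \<in> bop H K"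
    and lim: "(\<lambda>m. opnorm H K (X m - l)) \<longlonglongrightarrow> 0" and x: "x \<in> carr H"
  shows "(\<lambda>m. hnorm K (X m x - l x)) \<longlonglongrightarrow> 0"
proof (rule Lim_null_comparison)
  show "\<forall>\<^sub>F m in sequentially. norm (hnorm K (X m x - l x)) \<le> opnorm H K (X m - l) * hnorm H x"
    using opnorm_bound[OF H K bop_diff_fun[OF H K X] x] hilbert.hnorm_ge_0[OF K hilbert.diff_in[OF K bop_in[OF X(1) x] bop_in[OF X(2) x]]]
    by simp
  show "(\<lambda>m. opnorm H K (X m - l) * hnorm H x) \<longlonglongrightarrow> 0" using tendsto_mult_right[OF lim, of "hnorm H x"] by simp
qed

section \<open>Operators compared or defined on total sets\<close>

lemma bop_eqI_total:
  assumes H: "hilbert H" and K: "hilbert K" and A: "A \<in> bop H K" and B: "B \<in> bop H K"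
    and S: "S \<subseteq> carr H" "closed_cspan H S = carr H" and eq: "\<And>x. x \<in> S \<Longrightarrow> A x = B x"
  shows "A = B"
proof (rule bop_ext[OF A B])
  fix x assume x: "x \<in> carr H"
  have "closed_csubspace H {x \<in> carr H. A x = B x}"
  proof (rule hilbert.closed_csubspaceI[OF H], goal_cases)
    case (5 X l)
    have "A l = B l"
      by (rule hilbert.lim_unique[OF K, of "\<lambda>m. A (X m)"])
        (use 5 bop_tendsto[OF H K A, of X l] bop_tendsto[OF H K B, of X l] in \<open>auto simp: bop_in[OF A] bop_in[OF B]\<close>)
    with 5 show ?case by simp
  qed (auto simp: hilbert.zero_in[OF H] hilbert.add_in[OF H] hilbert.scale_in[OF H] bop_zero[OF H A] bop_zero[OF H B]
      bop_add[OF A] bop_add[OF B] bop_scale[OF A] bop_scale[OF B])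
  then have "carr H \<subseteq> {x \<in> carr H. A x = B x}" using S eq unfolding closed_cspan_def by blast
  then show "A x = B x" using x by blast
qed

lemma bop_eqI_ip:
  assumes H: "hilbert H" and K: "hilbert K" and A: "A \<in> bop H K" and B: "B \<in> bop H K"
    and S: "S \<subseteq> carr H" "closed_cspan H S = carr H" and S': "S' \<subseteq> carr K" "closed_cspan K S' = carr K"
    and eq: "\<And>x y. x \<in> S \<Longrightarrow> y \<in> S' \<Longrightarrow> ip K (A x) y = ip K (B x) y"
  shows "A = B"
proof (rule bop_eqI_total[OF H K A B S])
  fix x assume "x \<in> S"
  then have *: "A x \<in> carr K" "B x \<in> carr K" using S(1) bop_in[OF A] bop_in[OF B] by auto
  then have "A x - B x = 0"
    using eq[OF \<open>x \<in> S\<close>] S'(1) by (intro hilbert.total_orth_zero[OF K S'(2) S'(1)]) (auto simp: hilbert.diff_in[OF K] hilbert.ip_diff_left[OF K] subset_iff)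
  then show "A x = B x" by simp
qed

lemma closed_cspan_carr: "hilbert H \<Longrightarrow> closed_cspan H (carr H) = carr H"
  using hilbert.closed_csubspace_carr[of H] by (auto simp: closed_cspan_def)

lemma closed_cspan_mono:
  assumes H: "hilbert H" and S: "S \<subseteq> S'" "S' \<subseteq> carr H" and tot: "closed_cspan H S = carr H"
  shows "closed_cspan H S' = carr H"
  using S(1) tot closed_csubspace_subset[OF hilbert.closed_csubspace_cspan[OF H S(2)]]
  unfolding closed_cspan_def by blast

lemma bop_eqI_ip':
  assumes H: "hilbert H" and K: "hilbert K" and A: "A \<in> bop H K" and B: "B \<in> bop H K"
    and eq: "\<And>x y. x \<in> carr H \<Longrightarrow> y \<in> carr K \<Longrightarrow> ip K (A x) y = ip K (B x) y"
  shows "A = B"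
  by (rule bop_eqI_ip[OF H K A B subset_refl closed_cspan_carr[OF H] subset_refl closed_cspan_carr[OF K] eq])

text \<open>The operator is the closure of its graph on the span.\<close>

lemma bop_extension:
  fixes G :: "('a::complex_vector \<times> 'b::complex_vector) set"
  assumes H: "hilbert H" and K: "hilbert K" and G: "G \<subseteq> carr H \<times> carr K"
    and tot: "closed_cspan H (fst ` G) = carr H"
    and bd: "\<And>x y. (x, y) \<in> complex_vector.span G \<Longrightarrow> hnorm K y \<le> B * hnorm H x"
  shows "\<exists>A\<in>bop H K. (\<forall>(x, y)\<in>G. A x = y) \<and> (\<forall>x\<in>carr H. hnorm K (A x) \<le> B * hnorm H x)"
proof -
  interpret H: hilbert H by (rule H)
  interpret K: hilbert K by (rule K)
  let ?P = "complex_vector.span G"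
  have "csubspace (carr H \<times> carr K)"
    by (auto simp: complex_vector.subspace_def zero_prod_def scaleC_prod_def)
  then have PHK: "?P \<subseteq> carr H \<times> carr K" using G by (intro complex_vector.span_minimal)
  have PH: "x \<in> carr H" "y \<in> carr K" if "(x, y) \<in> ?P" for x y using PHK that by auto
  have Padd: "(x + x', y + y') \<in> ?P" if "(x, y) \<in> ?P" "(x', y') \<in> ?P" for x y x' y'
    using complex_vector.span_add[OF that] by simp
  have Pscale: "(c *\<^sub>C x, c *\<^sub>C y) \<in> ?P" if "(x, y) \<in> ?P" for c x y
    using complex_vector.span_scale[OF that, of c] by (simp add: scaleC_prod_def)
  have Pdiff: "(x - x', y - y') \<in> ?P" if "(x, y) \<in> ?P" "(x', y') \<in> ?P" for x y x' y'
    using complex_vector.span_diff[OF that] by simp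
  define Cl where "Cl x y \<longleftrightarrow> x \<in> carr H \<and> y \<in> carr K \<and> (\<exists>X Y. (\<forall>m. (X m, Y m) \<in> ?P) \<and>
      (\<lambda>m. hnorm H (X m - x)) \<longlonglongrightarrow> 0 \<and> (\<lambda>m. hnorm K (Y m - y)) \<longlonglongrightarrow> 0)" for x y
  have Cladd: "Cl (x + x') (y + y')" if xy: "Cl x y" "Cl x' y'" for x y x' y'
  proof -
    obtain X Y where XY: "\<And>m. (X m, Y m) \<in> ?P" "(\<lambda>m. hnorm H (X m - x)) \<longlonglongrightarrow> 0" "(\<lambda>m. hnorm K (Y m - y)) \<longlonglongrightarrow> 0"
      using xy(1) by (auto simp: Cl_def)
    obtain X' Y' where XY': "\<And>m. (X' m, Y' m) \<in> ?P" "(\<lambda>m. hnorm H (X' m - x')) \<longlonglongrightarrow> 0" "(\<lambda>m. hnorm K (Y' m - y')) \<longlonglongrightarrow> 0"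
      using xy(2) by (auto simp: Cl_def)
    have "(\<lambda>m. hnorm H (X m + X' m - (x + x'))) \<longlonglongrightarrow> 0" "(\<lambda>m. hnorm K (Y m + Y' m - (y + y'))) \<longlonglongrightarrow> 0"
      using xy XY(2,3) XY'(2,3) PH(1)[OF XY(1)] PH(2)[OF XY(1)] PH(1)[OF XY'(1)] PH(2)[OF XY'(1)] by (auto simp: Cl_def intro!: H.lim_add K.lim_add)
    then show ?thesis using xy Padd XY XY'
      unfolding Cl_def by (intro conjI exI[of _ "\<lambda>m. X m + X' m"] exI[of _ "\<lambda>m. Y m + Y' m"]) auto
  qed
  have Clscale: "Cl (c *\<^sub>C x) (c *\<^sub>C y)" if xy: "Cl x y" for x y c
  proof -
    obtain X Y where XY: "\<And>m. (X m, Y m) \<in> ?P" "(\<lambda>m. hnorm H (X m - x)) \<longlonglongrightarrow> 0" "(\<lambda>m. hnorm K (Y m - y)) \<longlonglongrightarrow> 0"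
      using xy(1) by (auto simp: Cl_def)
    have "(\<lambda>m. hnorm H (c *\<^sub>C X m - c *\<^sub>C x)) \<longlonglongrightarrow> 0" "(\<lambda>m. hnorm K (c *\<^sub>C Y m - c *\<^sub>C y)) \<longlonglongrightarrow> 0"
      using xy XY(2,3) PH(1)[OF XY(1)] PH(2)[OF XY(1)] by (auto simp: Cl_def intro!: H.lim_scale K.lim_scale)
    then show ?thesis using xy Pscale XY
      unfolding Cl_def by (intro conjI exI[of _ "\<lambda>m. c *\<^sub>C X m"] exI[of _ "\<lambda>m. c *\<^sub>C Y m"]) auto
  qed
  have Clbd: "hnorm K y \<le> B * hnorm H x" if xy: "Cl x y" for x y
  proof -
    obtain X Y where XY: "\<And>m. (X m, Y m) \<in> ?P" "(\<lambda>m. hnorm H (X m - x)) \<longlonglongrightarrow> 0" "(\<lambda>m. hnorm K (Y m - y)) \<longlonglongrightarrow> 0"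
      using xy(1) by (auto simp: Cl_def)
    have 1: "(\<lambda>m. hnorm K (Y m)) \<longlonglongrightarrow> hnorm K y" using XY(3) PH(2)[OF XY(1)] xy by (intro K.hnorm_tendsto) (auto simp: Cl_def)
    have 2: "(\<lambda>m. B * hnorm H (X m)) \<longlonglongrightarrow> B * hnorm H x" using XY(2) PH(1)[OF XY(1)] xy by (intro tendsto_mult_left H.hnorm_tendsto) (auto simp: Cl_def)
    show ?thesis by (rule LIMSEQ_le[OF 1 2]) (use bd XY in auto)
  qed
  \<comment> \<open>By linearity the difference of two values lies over 0, where the bound leaves
    only 0; so the closed relation is a function.\<close>
  have Cluniq: "y = y'" if "Cl x y" "Cl x y'" for x y y'
  proof -
    have "Cl (x + (-1) *\<^sub>C x) (y + (-1) *\<^sub>C y')" using that Cladd Clscale by blast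
    then have "Cl 0 (y - y')" by simp
    then have "hnorm K (y - y') \<le> 0" "y - y' \<in> carr K" using Clbd[of 0 "y - y'"] by (auto simp: Cl_def)
    then have "y - y' = 0" using K.hnorm_eq_0[of "y - y'"] K.hnorm_ge_0[of "y - y'"] by linarith
    then show ?thesis by simp
  qed
  have Clex: "\<exists>y. Cl x y" if x: "x \<in> carr H" for x
  proof -
    have fG: "fst ` G \<subseteq> carr H" using G by auto
    obtain X where X: "\<And>m. X m \<in> complex_vector.span (fst ` G)" "(\<lambda>m. hnorm H (X m - x)) \<longlonglongrightarrow> 0"
      using H.dense_span[OF tot fG x] by blast
    have "complex_vector.span (fst ` G) \<subseteq> {x. \<exists>y. (x, y) \<in> ?P}"
    proof (rule complex_vector.span_minimal)
      show "fst ` G \<subseteq> {x. \<exists>y. (x, y) \<in> ?P}" using complex_vector.span_base by force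
      show "csubspace {x. \<exists>y. (x, y) \<in> ?P}"
        unfolding complex_vector.subspace_def mem_Collect_eq
        using Padd Pscale complex_vector.span_zero[of G] unfolding zero_prod_def by blast
    qed
    then have "\<forall>m. \<exists>y. (X m, y) \<in> ?P" using X(1) by blast
    then obtain Y where XY: "\<And>m. (X m, Y m) \<in> ?P" using choice[of "\<lambda>m y. (X m, y) \<in> ?P"] by blast
    have "\<exists>l\<in>carr K. (\<lambda>m. hnorm K (Y m - l)) \<longlonglongrightarrow> 0"
    proof (rule K.complete)
      fix e :: real assume e: "e > 0"
      \<comment> \<open>\<open>B\<close> may vanish or be negative, hence the division by
        \<open>\<bar>B\<bar> + 1\<close>.\<close>
      then have "e / (\<bar>B\<bar> + 1) > 0" by simp
      from H.Cauchy_if_lim[OF _ x X(2) this] PH(1)[OF XY]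
      obtain N where N: "\<forall>p\<ge>N. \<forall>q\<ge>N. hnorm H (X p - X q) < e / (\<bar>B\<bar> + 1)" by blast
      have "hnorm K (Y p - Y q) < e" if "p \<ge> N" "q \<ge> N" for p q
      proof -
        have "hnorm K (Y p - Y q) \<le> B * hnorm H (X p - X q)" using Pdiff[OF XY XY] by (rule bd)
        also have "\<dots> \<le> (\<bar>B\<bar> + 1) * hnorm H (X p - X q)" using PH(1)[OF XY] by (intro mult_right_mono) auto
        also have "\<dots> < e" using N that by (simp add: pos_less_divide_eq mult.commute)
        finally show ?thesis .
      qed
      then show "\<exists>N. \<forall>p\<ge>N. \<forall>q\<ge>N. hnorm K (Y p - Y q) < e" by blast
    qed (use PH(2)[OF XY] in auto)
    then show ?thesis using x X XY unfolding Cl_def by blast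
  qed
  define A where "A x = (if x \<in> carr H then THE y. Cl x y else 0)" for x
  have AI: "A x = y" if "Cl x y" for x y
  proof -
    have "x \<in> carr H" using that by (simp add: Cl_def)
    moreover have "(THE y. Cl x y) = y" using that Cluniq by (intro the_equality)
    ultimately show ?thesis by (simp add: A_def)
  qed
  have ACl: "Cl x (A x)" if "x \<in> carr H" for x using Clex[OF that] AI by metis
  have "A \<in> bop H K"
  proof (rule bopI[where B = B])
    show "A x \<in> carr K" if "x \<in> carr H" for x using ACl[OF that] by (simp add: Cl_def)
    show "A (x + y) = A x + A y" if "x \<in> carr H" "y \<in> carr H" for x y using ACl that by (intro AI Cladd)
    show "A (c *\<^sub>C x) = c *\<^sub>C A x" if "x \<in> carr H" for x c using ACl that by (intro AI Clscale)
    show "hnorm K (A x) \<le> B * hnorm H x" if "x \<in> carr H" for x using ACl[OF that] by (rule Clbd)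
  qed (simp add: A_def)
  moreover have "A x = y" if "(x, y) \<in> G" for x y
  proof (rule AI)
    show "Cl x y" unfolding Cl_def using complex_vector.span_base[OF that] PH[of x y]
      by (intro conjI exI[of _ "\<lambda>_. x"] exI[of _ "\<lambda>_. y"]) auto
  qed
  moreover have "hnorm K (A x) \<le> B * hnorm H x" if "x \<in> carr H" for x using ACl[OF that] by (rule Clbd)
  ultimately show ?thesis by blast
qed

text \<open>Finite combinations indexed by parameters instead of vectors. Since \<open>g\<close>
  need not be injective, one parameter is chosen for each vector that occurs.\<close>

lemma span_imageE:
  assumes "p \<in> complex_vector.span (g ` S)"
  obtains F c where "finite F" "F \<subseteq> S" "p = (\<Sum>s\<in>F. c s *\<^sub>C g s)"
proof -
  obtain t r where t: "finite t" "t \<subseteq> g ` S" "p = (\<Sum>a\<in>t. r a *\<^sub>C a)"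
    using assms unfolding complex_vector.span_explicit by blast
  obtain F where F: "F \<subseteq> S" "inj_on g F" "t = g ` F" using t(2) by (metis subset_image_inj)
  have "finite F" using t(1) F by (simp add: finite_image_iff)
  moreover have "p = (\<Sum>s\<in>F. r (g s) *\<^sub>C g s)" using t(3) F by (simp add: sum.reindex)
  ultimately show ?thesis by (intro that[of F "\<lambda>s. r (g s)"] F(1))
qed

text \<open>Coefficients are padded by 0 outside the individual index sets, so that one finite set
  serves all of \<open>P\<close>.\<close>

lemma span_image_common:
  assumes "finite P" "\<And>p. p \<in> P \<Longrightarrow> y p \<in> complex_vector.span (g ` S)"
  shows "\<exists>F c. finite F \<and> F \<subseteq> S \<and> (\<forall>p\<in>P. y p = (\<Sum>s\<in>F. c p s *\<^sub>C g s))"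
proof -
  have "\<exists>F c. finite F \<and> F \<subseteq> S \<and> y p = (\<Sum>s\<in>F. c s *\<^sub>C g s)" if "p \<in> P" for p
    using span_imageE[OF assms(2)[OF that]] by metis
  then obtain F c where F: "\<And>p. p \<in> P \<Longrightarrow> finite (F p) \<and> F p \<subseteq> S \<and> y p = (\<Sum>s\<in>F p. c p s *\<^sub>C g s)"
    by metis
  show ?thesis
  proof (intro exI[of _ "\<Union>p\<in>P. F p"] exI[of _ "\<lambda>p s. if s \<in> F p then c p s else 0"] conjI ballI)
    fix p assume p: "p \<in> P"
    have "(\<Sum>s\<in>(\<Union>p\<in>P. F p). (if s \<in> F p then c p s else 0) *\<^sub>C g s) = (\<Sum>s\<in>F p. (if s \<in> F p then c p s else 0) *\<^sub>C g s)"
      using F assms(1) p by (intro sum.mono_neutral_right) auto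
    then show "y p = (\<Sum>s\<in>(\<Union>p\<in>P. F p). (if s \<in> F p then c p s else 0) *\<^sub>C g s)" using F[OF p] by simp
  qed (use F assms(1) in auto)
qed

section \<open>Riesz representation and adjoints\<close>

lemma Riesz:
  assumes H: "hilbert H" and f: "f \<in> bop H complex_hspace"
  shows "\<exists>z\<in>carr H. \<forall>x\<in>carr H. f x = ip H x z"
proof -
  interpret H: hilbert H by (rule H)
  let ?V = "{x \<in> carr H. f x = 0}"
  have cl: "closed_csubspace H ?V"
  proof (rule H.closed_csubspaceI, goal_cases)
    case (5 X l)
    have "(\<lambda>m. hnorm complex_hspace (f (X m) - f l)) \<longlonglongrightarrow> 0"
      using 5 by (intro bop_tendsto[OF H hilbert_complex f]) auto
    moreover have "f (X m) = 0" for m using 5(1)[of m] by simp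
    ultimately have "f l = 0" by (simp add: LIMSEQ_const_iff)
    with 5 show ?case by simp
  qed (auto simp: bop_zero[OF H f] bop_add[OF f] bop_scale[OF f])
  show ?thesis
  proof (cases "?V = carr H")
    case True
    then show ?thesis by (intro bexI[of _ 0]) auto
  next
    case False
    then obtain x0 where x0: "x0 \<in> carr H" "f x0 \<noteq> 0" by auto
    \<comment> \<open>Any \<open>u\<close> orthogonal to the kernel with
      \<open>f u \<noteq> 0\<close> represents \<open>f\<close> after scaling, because
      \<open>x - (f x / f u) *\<^sub>C u\<close> lies in the kernel.\<close>
    define u where "u = x0 - proj H ?V x0"
    have pr: "proj H ?V x0 \<in> ?V" "u \<in> orth H ?V" using H.proj_props[OF cl x0(1)] by (auto simp: u_def)
    have u: "u \<in> carr H" "f u \<noteq> 0" using pr x0 by (auto simp: u_def bop_diff[OF H f])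
    have uu: "ip H u u \<noteq> 0" using H.ip_eq_0[OF u(1)] u bop_zero[OF H f] by auto
    define z where "z = cnj (f u / ip H u u) *\<^sub>C u"
    have "f x = ip H x z" if x: "x \<in> carr H" for x
    proof -
      have fs: "f ((f x / f u) *\<^sub>C u) = f x" using u by (simp add: bop_scale[OF f u(1)] scaleC_complex_def)
      have "x - (f x / f u) *\<^sub>C u \<in> ?V" using x u fs by (simp add: bop_diff[OF H f])
      then have "ip H u (x - (f x / f u) *\<^sub>C u) = 0" using pr(2) by (simp add: orth_def)
      then have "ip H (x - (f x / f u) *\<^sub>C u) u = 0" using x u H.ip_cnj[of u "x - (f x / f u) *\<^sub>C u"] by simp
      then have "ip H x u = f x / f u * ip H u u" using x u by (simp add: H.ip_diff_left H.ip_scale)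
      then show ?thesis using x u uu by (simp add: z_def H.ip_scale_right)
    qed
    moreover have "z \<in> carr H" using u by (simp add: z_def)
    ultimately show ?thesis by blast
  qed
qed

text \<open>Riesz, applied for each fixed \<open>y\<close>, gives the value of the adjoint at
  \<open>y\<close>; its norm is controlled by testing the identity at that value itself.\<close>

lemma adjoint_exists:
  assumes H: "hilbert H" and K: "hilbert K" and A: "A \<in> bop H K"
  shows "\<exists>B\<in>bop K H. \<forall>x\<in>carr H. \<forall>y\<in>carr K. ip K (A x) y = ip H x (B y)"
proof -
  interpret H: hilbert H by (rule H)
  interpret K: hilbert K by (rule K)
  obtain a where a: "a > 0" "\<And>x. x \<in> carr H \<Longrightarrow> hnorm K (A x) \<le> a * hnorm H x" using bop_boundE[OF A H] by blast
  note [simp] = bop_in[OF A]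
  have "\<exists>z\<in>carr H. \<forall>x\<in>carr H. ip K (A x) y = ip H x z" if y: "y \<in> carr K" for y
  proof -
    define f where "f x = (if x \<in> carr H then ip K (A x) y else 0)" for x
    have "f \<in> bop H complex_hspace"
    proof (rule bopI[where B = "a * hnorm K y"])
      fix x assume x: "x \<in> carr H"
      have "cmod (ip K (A x) y) \<le> hnorm K (A x) * hnorm K y" using x y by (simp add: K.Cauchy_Schwarz)
      also have "\<dots> \<le> (a * hnorm H x) * hnorm K y" using a x y by (intro mult_right_mono) auto
      finally show "hnorm complex_hspace (f x) \<le> a * hnorm K y * hnorm H x" using x by (simp add: f_def mult_ac)
    qed (auto simp: f_def complex_hspace_def bop_add[OF A] bop_scale[OF A] K.ip_add K.ip_scale y scaleC_complex_def)
    from Riesz[OF H this] obtain z where "z \<in> carr H" "\<forall>x\<in>carr H. f x = ip H x z" by blast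
    then show ?thesis by (intro bexI[of _ z]) (auto simp: f_def)
  qed
  then obtain g where g: "\<And>y. y \<in> carr K \<Longrightarrow> g y \<in> carr H" "\<And>x y. y \<in> carr K \<Longrightarrow> x \<in> carr H \<Longrightarrow> ip K (A x) y = ip H x (g y)"
    by metis
  have eqI: "u = v" if "u \<in> carr H" "v \<in> carr H" "\<And>x. x \<in> carr H \<Longrightarrow> ip H x u = ip H x v" for u v
  proof -
    have "ip H (u - v) (u - v) = 0" using that(1,2) that(3)[of "u - v"] by (simp add: H.ip_diff_right)
    then show ?thesis using H.ip_eq_0[of "u - v"] that by simp
  qed
  define B where "B y = (if y \<in> carr K then g y else 0)" for y
  have "B \<in> bop K H"
  proof (rule bopI[where B = a])
    fix y assume y: "y \<in> carr K"
    have "(hnorm H (g y))\<^sup>2 = Re (ip K (A (g y)) y)" using y g by (simp add: H.hnorm_sq)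
    also have "\<dots> \<le> hnorm K (A (g y)) * hnorm K y"
      using K.Cauchy_Schwarz[of "A (g y)" y] complex_Re_le_cmod[of "ip K (A (g y)) y"] y g by auto
    also have "\<dots> \<le> (a * hnorm H (g y)) * hnorm K y" using a g y by (intro mult_right_mono) auto
    finally have "hnorm H (g y) * hnorm H (g y) \<le> hnorm H (g y) * (a * hnorm K y)" by (simp add: power2_eq_square mult_ac)
    then show "hnorm H (B y) \<le> a * hnorm K y"
      using H.hnorm_ge_0[OF g(1)[OF y]] a(1) K.hnorm_ge_0[OF y] y
      by (cases "hnorm H (g y) = 0") (auto simp: B_def)
  qed (auto simp: B_def g(1) K.ip_simps H.ip_simps g(2)[symmetric] intro!: eqI)
  then show ?thesis using g(2) by (intro bexI[of _ B]) (auto simp: B_def)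
qed

text \<open>\<open>adj\<close> is a definite description; an operator with the adjoint identity is
  unique because all its inner products are prescribed.\<close>

lemma adj_eqI:
  assumes H: "hilbert H" and K: "hilbert K" and B: "B \<in> bop K H"
    and eq: "\<And>x y. x \<in> carr H \<Longrightarrow> y \<in> carr K \<Longrightarrow> ip K (A x) y = ip H x (B y)"
  shows "adj H K A = B"
  unfolding adj_def
proof (rule the_equality)
  fix C assume C: "C \<in> bop K H \<and> (\<forall>x\<in>carr H. \<forall>y\<in>carr K. ip K (A x) y = ip H x (C y))"
  show "C = B"
  proof (rule bop_eqI_ip'[OF K H])
    fix y x assume yx: "y \<in> carr K" "x \<in> carr H"
    then have "ip H x (C y) = ip H x (B y)" using C eq by simp
    then show "ip H (C y) x = ip H (B y) x"
      using yx bop_in[of C K H y] bop_in[OF B, of y] C hilbert.ip_cnj[OF H, of x "C y"] hilbert.ip_cnj[OF H, of x "B y"] by simp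
  qed (use B C in auto)
qed (use B eq in auto)

lemma
  assumes H: "hilbert H" and K: "hilbert K" and A: "A \<in> bop H K"
  shows adj_bop: "adj H K A \<in> bop K H"
    and adj_ip: "x \<in> carr H \<Longrightarrow> y \<in> carr K \<Longrightarrow> ip K (A x) y = ip H x (adj H K A y)"
proof -
  obtain B where "B \<in> bop K H" "\<forall>x\<in>carr H. \<forall>y\<in>carr K. ip K (A x) y = ip H x (B y)"
    using adjoint_exists[OF assms] by blast
  then show "adj H K A \<in> bop K H" "x \<in> carr H \<Longrightarrow> y \<in> carr K \<Longrightarrow> ip K (A x) y = ip H x (adj H K A y)"
    using adj_eqI[OF H K, of B A] by auto
qed

lemma adj_ip':
  assumes H: "hilbert H" and K: "hilbert K" and A: "A \<in> bop H K" and x: "x \<in> carr H" "y \<in> carr K"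
  shows "ip H (adj H K A y) x = ip K y (A x)"
  using adj_ip[OF assms] hilbert.ip_cnj[OF K, of "A x" y] hilbert.ip_cnj[OF H, of x "adj H K A y"] x
    bop_in[OF adj_bop[OF H K A]] bop_in[OF A] by simp

lemma adj_adj:
  assumes H: "hilbert H" and K: "hilbert K" and A: "A \<in> bop H K"
  shows "adj K H (adj H K A) = A"
  using assms by (intro adj_eqI) (auto simp: adj_ip' adj_bop)

lemma adj_comp:
  assumes H: "hilbert H" and K: "hilbert K" and L: "hilbert L" and A: "A \<in> bop K L" and B: "B \<in> bop H K"
  shows "adj H L (A \<circ> B) = adj H K B \<circ> adj K L A"
  by (rule adj_eqI[OF H L bop_comp[OF L K H adj_bop[OF H K B] adj_bop[OF K L A]]])
    (simp add: adj_ip[OF K L A] adj_ip[OF H K B] bop_in[OF B] bop_in[OF adj_bop[OF K L A]])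

lemma adj_plus:
  assumes H: "hilbert H" and K: "hilbert K" and A: "A \<in> bop H K" and B: "B \<in> bop H K"
  shows "adj H K (A + B) = adj H K A + adj H K B"
  by (rule adj_eqI[OF H K bop_plus[OF K H adj_bop[OF H K A] adj_bop[OF H K B]]])
    (simp add: hilbert.ip_add[OF K] hilbert.ip_add_right[OF H] bop_in[OF A] bop_in[OF B]
      bop_in[OF adj_bop[OF H K A]] bop_in[OF adj_bop[OF H K B]] adj_ip[OF H K A] adj_ip[OF H K B])

lemma adj_scaleC:
  assumes H: "hilbert H" and K: "hilbert K" and A: "A \<in> bop H K"
  shows "adj H K (c *\<^sub>C A) = cnj c *\<^sub>C adj H K A"
  by (rule adj_eqI[OF H K bop_scaleC[OF K H adj_bop[OF H K A]]])
    (simp add: scaleC_fun_def hilbert.ip_scale[OF K] hilbert.ip_scale_right[OF H] bop_in[OF A]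
      bop_in[OF adj_bop[OF H K A]] adj_ip[OF H K A])

lemma adj_diff:
  assumes H: "hilbert H" and K: "hilbert K" and A: "A \<in> bop H K" and B: "B \<in> bop H K"
  shows "adj H K (A - B) = adj H K A - adj H K B"
  by (rule adj_eqI[OF H K bop_diff_fun[OF K H adj_bop[OF H K A] adj_bop[OF H K B]]])
    (simp add: hilbert.ip_diff_left[OF K] hilbert.ip_diff_right[OF H] bop_in[OF A] bop_in[OF B]
      bop_in[OF adj_bop[OF H K A]] bop_in[OF adj_bop[OF H K B]] adj_ip[OF H K A] adj_ip[OF H K B])

lemma adj_idop: "hilbert H \<Longrightarrow> adj H H (idop H) = idop H"
  by (rule adj_eqI[OF _ _ bop_idop]) (auto simp: idop_def)

lemma opnorm_adj_le:
  assumes H: "hilbert H" and K: "hilbert K" and A: "A \<in> bop H K"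
  shows "opnorm K H (adj H K A) \<le> opnorm H K A"
proof (rule opnorm_le[OF K _ opnorm_ge_0[OF assms]])
  fix y assume y: "y \<in> carr K"
  let ?z = "adj H K A y"
  have z: "?z \<in> carr H" using bop_in[OF adj_bop[OF assms] y] .
  have "(hnorm H ?z)\<^sup>2 = Re (ip K (A ?z) y)" using adj_ip[OF assms z y] z by (simp add: hilbert.hnorm_sq[OF H])
  also have "\<dots> \<le> hnorm K (A ?z) * hnorm K y"
    using hilbert.Cauchy_Schwarz[OF K bop_in[OF A z] y] complex_Re_le_cmod[of "ip K (A ?z) y"] by linarith
  also have "\<dots> \<le> (opnorm H K A * hnorm H ?z) * hnorm K y"
    using opnorm_bound[OF assms z] hilbert.hnorm_ge_0[OF K y] by (intro mult_right_mono)
  finally have "hnorm H ?z * hnorm H ?z \<le> hnorm H ?z * (opnorm H K A * hnorm K y)" by (simp add: power2_eq_square mult_ac)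
  then show "hnorm H ?z \<le> opnorm H K A * hnorm K y"
    using hilbert.hnorm_ge_0[OF H z] opnorm_ge_0[OF assms] hilbert.hnorm_ge_0[OF K y]
    by (cases "hnorm H ?z = 0") auto
qed

text \<open>A bounded form on a total family determines an operator: Riesz in each of the two variables.\<close>

lemma bop_of_bounded_kernel:
  fixes w :: "'s \<Rightarrow> 'a::complex_vector"
  assumes H: "hilbert H" and w: "w ` S \<subseteq> carr H" and tot: "closed_cspan H (w ` S) = carr H"
    and bd: "\<And>F c d. finite F \<Longrightarrow> F \<subseteq> S \<Longrightarrow> cmod (\<Sum>s\<in>F. \<Sum>t\<in>F. c s * cnj (d t) * k s t)
       \<le> M * hnorm H (\<Sum>s\<in>F. c s *\<^sub>C w s) * hnorm H (\<Sum>t\<in>F. d t *\<^sub>C w t)"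
  shows "\<exists>A\<in>bop H H. \<forall>s\<in>S. \<forall>t\<in>S. ip H (A (w s)) (w t) = k s t"
proof -
  interpret H: hilbert H by (rule H)
  have wH [simp]: "w s \<in> carr H" if "s \<in> S" for s using w that by auto
  \<comment> \<open>The bound is assumed with one index set in both variables; zero coefficients
    extend it to two different sets.\<close>
  have bd2: "cmod (\<Sum>s\<in>F. \<Sum>t\<in>G. c s * cnj (d t) * k s t)
       \<le> M * hnorm H (\<Sum>s\<in>F. c s *\<^sub>C w s) * hnorm H (\<Sum>t\<in>G. d t *\<^sub>C w t)"
    if F: "finite F" "F \<subseteq> S" and G: "finite G" "G \<subseteq> S" for F G c d
  proof -
    define c' d' where "c' s = (if s \<in> F then c s else 0)" and "d' t = (if t \<in> G then d t else 0)" for s t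
    have 1: "(\<Sum>s\<in>F \<union> G. c' s *\<^sub>C w s) = (\<Sum>s\<in>F. c s *\<^sub>C w s)"
      using F G by (intro sum.mono_neutral_cong_right) (auto simp: c'_def)
    have 2: "(\<Sum>s\<in>F \<union> G. d' s *\<^sub>C w s) = (\<Sum>s\<in>G. d s *\<^sub>C w s)"
      using F G by (intro sum.mono_neutral_cong_right) (auto simp: d'_def)
    have "(\<Sum>t\<in>F \<union> G. c' s * cnj (d' t) * k s t) = (\<Sum>t\<in>G. c' s * cnj (d t) * k s t)" for s
      using F G by (intro sum.mono_neutral_cong_right) (auto simp: d'_def)
    then have "(\<Sum>s\<in>F \<union> G. \<Sum>t\<in>F \<union> G. c' s * cnj (d' t) * k s t) = (\<Sum>s\<in>F \<union> G. \<Sum>t\<in>G. c' s * cnj (d t) * k s t)"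
      by simp
    also have "\<dots> = (\<Sum>s\<in>F. \<Sum>t\<in>G. c s * cnj (d t) * k s t)"
      using F G by (intro sum.mono_neutral_cong_right) (auto simp: c'_def)
    finally show ?thesis using bd[of "F \<union> G" c' d'] F G 1 2 by simp
  qed
  \<comment> \<open>For fixed \<open>s\<close>, Riesz represents the functional that sends
    \<open>w t\<close> to \<open>cnj (k s t)\<close>; \<open>z s\<close> becomes the value of the
    operator at \<open>w s\<close>.\<close>
  have z_ex: "\<exists>z\<in>carr H. \<forall>t\<in>S. ip H z (w t) = k s t" if s: "s \<in> S" for s
  proof -
    let ?G = "(\<lambda>t. (w t, cnj (k s t))) ` S"
    have "\<exists>A\<in>bop H complex_hspace. (\<forall>(x, y)\<in>?G. A x = y) \<and> (\<forall>x\<in>carr H. hnorm complex_hspace (A x) \<le> (M * hnorm H (w s)) * hnorm H x)"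
    proof (rule bop_extension[OF H hilbert_complex])
      show "?G \<subseteq> carr H \<times> carr complex_hspace" by (auto simp: complex_hspace_def)
      show "closed_cspan H (fst ` ?G) = carr H" using tot by (simp add: image_image)
      fix x y assume "(x, y) \<in> complex_vector.span ?G"
      then obtain F c where F: "finite F" "F \<subseteq> S" "(x, y) = (\<Sum>t\<in>F. c t *\<^sub>C (w t, cnj (k s t)))" by (rule span_imageE)
      have x: "x = (\<Sum>t\<in>F. c t *\<^sub>C w t)" and y: "y = (\<Sum>t\<in>F. c t * cnj (k s t))"
        using arg_cong[OF F(3), of fst] arg_cong[OF F(3), of snd]
        by (simp_all add: fst_sum snd_sum scaleC_prod_def scaleC_complex_def)
      have "cnj y = (\<Sum>s\<in>{s}. \<Sum>t\<in>F. 1 * cnj (c t) * k s t)" by (simp add: y)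
      then have "cmod y \<le> M * hnorm H (w s) * hnorm H x"
        using bd2[of "{s}" F "\<lambda>_. 1" c] F s x by (simp add: scaleC_one flip: complex_mod_cnj[of y])
      then show "hnorm complex_hspace y \<le> M * hnorm H (w s) * hnorm H x" by simp
    qed
    then obtain f where f: "f \<in> bop H complex_hspace" "\<And>t. t \<in> S \<Longrightarrow> f (w t) = cnj (k s t)" by auto
    obtain z where z: "z \<in> carr H" "\<And>x. x \<in> carr H \<Longrightarrow> f x = ip H x z" using Riesz[OF H f(1)] by blast
    have "ip H z (w t) = k s t" if "t \<in> S" for t
      using f(2)[OF that] z(2)[of "w t"] H.ip_cnj[of "w t" z] z(1) that by simp
    then show ?thesis using z(1) by blast
  qed
  then obtain z where z: "\<And>s. s \<in> S \<Longrightarrow> z s \<in> carr H" "\<And>s t. s \<in> S \<Longrightarrow> t \<in> S \<Longrightarrow> ip H (z s) (w t) = k s t" by metis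
  let ?G = "(\<lambda>s. (w s, z s)) ` S"
  have "\<exists>A\<in>bop H H. (\<forall>(x, y)\<in>?G. A x = y) \<and> (\<forall>x\<in>carr H. hnorm H (A x) \<le> M * hnorm H x)"
  proof (rule bop_extension[OF H H])
    show "?G \<subseteq> carr H \<times> carr H" using z by auto
    show "closed_cspan H (fst ` ?G) = carr H" using tot by (simp add: image_image)
    fix x y assume "(x, y) \<in> complex_vector.span ?G"
    then obtain F c where F: "finite F" "F \<subseteq> S" "(x, y) = (\<Sum>s\<in>F. c s *\<^sub>C (w s, z s))" by (rule span_imageE)
    have x: "x = (\<Sum>t\<in>F. c t *\<^sub>C w t)" and y: "y = (\<Sum>t\<in>F. c t *\<^sub>C z t)"
      using arg_cong[OF F(3), of fst] arg_cong[OF F(3), of snd]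
      by (simp_all add: fst_sum snd_sum scaleC_prod_def)
    have yH: "y \<in> carr H" unfolding y using F z by (intro H.sum_in H.scale_in) auto
    \<comment> \<open>Only products with vectors of the span are under control, so \<open>y\<close>
      is tested against approximants of itself.\<close>
    obtain Y where Y: "\<And>m. Y m \<in> complex_vector.span (w ` S)" "(\<lambda>m. hnorm H (Y m - y)) \<longlonglongrightarrow> 0"
      using H.dense_span[OF tot w yH] by blast
    have YH: "Y m \<in> carr H" for m using Y(1) complex_vector.span_minimal[OF w H.subspace] by blast
    have est: "cmod (ip H y (Y m)) \<le> M * hnorm H x * hnorm H (Y m)" for m
    proof -
      obtain G d where G: "finite G" "G \<subseteq> S" "Y m = (\<Sum>t\<in>G. d t *\<^sub>C w t)" using Y(1) by (rule span_imageE)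
      have "ip H y (Y m) = (\<Sum>s\<in>F. \<Sum>t\<in>G. c s * cnj (d t) * ip H (z s) (w t))"
        unfolding y G(3) using F G z by (intro H.ip_lincomb) auto
      also have "\<dots> = (\<Sum>s\<in>F. \<Sum>t\<in>G. c s * cnj (d t) * k s t)"
        using z(2)[OF subsetD[OF F(2)] subsetD[OF G(2)]] by (intro sum.cong refl) simp
      finally show ?thesis using bd2[OF F(1,2) G(1,2), of c d] by (simp add: x G(3))
    qed
    have 1: "(\<lambda>m. cmod (ip H y (Y m))) \<longlonglongrightarrow> cmod (ip H y y)"
      by (intro tendsto_norm H.ip_tendsto_right[OF YH yH Y(2) yH])
    have 2: "(\<lambda>m. M * hnorm H x * hnorm H (Y m)) \<longlonglongrightarrow> M * hnorm H x * hnorm H y"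
      by (intro tendsto_mult_left H.hnorm_tendsto[OF YH yH Y(2)])
    have "cmod (ip H y y) \<le> M * hnorm H x * hnorm H y"
      by (rule LIMSEQ_le[OF 1 2]) (use est in auto)
    then have "hnorm H y * hnorm H y \<le> (M * hnorm H x) * hnorm H y"
      using yH by (simp add: H.ip_self norm_power power2_eq_square norm_mult)
    \<comment> \<open>Cancelling \<open>hnorm H y\<close> fails when it is 0; there the sign of the
      bound is needed, and \<open>M\<close> itself has no prescribed sign.\<close>
    moreover have "0 \<le> M * hnorm H x"
    proof (cases "x = 0")
      case False
      have "x \<in> carr H" unfolding x using F by (intro H.sum_in H.scale_in) auto
      then have x0: "0 < hnorm H x" using False H.hnorm_eq_0[of x] H.hnorm_ge_0[of x] by linarith
      have "0 \<le> M * hnorm H x * hnorm H x"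
        using bd2[OF F(1,2) F(1,2), of c c] by (intro order_trans[OF norm_ge_zero]) (auto simp: x)
      then show ?thesis using x0 by (simp add: zero_le_mult_iff)
    qed simp
    ultimately show "hnorm H y \<le> M * hnorm H x"
      using H.hnorm_ge_0[OF yH] by (cases "hnorm H y = 0") auto
  qed
  then obtain A where "A \<in> bop H H" "\<And>s. s \<in> S \<Longrightarrow> A (w s) = z s" by auto
  then show ?thesis using z by (intro bexI[of _ A]) auto
qed

section \<open>Square roots and Schur's lemma\<close>

lemma kernel_closed:
  assumes H: "hilbert H" and K: "hilbert K" and A: "A \<in> bop H K"
  shows "closed_csubspace H {x \<in> carr H. A x = 0}"
proof -
  interpret H: hilbert H by (rule H)
  show ?thesis
  proof (rule H.closed_csubspaceI, goal_cases)
    case (5 X l)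
    have "A l = 0"
      by (rule hilbert.lim_unique[OF K, of "\<lambda>m. A (X m)"])
        (use 5 bop_tendsto[OF H K A, of X l] in \<open>auto simp: bop_in[OF A] hilbert.zero_in[OF K] hilbert.hnorm_zero[OF K]\<close>)
    with 5 show ?case by simp
  qed (auto simp: bop_zero[OF H A] bop_add[OF A] bop_scale[OF A])
qed

text \<open>Serves the square root iteration, whose limit is taken vector by vector; the uniform
  bound passes to the limit.\<close>

lemma bop_pointwise_limit:
  assumes H: "hilbert H" and K: "hilbert K" and Y: "\<And>n. Y n \<in> bop H K"
    and bd: "\<And>n x. x \<in> carr H \<Longrightarrow> hnorm K (Y n x) \<le> B * hnorm H x"
    and cv: "\<And>x. x \<in> carr H \<Longrightarrow> \<exists>l\<in>carr K. (\<lambda>n. hnorm K (Y n x - l)) \<longlonglongrightarrow> 0"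
  shows "\<exists>L\<in>bop H K. (\<forall>x\<in>carr H. (\<lambda>n. hnorm K (Y n x - L x)) \<longlonglongrightarrow> 0) \<and> (\<forall>x\<in>carr H. hnorm K (L x) \<le> B * hnorm H x)"
proof -
  interpret H: hilbert H by (rule H)
  interpret K: hilbert K by (rule K)
  obtain g where g: "\<And>x. x \<in> carr H \<Longrightarrow> g x \<in> carr K" "\<And>x. x \<in> carr H \<Longrightarrow> (\<lambda>n. hnorm K (Y n x - g x)) \<longlonglongrightarrow> 0"
    using cv by metis
  define L where "L x = (if x \<in> carr H then g x else 0)" for x
  have gbd: "hnorm K (g x) \<le> B * hnorm H x" if x: "x \<in> carr H" for x
    by (rule LIMSEQ_le_const2[OF K.hnorm_tendsto[OF _ g(1)[OF x] g(2)[OF x]]]) (use bd x bop_in[OF Y] in auto)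
  have "L \<in> bop H K"
  proof (rule bopI[where B = B])
    fix x y assume xy: "x \<in> carr H" "y \<in> carr H"
    have "(\<lambda>n. hnorm K (Y n (x + y) - (g x + g y))) \<longlonglongrightarrow> 0"
      using K.lim_add[of "\<lambda>n. Y n x" "g x" "\<lambda>n. Y n y" "g y"] xy g by (simp add: bop_in[OF Y] bop_add[OF Y])
    then have "g (x + y) = g x + g y"
      using xy g by (intro K.lim_unique[of "\<lambda>n. Y n (x + y)"]) (auto simp: bop_in[OF Y])
    then show "L (x + y) = L x + L y" using xy by (simp add: L_def)
  next
    fix c x assume x: "x \<in> carr H"
    have "(\<lambda>n. hnorm K (Y n (c *\<^sub>C x) - c *\<^sub>C g x)) \<longlonglongrightarrow> 0"
      using K.lim_scale[of "\<lambda>n. Y n x" "g x" c] x g by (simp add: bop_in[OF Y] bop_scale[OF Y])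
    then have "g (c *\<^sub>C x) = c *\<^sub>C g x"
      using x g by (intro K.lim_unique[of "\<lambda>n. Y n (c *\<^sub>C x)"]) (auto simp: bop_in[OF Y])
    then show "L (c *\<^sub>C x) = c *\<^sub>C L x" using x by (simp add: L_def)
  qed (use g gbd in \<open>auto simp: L_def\<close>)
  then show ?thesis using g gbd by (intro bexI[of _ L]) (auto simp: L_def)
qed

text \<open>
  The square root of \<open>1 - A\<close> is \<open>1 - Y\<close> for the fixed point \<open>Y = (A + Y\<^sup>2) / 2\<close>; the iteration
  starting at \<open>0\<close> is dominated by the scalar one for \<open>A = 1\<close>, which increases to \<open>1\<close>.
\<close>

primrec sqrt_iter :: "('a \<Rightarrow> 'a) \<Rightarrow> nat \<Rightarrow> 'a \<Rightarrow> 'a::complex_vector" where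
  "sqrt_iter A 0 = 0"
| "sqrt_iter A (Suc n) = (1/2) *\<^sub>C (A + (sqrt_iter A n \<circ> sqrt_iter A n))"

primrec scalar_iter :: "nat \<Rightarrow> real" where
  "scalar_iter 0 = 0"
| "scalar_iter (Suc n) = (1 + (scalar_iter n)\<^sup>2) / 2"

lemma scalar_iter_bounds: "0 \<le> scalar_iter n" "scalar_iter n \<le> 1"
  by (induction n) (auto simp: power_le_one)

text \<open>This is \<open>0 \<le> (1 - y)\<^sup>2\<close> for
  \<open>y = scalar_iter n\<close>.\<close>

lemma scalar_iter_mono: "scalar_iter n \<le> scalar_iter (Suc n)"
  using sum_squares_bound[of "scalar_iter n" 1] by simp

text \<open>Commutation with \<open>A\<close> passes to each iterate and to the limit; in Schur's
  lemma it makes a kernel invariant. Positivity of \<open>s\<close> holds because the limit of the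
  iteration is a contraction.\<close>

lemma bop_sqrt:
  assumes H: "hilbert H" and A: "A \<in> bop H H" "adj H H A = A"
    and le1: "\<And>x. x \<in> carr H \<Longrightarrow> hnorm H (A x) \<le> hnorm H x"
  shows "\<exists>s\<in>bop H H. adj H H s = s \<and> s \<circ> s = idop H - A \<and> (\<forall>x\<in>carr H. 0 \<le> Re (ip H (s x) x)) \<and>
    (\<forall>B\<in>bop H H. B \<circ> A = A \<circ> B \<longrightarrow> B \<circ> s = s \<circ> B)"
proof -
  interpret H: hilbert H by (rule H)
  let ?Y = "sqrt_iter A" and ?y = scalar_iter
  have Y: "?Y n \<in> bop H H" for n
  proof (induction n)
    case 0 show ?case unfolding sqrt_iter.simps by (rule bop_zero_fun[OF H H])
  next
    case (Suc n) show ?case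
      unfolding sqrt_iter.simps by (intro bop_scaleC[OF H H] bop_plus[OF H H] A(1) bop_comp[OF H H H] Suc)
  qed
  note [simp] = bop_in[OF Y] bop_in[OF A(1)]
  have Ysuc: "?Y (Suc m) z = (1/2) *\<^sub>C (A z + ?Y m (?Y m z))" for m z by (simp add: scaleC_fun_def)
  have Yadj: "adj H H (?Y n) = ?Y n" for n
  proof (induction n)
    case 0
    have "adj H H (0 *\<^sub>C idop H) = cnj 0 *\<^sub>C adj H H (idop H)" by (rule adj_scaleC[OF H H bop_idop[OF H]])
    then show ?case by (simp only: sqrt_iter.simps complex_vector.scale_zero_left complex_cnj_zero)
  next
    case (Suc n) then show ?case
      using H A Y by (simp add: adj_scaleC[OF H H] bop_plus bop_comp adj_plus[OF H H] adj_comp[OF H H H])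
  qed
  have Ycomm: "B \<circ> ?Y n = ?Y n \<circ> B" if B: "B \<in> bop H H" "B \<circ> A = A \<circ> B" for B n
  proof (induction n)
    case 0 show ?case using bop_zero[OF H B(1)] by (simp add: fun_eq_iff)
  next
    case (Suc n)
    have "B \<circ> (?Y n \<circ> ?Y n) = (?Y n \<circ> ?Y n) \<circ> B"
      using Suc by (metis comp_assoc)
    then show ?case
      unfolding sqrt_iter.simps bop_comp_scale_right[OF bop_plus[OF H H A(1) bop_comp[OF H H H Y Y]] B(1) H]
        bop_comp_add_right[OF A(1) bop_comp[OF H H H Y Y] B(1) H] comp_scale_left comp_add_left B(2) by (simp only:)
  qed
  have YY: "?Y m \<circ> ?Y n = ?Y n \<circ> ?Y m" for m n
    using Ycomm[OF Y Ycomm[OF A(1) refl, symmetric]] .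
  have Ybd: "hnorm H (?Y n x) \<le> ?y n * hnorm H x" if "x \<in> carr H" for n x
    using that
  proof (induction n arbitrary: x)
    case (Suc n)
    have "hnorm H (?Y (Suc n) x) = (1/2) * hnorm H (A x + ?Y n (?Y n x))"
      using Suc.prems by (simp add: scaleC_fun_def H.hnorm_scale)
    also have "\<dots> \<le> (1/2) * (hnorm H x + ?y n * (?y n * hnorm H x))"
    proof -
      have "hnorm H (?Y n (?Y n x)) \<le> ?y n * (?y n * hnorm H x)"
        using Suc.IH[of "?Y n x"] mult_left_mono[OF Suc.IH[OF Suc.prems] scalar_iter_bounds(1)[of n]] Suc.prems by (simp add: order_trans)
      then show ?thesis using H.hnorm_triangle[of "A x" "?Y n (?Y n x)"] le1[OF Suc.prems] Suc.prems by simp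
    qed
    also have "\<dots> = ?y (Suc n) * hnorm H x" by (simp add: power2_eq_square algebra_simps add_divide_distrib)
    finally show ?case .
  qed simp
  have step: "hnorm H (?Y (Suc n) x - ?Y n x) \<le> (?y (Suc n) - ?y n) * hnorm H x" if "x \<in> carr H" for n x
    using that
  proof (induction n arbitrary: x)
    case 0 then show ?case using le1[of x] by (simp add: scaleC_fun_def H.hnorm_scale)
  next
    case (Suc n)
    \<comment> \<open>Iterates commute, so the difference of consecutive squares factors as sum
      times difference; the scalar iteration obeys the same identity, which preserves the
      domination.\<close>
    define D where "D = ?Y (Suc n) x - ?Y n x"
    have D: "D \<in> carr H" using Suc.prems unfolding D_def by (intro H.diff_in bop_in[OF Y])
    have comm: "?Y (Suc n) (?Y n x) = ?Y n (?Y (Suc n) x)" using YY[of "Suc n" n] by (metis comp_apply)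
    have YD: "?Y (Suc n) D + ?Y n D = ?Y (Suc n) (?Y (Suc n) x) - ?Y n (?Y n x)"
      unfolding D_def bop_diff[OF H Y bop_in[OF Y Suc.prems] bop_in[OF Y Suc.prems]] comm by simp
    have "?Y (Suc (Suc n)) x - ?Y (Suc n) x = (1/2) *\<^sub>C (A x + ?Y (Suc n) (?Y (Suc n) x)) - (1/2) *\<^sub>C (A x + ?Y n (?Y n x))"
      by (rule arg_cong2[where f = "(-)"]; rule Ysuc)
    also have "\<dots> = (1/2) *\<^sub>C (?Y (Suc n) D + ?Y n D)"
      unfolding YD complex_vector.scale_right_diff_distrib[symmetric] by simp
    finally have eq: "?Y (Suc (Suc n)) x - ?Y (Suc n) x = (1/2) *\<^sub>C (?Y (Suc n) D + ?Y n D)" .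
    have "hnorm H (?Y (Suc (Suc n)) x - ?Y (Suc n) x) = (1/2) * hnorm H (?Y (Suc n) D + ?Y n D)"
      unfolding eq by (subst H.hnorm_scale) (auto simp del: sqrt_iter.simps intro!: H.add_in bop_in[OF Y] D)
    also have "\<dots> \<le> (1/2) * (?y (Suc n) * hnorm H D + ?y n * hnorm H D)"
      by (intro mult_left_mono order_trans[OF H.hnorm_triangle[OF bop_in[OF Y D] bop_in[OF Y D]]] add_mono Ybd D) simp
    also have "\<dots> = (1/2) * ((?y (Suc n) + ?y n) * hnorm H D)" by (simp only: distrib_right)
    also have "\<dots> \<le> (1/2) * ((?y (Suc n) + ?y n) * ((?y (Suc n) - ?y n) * hnorm H x))"
      using Suc.IH[OF Suc.prems] scalar_iter_bounds[of n] scalar_iter_bounds[of "Suc n"] unfolding D_def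
      by (intro mult_left_mono) (auto simp del: scalar_iter.simps sqrt_iter.simps)
    also have "\<dots> = (?y (Suc (Suc n)) - ?y (Suc n)) * hnorm H x"
      unfolding scalar_iter.simps(2)[of "Suc n"] scalar_iter.simps(2)[of n]
      by (simp add: power2_eq_square field_simps)
    finally show ?case .
  qed
  have diff: "hnorm H (?Y p x - ?Y q x) \<le> (?y p - ?y q) * hnorm H x" if x: "x \<in> carr H" and "q \<le> p" for p q x
    using \<open>q \<le> p\<close>
  proof (induction p rule: dec_induct)
    case (step p)
    have "hnorm H (?Y (Suc p) x - ?Y q x) \<le> hnorm H (?Y (Suc p) x - ?Y p x) + hnorm H (?Y p x - ?Y q x)"
      using x by (intro H.hnorm_triangle_diff bop_in[OF Y])
    also have "\<dots> \<le> (?y (Suc p) - ?y p) * hnorm H x + (?y p - ?y q) * hnorm H x"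
      using \<open>x \<in> carr H\<close> \<open>\<And>n x. x \<in> carr H \<Longrightarrow> hnorm H (?Y (Suc n) x - ?Y n x) \<le> (?y (Suc n) - ?y n) * hnorm H x\<close> step.IH by (intro add_mono)
    finally show ?case by (simp only: left_diff_distrib)
  qed simp
  have "Cauchy ?y"
  proof (rule convergent_Cauchy, rule Bseq_monoseq_convergent)
    show "Bseq ?y" using scalar_iter_bounds by (intro BseqI'[of _ 1]) auto
    show "monoseq ?y" using scalar_iter_mono by (intro mono_SucI1) auto
  qed
  have cv: "\<exists>l\<in>carr H. (\<lambda>n. hnorm H (?Y n x - l)) \<longlonglongrightarrow> 0" if x: "x \<in> carr H" for x
  proof (rule H.complete)
    fix e :: real assume e: "e > 0"
    have nx: "0 \<le> hnorm H x" using x by simp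
    then have "e / (hnorm H x + 1) > 0" using e by simp
    then obtain N where N: "\<And>p q. p \<ge> N \<Longrightarrow> q \<ge> N \<Longrightarrow> \<bar>?y p - ?y q\<bar> < e / (hnorm H x + 1)"
      using \<open>Cauchy ?y\<close> unfolding Cauchy_def dist_real_def by meson
    have *: "hnorm H (?Y p x - ?Y q x) < e" if "p \<ge> N" "q \<ge> N" "q \<le> p" for p q
    proof -
      have "hnorm H (?Y p x - ?Y q x) \<le> (?y p - ?y q) * hnorm H x" using diff x that by blast
      also have "\<dots> \<le> \<bar>?y p - ?y q\<bar> * (hnorm H x + 1)" using nx by (intro mult_mono) auto
      also have "\<dots> < e" using N[OF that(1,2)] nx by (simp add: pos_less_divide_eq)
      finally show ?thesis .
    qed
    have "hnorm H (?Y p x - ?Y q x) < e" if "p \<ge> N" "q \<ge> N" for p q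
      using *[of p q] *[of q p] that H.hnorm_diff_commute[OF bop_in[OF Y x] bop_in[OF Y x], of p q] by (cases "q \<le> p") auto
    then show "\<exists>N. \<forall>p\<ge>N. \<forall>q\<ge>N. hnorm H (?Y p x - ?Y q x) < e" by blast
  qed (use x in \<open>simp\<close>)
  have Ybd1: "hnorm H (?Y n x) \<le> 1 * hnorm H x" if "x \<in> carr H" for n x
    using Ybd[OF that, of n] mult_right_mono[OF scalar_iter_bounds(2)[of n] H.hnorm_ge_0[OF that]] by linarith
  obtain L where L: "L \<in> bop H H" "\<And>x. x \<in> carr H \<Longrightarrow> (\<lambda>n. hnorm H (?Y n x - L x)) \<longlonglongrightarrow> 0"
    "\<And>x. x \<in> carr H \<Longrightarrow> hnorm H (L x) \<le> hnorm H x"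
    using bop_pointwise_limit[OF H H Y Ybd1 cv] by auto
  note [simp] = bop_in[OF L(1)]
  have Ladj: "adj H H L = L"
  proof (rule adj_eqI[OF H H L(1)])
    fix x y assume xy: "x \<in> carr H" "y \<in> carr H"
    have 1: "(\<lambda>n. ip H (?Y n x) y) \<longlonglongrightarrow> ip H (L x) y" using xy L by (intro H.ip_tendsto_left) auto
    have "(\<lambda>n. ip H x (?Y n y)) \<longlonglongrightarrow> ip H x (L y)" using xy L by (intro H.ip_tendsto_right) auto
    then have "(\<lambda>n. ip H (?Y n x) y) \<longlonglongrightarrow> ip H x (L y)" using adj_ip[OF H H Y xy] Yadj by simp
    with 1 show "ip H (L x) y = ip H x (L y)" by (rule LIMSEQ_unique)
  qed
  have Lcomm: "B \<circ> L = L \<circ> B" if B: "B \<in> bop H H" "B \<circ> A = A \<circ> B" for B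
  proof (rule bop_ext[OF bop_comp[OF H H H B(1) L(1)] bop_comp[OF H H H L(1) B(1)]])
    fix x assume x: "x \<in> carr H"
    have BY: "B (?Y n x) = ?Y n (B x)" for n using Ycomm[OF B, of n] by (metis comp_apply)
    have "(\<lambda>n. hnorm H (B (?Y n x) - B (L x))) \<longlonglongrightarrow> 0" using x L by (intro bop_tendsto[OF H H B(1)]) auto
    moreover have "(\<lambda>n. hnorm H (B (?Y n x) - L (B x))) \<longlonglongrightarrow> 0" unfolding BY using x L bop_in[OF B(1)] by auto
    ultimately show "(B \<circ> L) x = (L \<circ> B) x"
      using H.lim_unique[of "\<lambda>n. B (?Y n x)"] x bop_in[OF B(1)] by simp
  qed
  \<comment> \<open>The fixed point equation survives the limit: squares converge because the
    iterates are uniformly contractive.\<close>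
  have Lfix: "L x = (1/2) *\<^sub>C (A x + L (L x))" if x: "x \<in> carr H" for x
  proof (rule H.lim_unique[of "\<lambda>n. ?Y (Suc n) x"])
    show "(\<lambda>m. hnorm H (?Y (Suc m) x - L x)) \<longlonglongrightarrow> 0" using L(2)[OF x] LIMSEQ_Suc by fast
    have "(\<lambda>n. hnorm H (?Y n (?Y n x) - L (L x))) \<longlonglongrightarrow> 0"
    proof (rule Lim_null_comparison)
      have "hnorm H (?Y n (?Y n x) - L (L x)) \<le> hnorm H (?Y n x - L x) + hnorm H (?Y n (L x) - L (L x))" for n
        using H.hnorm_triangle_diff[of "?Y n (?Y n x)" "?Y n (L x)" "L (L x)"] Ybd1[of "?Y n x - L x" n] x
        by (simp add: bop_diff[OF H Y])
      then show "\<forall>\<^sub>F n in sequentially. norm (hnorm H (?Y n (?Y n x) - L (L x))) \<le> hnorm H (?Y n x - L x) + hnorm H (?Y n (L x) - L (L x))"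
        using x by simp
      show "(\<lambda>n. hnorm H (?Y n x - L x) + hnorm H (?Y n (L x) - L (L x))) \<longlonglongrightarrow> 0"
        using tendsto_add[OF L(2)[OF x] L(2)[of "L x"]] x by simp
    qed
    then have "(\<lambda>n. hnorm H (A x + ?Y n (?Y n x) - (A x + L (L x)))) \<longlonglongrightarrow> 0" by simp
    then have "(\<lambda>n. hnorm H ((1/2) *\<^sub>C (A x + ?Y n (?Y n x)) - (1/2) *\<^sub>C (A x + L (L x)))) \<longlonglongrightarrow> 0"
      using x by (intro H.lim_scale) auto
    then show "(\<lambda>m. hnorm H (?Y (Suc m) x - (1/2) *\<^sub>C (A x + L (L x)))) \<longlonglongrightarrow> 0" by (simp add: scaleC_fun_def)
  qed (use x in \<open>auto simp: scaleC_fun_def\<close>)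
  define s where "s = idop H - L"
  have s: "s \<in> bop H H" unfolding s_def by (intro bop_diff_fun H bop_idop L)
  have sx: "s x = x - L x" if "x \<in> carr H" for x using that by (simp add: s_def idop_def)
  have "s \<circ> s = idop H - A"
  proof (rule bop_ext[OF bop_comp[OF H H H s s] bop_diff_fun[OF H H bop_idop[OF H] A(1)]])
    fix x assume x: "x \<in> carr H"
    \<comment> \<open>With \<open>2 L = A + L\<^sup>2\<close>, the square of \<open>1 - L\<close> is
      \<open>1 - A\<close>.\<close>
    have "2 *\<^sub>C L x = A x + L (L x)" using arg_cong[OF Lfix[OF x], of "(*\<^sub>C) 2"] by (simp add: scaleC_scaleC scaleC_one)
    moreover have "2 *\<^sub>C L x = L x + L x" using scaleC_add_left[of 1 1 "L x"] by (simp add: scaleC_one)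
    ultimately have e: "A x = L x + L x - L (L x)" by (metis add_diff_cancel_right')
    have "(s \<circ> s) x = (x - L x) - (L x - L (L x))" using x by (simp add: sx bop_diff[OF H L(1)])
    also have "\<dots> = x - A x" unfolding e by simp
    finally show "(s \<circ> s) x = (idop H - A) x" using x by (simp add: idop_def)
  qed
  moreover have "adj H H s = s" unfolding s_def by (simp add: adj_diff H L bop_idop adj_idop Ladj)
  moreover have "0 \<le> Re (ip H (s x) x)" if x: "x \<in> carr H" for x
  proof -
    have "Re (ip H (L x) x) \<le> hnorm H (L x) * hnorm H x"
      using H.Cauchy_Schwarz[of "L x" x] complex_Re_le_cmod[of "ip H (L x) x"] x by simp
    also have "\<dots> \<le> hnorm H x * hnorm H x" using L(3)[OF x] x by (intro mult_right_mono) auto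
    finally show ?thesis using x by (simp add: sx H.ip_diff_left H.ip_self power2_eq_square)
  qed
  moreover have "B \<circ> s = s \<circ> B" if "B \<in> bop H H" "B \<circ> A = A \<circ> B" for B
    unfolding s_def using that Lcomm[OF that]
    by (simp add: bop_comp_diff_right[OF bop_idop[OF H] L(1) that(1) H] comp_diff_left H)
  ultimately show ?thesis using s by blast
qed

text \<open>The operator is \<open>M\<close> times the square root of 1 - adj a a / M^2. It turns
  the bound on \<open>a\<close> into an exact identity of inner products, which passes to tensor
  products and *-representations, where a bound is read off again.\<close>

lemma defect_operator:
  assumes H: "hilbert H" and a: "a \<in> bop H H" and M: "M > 0" "opnorm H H a \<le> M"
  shows "\<exists>s\<in>bop H H. \<forall>x\<in>carr H. \<forall>y\<in>carr H. ip H (s x) (s y) = of_real (M\<^sup>2) * ip H x y - ip H (a x) (a y)"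
proof -
  interpret H: hilbert H by (rule H)
  note a' = adj_bop[OF H H a]
  let ?a' = "adj H H a" and ?k = "complex_of_real (1 / M\<^sup>2)"
  note [simp] = bop_in[OF a] bop_in[OF a']
  have aa: "?a' \<circ> a \<in> bop H H" by (rule bop_comp[OF H H H a' a])
  define c where "c = ?k *\<^sub>C (?a' \<circ> a)"
  have c: "c \<in> bop H H" unfolding c_def by (intro bop_scaleC H aa)
  have cadj: "adj H H c = c"
    by (simp add: c_def adj_scaleC[OF H H aa] adj_comp[OF H H H a' a] adj_adj[OF H H a])
  have cx: "c x = ?k *\<^sub>C ?a' (a x)" for x by (simp add: c_def scaleC_fun_def)
  have "hnorm H (c x) \<le> hnorm H x" if x: "x \<in> carr H" for x
  proof -
    have "hnorm H (?a' (a x)) \<le> M * hnorm H (a x)"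
      using opnorm_bound[OF H H a', of "a x"] x mult_right_mono[OF order_trans[OF opnorm_adj_le[OF H H a] M(2)], of "hnorm H (a x)"] by simp
    also have "\<dots> \<le> M * (M * hnorm H x)"
      using opnorm_bound[OF H H a x] mult_right_mono[OF M(2), of "hnorm H x"] x M(1) by (intro mult_left_mono) auto
    finally show ?thesis using x M(1)
      by (simp add: cx H.hnorm_scale norm_divide norm_mult power2_eq_square field_simps)
  qed
  then obtain s where s: "s \<in> bop H H" "adj H H s = s" "s \<circ> s = idop H - c" using bop_sqrt[OF H c cadj] by blast
  note [simp] = bop_in[OF s(1)]
  have "ip H ((of_real M *\<^sub>C s) x) ((of_real M *\<^sub>C s) y) = of_real (M\<^sup>2) * ip H x y - ip H (a x) (a y)"
    if x: "x \<in> carr H" and y: "y \<in> carr H" for x y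
  proof -
    have "ip H (s x) (s y) = ip H (s (s x)) y" using adj_ip[OF H H s(1), of "s x" y] s(2) x y by simp
    also have "s (s x) = x - c x" using fun_cong[OF s(3), of x] x by (simp add: idop_def)
    also have "ip H (x - c x) y = ip H x y - ?k * ip H (a x) (a y)"
      using x y adj_ip'[OF H H a, of y "a x"] by (simp add: cx H.ip_diff_left H.ip_scale)
    finally have "of_real (M\<^sup>2) * ip H (s x) (s y) = of_real (M\<^sup>2) * ip H x y - (of_real (M\<^sup>2) * ?k) * ip H (a x) (a y)"
      by (simp add: right_diff_distrib)
    also have "of_real (M\<^sup>2) * ?k = 1" using M(1) by simp
    finally show ?thesis using x y by (simp add: scaleC_fun_def H.ip_scale H.ip_scale_right power2_eq_square mult.assoc)
  qed
  then show ?thesis using bop_scaleC[OF H H s(1)] by blast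
qed

text \<open>The invariant subspace clause of \<open>irreducible_representation\<close> for the
  identity map, kept apart from the requirement that the representation be nonzero.\<close>

definition acts_irreducibly :: "'a::complex_vector hspace \<Rightarrow> ('a \<Rightarrow> 'a) set \<Rightarrow> bool" where
  "acts_irreducibly H C \<longleftrightarrow>
     (\<forall>V. closed_csubspace H V \<and> (\<forall>a\<in>C. \<forall>x\<in>V. a x \<in> V) \<longrightarrow> V = {0} \<or> V = carr H)"

text \<open>Irreducibility is applied to the kernel of \<open>\<bar>R - r\<bar> - (R - r)\<close>.\<close>

lemma Schur_dichotomy:
  assumes H: "hilbert H" and C: "C \<subseteq> bop H H" and irr: "acts_irreducibly H C"
    and R: "R \<in> bop H H" "adj H H R = R" and comm: "\<And>a. a \<in> C \<Longrightarrow> a \<circ> R = R \<circ> a"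
  shows "(\<forall>x\<in>carr H. r * (hnorm H x)\<^sup>2 \<le> Re (ip H (R x) x)) \<or> (\<forall>x\<in>carr H. Re (ip H (R x) x) \<le> r * (hnorm H x)\<^sup>2)"
proof -
  interpret H: hilbert H by (rule H)
  define D where "D = R - of_real r *\<^sub>C idop H"
  have rid: "of_real r *\<^sub>C idop H \<in> bop H H" by (intro bop_scaleC H bop_idop)
  have D: "D \<in> bop H H" unfolding D_def by (intro bop_diff_fun H R rid)
  have Dadj: "adj H H D = D" unfolding D_def
    by (simp add: adj_diff[OF H H R(1) rid] R adj_scaleC[OF H H bop_idop[OF H]] adj_idop H)
  have Dcomm: "a \<circ> D = D \<circ> a" if "a \<in> C" for a
    unfolding D_def using comm[OF that] subsetD[OF C that]
    by (simp add: bop_comp_diff_right[OF R(1) rid _ H] comp_diff_left comp_scale_left bop_comp_scale_right[OF bop_idop[OF H] _ H] H)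
  obtain M where M: "M > 0" "\<And>x. x \<in> carr H \<Longrightarrow> hnorm H (D x) \<le> M * hnorm H x" using bop_boundE[OF D H] by blast
  \<comment> \<open>Scaled to a contraction, so that \<open>1 - E\<^sup>2\<close> is one as well and
    \<open>bop_sqrt\<close> applied to it yields the absolute value of \<open>E\<close>.\<close>
  define E where "E = of_real (1 / M) *\<^sub>C D"
  have E: "E \<in> bop H H" unfolding E_def by (intro bop_scaleC H D)
  have Eadj: "adj H H E = E" unfolding E_def by (simp add: adj_scaleC[OF H H D] Dadj)
  have Ecomm: "a \<circ> E = E \<circ> a" if "a \<in> C" for a
    unfolding E_def using Dcomm[OF that] subsetD[OF C that]
    by (simp add: comp_scale_left bop_comp_scale_right[OF D _ H])
  have Ele: "hnorm H (E x) \<le> hnorm H x" if x: "x \<in> carr H" for x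
    using M(1) M(2)[OF x] bop_in[OF D x] by (simp add: E_def scaleC_fun_def H.hnorm_scale norm_divide pos_divide_le_eq mult.commute)
  define A where "A = idop H - (E \<circ> E)"
  note EE = bop_comp[OF H H H E E]
  note [simp] = bop_in[OF E]
  have A: "A \<in> bop H H" unfolding A_def by (intro bop_diff_fun H bop_idop EE)
  have Aadj: "adj H H A = A" unfolding A_def
    by (simp add: adj_diff[OF H H bop_idop[OF H] EE] adj_idop H adj_comp[OF H H H E E] Eadj)
  have "hnorm H (A x) \<le> hnorm H x" if x: "x \<in> carr H" for x
  proof (rule power2_le_imp_le)
    have "ip H x (E (E x)) = ip H (E x) (E x)" using adj_ip[OF H H E x, of "E x"] x Eadj by simp
    then have "(hnorm H (A x))\<^sup>2 = (hnorm H x)\<^sup>2 - 2 * (hnorm H (E x))\<^sup>2 + (hnorm H (E (E x)))\<^sup>2"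
      using x by (simp add: A_def idop_def H.hnorm_diff_sq H.ip_self)
    moreover have "(hnorm H (E (E x)))\<^sup>2 \<le> (hnorm H (E x))\<^sup>2" using Ele[of "E x"] x by (intro power_mono) auto
    ultimately show "(hnorm H (A x))\<^sup>2 \<le> (hnorm H x)\<^sup>2" using zero_le_power2[of "hnorm H (E x)"] by linarith
  qed (use x in simp)
  then obtain s where s: "s \<in> bop H H" "s \<circ> s = idop H - A" "\<And>x. x \<in> carr H \<Longrightarrow> 0 \<le> Re (ip H (s x) x)"
      "\<And>B. B \<in> bop H H \<Longrightarrow> B \<circ> A = A \<circ> B \<Longrightarrow> B \<circ> s = s \<circ> B"
    using bop_sqrt[OF H A Aadj] by blast
  note [simp] = bop_in[OF s(1)]
  have ssEE: "s \<circ> s = E \<circ> E" using s(2) by (simp add: A_def)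
  have comm_s: "B \<circ> s = s \<circ> B" if B: "B \<in> bop H H" "B \<circ> E = E \<circ> B" for B
  proof (rule s(4)[OF B(1)])
    have "B \<circ> (E \<circ> E) = (E \<circ> E) \<circ> B" using B(2) by (metis comp_assoc)
    then show "B \<circ> A = A \<circ> B" unfolding A_def using B(1)
      by (simp add: bop_comp_diff_right[OF bop_idop[OF H] EE B(1) H] comp_diff_left H)
  qed
  have Es: "E (s x) = s (E x)" for x using comm_s[OF E refl] by (metis comp_apply)
  let ?V = "{x \<in> carr H. (s - E) x = 0}"
  have "closed_csubspace H ?V" by (rule kernel_closed[OF H H bop_diff_fun[OF H H s(1) E]])
  moreover have "a x \<in> ?V" if "a \<in> C" "x \<in> ?V" for a x
  proof -
    have a: "a \<in> bop H H" using C that by auto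
    have "s (a x) = a (s x)" "E (a x) = a (E x)" using comm_s[OF a Ecomm[OF that(1)]] Ecomm[OF that(1)] by (metis comp_apply)+
    then show ?thesis using that(2) bop_in[OF a] by simp
  qed
  ultimately have V: "?V = {0} \<or> ?V = carr H" using irr unfolding acts_irreducibly_def by blast
  have ED: "Re (ip H (E x) x) = (1 / M) * (Re (ip H (R x) x) - r * (hnorm H x)\<^sup>2)" if x: "x \<in> carr H" for x
    using x bop_in[OF D x] bop_in[OF R(1) x]
    by (simp add: E_def scaleC_fun_def H.ip_scale) (simp add: D_def idop_def scaleC_fun_def H.ip_diff_left H.ip_scale H.ip_self)
  from V show ?thesis
  proof
    assume V0: "?V = {0}"
    have "Re (ip H (R x) x) \<le> r * (hnorm H x)\<^sup>2" if x: "x \<in> carr H" for x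
    proof -
      \<comment> \<open>Since \<open>s\<close> commutes with \<open>E\<close> and
        \<open>s\<^sup>2 = E\<^sup>2\<close>, the range of \<open>s + E\<close> lies in the kernel
        of \<open>s - E\<close>.\<close>
      have "s (s x + E x) = E (s x + E x)"
        using x fun_cong[OF ssEE, of x] by (simp add: bop_add[OF s(1)] bop_add[OF E] Es)
      then have "s x + E x \<in> ?V" using x by simp
      then have "s x + E x = 0" using V0 by blast
      then have "E x = - s x" by (simp add: eq_neg_iff_add_eq_0 add.commute)
      then have "Re (ip H (E x) x) \<le> 0" using s(3)[OF x] x by simp
      then show ?thesis using ED[OF x] M(1) by (simp add: mult_le_0_iff divide_le_0_iff)
    qed
    then show ?thesis by blast
  next
    assume V1: "?V = carr H"
    have "r * (hnorm H x)\<^sup>2 \<le> Re (ip H (R x) x)" if x: "x \<in> carr H" for x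
    proof -
      have "x \<in> ?V" using V1 x by blast
      then have "E x = s x" by simp
      then have "0 \<le> Re (ip H (E x) x)" using s(3)[OF x] by simp
      then show ?thesis using ED[OF x] M(1) by (simp add: zero_le_divide_iff)
    qed
    then show ?thesis by blast
  qed
qed

text \<open>\<open>r\<close> is the Rayleigh quotient at one vector \<open>x0\<close>. Below
  \<open>r\<close> one alternative of the dichotomy fails at \<open>x0\<close>, above
  \<open>r\<close> the other, so the form of \<open>R\<close> is squeezed between all t < r and all
  t > r.\<close>

lemma Schur_selfadjoint:
  assumes H: "hilbert H" and C: "C \<subseteq> bop H H" and irr: "acts_irreducibly H C"
    and R: "R \<in> bop H H" "adj H H R = R" and comm: "\<And>a. a \<in> C \<Longrightarrow> a \<circ> R = R \<circ> a"
  shows "\<exists>c. R = c *\<^sub>C idop H"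
proof (cases "carr H = {0}")
  case True
  have "R = 0 *\<^sub>C idop H"
    by (rule bop_ext[OF R(1) bop_scaleC[OF H H bop_idop[OF H]]]) (use True bop_zero[OF H R(1)] in auto)
  then show ?thesis by blast
next
  case False
  interpret H: hilbert H by (rule H)
  obtain x0 where x0: "x0 \<in> carr H" "x0 \<noteq> 0" using False H.zero_in by blast
  have n0: "(hnorm H x0)\<^sup>2 > 0" using H.hnorm_eq_0[OF x0(1)] x0 by simp
  define r where "r = Re (ip H (R x0) x0) / (hnorm H x0)\<^sup>2"
  have r: "Re (ip H (R x0) x0) = r * (hnorm H x0)\<^sup>2" using n0 by (simp add: r_def)
  note dich = Schur_dichotomy[OF H C irr R comm]
  have ge: "r * (hnorm H x)\<^sup>2 \<le> Re (ip H (R x) x)" if x: "x \<in> carr H" for x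
  proof -
    have *: "t * (hnorm H x)\<^sup>2 \<le> Re (ip H (R x) x)" if "t < r" for t
    proof -
      have "\<not> Re (ip H (R x0) x0) \<le> t * (hnorm H x0)\<^sup>2" using r that n0 by simp
      then show ?thesis using dich[of t] x x0 by blast
    qed
    have "((\<lambda>t. t * (hnorm H x)\<^sup>2) \<longlongrightarrow> r * (hnorm H x)\<^sup>2) (at_left r)" by (intro tendsto_intros)
    moreover have "\<forall>\<^sub>F t in at_left r. t * (hnorm H x)\<^sup>2 \<le> Re (ip H (R x) x)"
      using * by (auto simp: eventually_at_left_field intro: lt_ex)
    ultimately show ?thesis by (rule tendsto_upperbound) simp
  qed
  have le: "Re (ip H (R x) x) \<le> r * (hnorm H x)\<^sup>2" if x: "x \<in> carr H" for x
  proof -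
    have *: "Re (ip H (R x) x) \<le> t * (hnorm H x)\<^sup>2" if "r < t" for t
    proof -
      have "\<not> t * (hnorm H x0)\<^sup>2 \<le> Re (ip H (R x0) x0)" using r that n0 by simp
      then show ?thesis using dich[of t] x x0 by blast
    qed
    have "((\<lambda>t. t * (hnorm H x)\<^sup>2) \<longlongrightarrow> r * (hnorm H x)\<^sup>2) (at_right r)" by (intro tendsto_intros)
    moreover have "\<forall>\<^sub>F t in at_right r. Re (ip H (R x) x) \<le> t * (hnorm H x)\<^sup>2"
      using * by (auto simp: eventually_at_right_field intro: gt_ex)
    ultimately show ?thesis by (rule tendsto_lowerbound) simp
  qed
  define S where "S = R - of_real r *\<^sub>C idop H"
  have rid: "of_real r *\<^sub>C idop H \<in> bop H H" by (intro bop_scaleC H bop_idop)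
  have S: "S \<in> bop H H" unfolding S_def by (intro bop_diff_fun H R rid)
  have Sadj: "adj H H S = S" unfolding S_def
    by (simp add: adj_diff[OF H H R(1) rid] R adj_scaleC[OF H H bop_idop[OF H]] adj_idop H)
  note [simp] = bop_in[OF S] bop_in[OF R(1)]
  have S0: "Re (ip H (S x) x) = 0" if x: "x \<in> carr H" for x
    using ge[OF x] le[OF x] x by (simp add: S_def idop_def scaleC_fun_def H.ip_diff_left H.ip_scale H.ip_self)
  have "S x = 0" if x: "x \<in> carr H" for x
  proof -
    \<comment> \<open>Polarization at \<open>x + S x\<close>: the real form of \<open>S\<close>
      vanishes on the diagonal, and the cross terms add up to
      \<open>2 * (hnorm H (S x))\<^sup>2\<close>.\<close>
    have "ip H (S (S x)) x = ip H (S x) (S x)" using adj_ip[OF H H S, of "S x" x] x Sadj by simp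
    then have "Re (ip H (S (x + S x)) (x + S x)) = Re (ip H (S x) x) + Re (ip H (S (S x)) (S x)) + 2 * (hnorm H (S x))\<^sup>2"
      using x by (simp add: bop_add[OF S] H.ip_add H.ip_add_right H.ip_self)
    then have "(hnorm H (S x))\<^sup>2 = 0" using S0[of "x + S x"] S0[of x] S0[of "S x"] x by simp
    then show ?thesis using H.hnorm_eq_0[of "S x"] x by simp
  qed
  then have "R = of_real r *\<^sub>C idop H"
    by (intro bop_ext[OF R(1) rid]) (simp add: S_def)
  then show ?thesis by blast
qed

text \<open>\<open>R\<close> is recovered from the selfadjoint operators R + adj R and \<i> R - \<i>
  adj R; closure of \<open>C\<close> under adjoints makes adj R commute with \<open>C\<close> as
  well.\<close>

lemma Schur:
  assumes H: "hilbert H" and C: "C \<subseteq> bop H H" "\<And>a. a \<in> C \<Longrightarrow> adj H H a \<in> C" and irr: "acts_irreducibly H C"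
    and R: "R \<in> bop H H" and comm: "\<And>a. a \<in> C \<Longrightarrow> a \<circ> R = R \<circ> a"
  shows "\<exists>c. R = c *\<^sub>C idop H"
proof -
  let ?R' = "adj H H R"
  have R': "?R' \<in> bop H H" by (rule adj_bop[OF H H R])
  have comm': "a \<circ> ?R' = ?R' \<circ> a" if a: "a \<in> C" for a
  proof -
    have "a \<in> bop H H" and a': "adj H H a \<in> bop H H" using C a by auto
    then have "adj H H (R \<circ> adj H H a) = a \<circ> ?R'" "adj H H (adj H H a \<circ> R) = ?R' \<circ> a"
      by (simp_all add: adj_comp[OF H H H] adj_adj[OF H H] R)
    then show ?thesis using comm[OF C(2)[OF a]] by simp
  qed
  have "\<exists>c. R + ?R' = c *\<^sub>C idop H"
    by (rule Schur_selfadjoint[OF H C(1) irr bop_plus[OF H H R R']])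
      (use C comm comm' in \<open>auto simp: adj_plus[OF H H R R'] adj_adj[OF H H R] add.commute bop_comp_add_right[OF R R' _ H] comp_add_left subset_iff\<close>)
  then obtain c1 where c1: "R + ?R' = c1 *\<^sub>C idop H" by blast
  have iR: "\<i> *\<^sub>C R \<in> bop H H" "(- \<i>) *\<^sub>C ?R' \<in> bop H H" by (intro bop_scaleC H R R')+
  have "\<exists>c. \<i> *\<^sub>C R + (- \<i>) *\<^sub>C ?R' = c *\<^sub>C idop H"
    by (rule Schur_selfadjoint[OF H C(1) irr bop_plus[OF H H iR]])
      (use C comm comm' in \<open>auto simp: adj_plus[OF H H iR] adj_scaleC[OF H H R] adj_scaleC[OF H H R'] adj_adj[OF H H R] add.commute
         bop_comp_add_right[OF iR _ H] bop_comp_scale_right[OF R _ H] bop_comp_scale_right[OF R' _ H] comp_add_left comp_scale_left subset_iff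
         simp del: complex_vector.scale_minus_left\<close>)
  then obtain c2 where c2: "\<i> *\<^sub>C R + (- \<i>) *\<^sub>C ?R' = c2 *\<^sub>C idop H" by blast
  have "2 *\<^sub>C R = (R + ?R') + (- \<i>) *\<^sub>C (\<i> *\<^sub>C R + (- \<i>) *\<^sub>C ?R')"
  proof -
    have "2 *\<^sub>C R = R + R" using scaleC_add_left[of 1 1 R] by (simp add: scaleC_one)
    then show ?thesis by (simp add: scaleC_add_right scaleC_scaleC scaleC_one complex_vector.scale_right_diff_distrib)
  qed
  also have "\<dots> = (c1 - \<i> * c2) *\<^sub>C idop H"
    unfolding c1 c2 by (simp add: scaleC_scaleC complex_vector.scale_left_diff_distrib)
  finally have "(1/2) *\<^sub>C (2 *\<^sub>C R) = ((c1 - \<i> * c2) / 2) *\<^sub>C idop H" by (simp add: scaleC_scaleC)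
  then have "R = ((c1 - \<i> * c2) / 2) *\<^sub>C idop H" by (simp add: scaleC_scaleC scaleC_one)
  then show ?thesis by blast
qed

section \<open>Generated algebras and completely positive maps\<close>

lemma opnorm_lim_unique:
  assumes H: "hilbert H" and K: "hilbert K" and X: "\<And>m. X m \<in> bop H K" "l \<in> bop H K" "(\<lambda>m. opnorm H K (X m - l)) \<longlonglongrightarrow> 0"
    and k: "k \<in> bop H K" "(\<lambda>m. opnorm H K (X m - k)) \<longlonglongrightarrow> 0"
  shows "l = k"
proof (rule bop_ext[OF X(2) k(1)])
  fix x assume x: "x \<in> carr H"
  show "l x = k x"
    by (rule hilbert.lim_unique[OF K, of "\<lambda>m. X m x"])
      (use bop_in[OF X(1) x] bop_in[OF X(2) x] bop_in[OF k(1) x] opnorm_tendsto_pointwise[OF H K X x] opnorm_tendsto_pointwise[OF H K X(1) k x] in auto)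
qed

lemma opnorm_lim_comp_right:
  assumes H: "hilbert H" and K: "hilbert K" and L: "hilbert L"
    and X: "\<And>m. X m \<in> bop K L" "l \<in> bop K L" "(\<lambda>m. opnorm K L (X m - l)) \<longlonglongrightarrow> 0" and y: "y \<in> bop H K"
  shows "(\<lambda>m. opnorm H L ((X m \<circ> y) - (l \<circ> y))) \<longlonglongrightarrow> 0"
proof (rule Lim_null_comparison)
  have "opnorm H L ((X m \<circ> y) - (l \<circ> y)) \<le> opnorm K L (X m - l) * opnorm H K y" for m
    using opnorm_comp_le[OF H K L bop_diff_fun[OF K L X(1,2)] y] by (simp add: comp_diff_left)
  then show "\<forall>\<^sub>F m in sequentially. norm (opnorm H L ((X m \<circ> y) - (l \<circ> y))) \<le> opnorm K L (X m - l) * opnorm H K y"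
    using opnorm_ge_0[OF H L bop_diff_fun[OF H L bop_comp[OF H K L X(1) y] bop_comp[OF H K L X(2) y]]] by simp
  show "(\<lambda>m. opnorm K L (X m - l) * opnorm H K y) \<longlonglongrightarrow> 0" using tendsto_mult_right[OF X(3), of "opnorm H K y"] by simp
qed

lemma opnorm_lim_adj:
  assumes H: "hilbert H" and K: "hilbert K"
    and X: "\<And>m. X m \<in> bop H K" "l \<in> bop H K" "(\<lambda>m. opnorm H K (X m - l)) \<longlonglongrightarrow> 0"
  shows "(\<lambda>m. opnorm K H (adj H K (X m) - adj H K l)) \<longlonglongrightarrow> 0"
proof (rule Lim_null_comparison[OF _ X(3)])
  have "opnorm K H (adj H K (X m) - adj H K l) \<le> opnorm H K (X m - l)" for m
    using opnorm_adj_le[OF H K bop_diff_fun[OF H K X(1,2)]] by (simp add: adj_diff[OF H K X(1,2)])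
  then show "\<forall>\<^sub>F m in sequentially. norm (opnorm K H (adj H K (X m) - adj H K l)) \<le> opnorm H K (X m - l)"
    using opnorm_ge_0[OF K H bop_diff_fun[OF K H adj_bop[OF H K X(1)] adj_bop[OF H K X(2)]]] by simp
qed

section \<open>Closed algebras and algebras generated by a set\<close>

lemma banach_algebraI:
  assumes "A \<subseteq> bop H H" "0 \<in> A" "\<And>a b. a \<in> A \<Longrightarrow> b \<in> A \<Longrightarrow> a + b \<in> A" "\<And>c a. a \<in> A \<Longrightarrow> c *\<^sub>C a \<in> A"
    "\<And>a b. a \<in> A \<Longrightarrow> b \<in> A \<Longrightarrow> a \<circ> b \<in> A"
    "\<And>X l. (\<And>m. X m \<in> A) \<Longrightarrow> l \<in> bop H H \<Longrightarrow> (\<lambda>m. opnorm H H (X m - l)) \<longlonglongrightarrow> 0 \<Longrightarrow> l \<in> A"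
  shows "banach_algebra H A"
  unfolding banach_algebra_def complex_vector.subspace_def
proof (intro conjI ballI allI impI)
  fix X l assume "(\<forall>m. X m \<in> A) \<and> l \<in> bop H H \<and> (\<lambda>m. opnorm H H (X m - l)) \<longlonglongrightarrow> 0"
  then show "l \<in> A" by (intro assms(6)[of X l]) simp_all
qed (rule assms(1-5); assumption?)+

lemma
  assumes "banach_algebra H A"
  shows banach_algebra_bop: "A \<subseteq> bop H H" and banach_algebra_subspace: "csubspace A"
    and banach_algebra_comp: "a \<in> A \<Longrightarrow> b \<in> A \<Longrightarrow> a \<circ> b \<in> A"
    and banach_algebra_lim: "(\<And>m. X m \<in> A) \<Longrightarrow> l \<in> bop H H \<Longrightarrow> (\<lambda>m. opnorm H H (X m - l)) \<longlonglongrightarrow> 0 \<Longrightarrow> l \<in> A"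
proof -
  show "A \<subseteq> bop H H" "csubspace A" "a \<in> A \<Longrightarrow> b \<in> A \<Longrightarrow> a \<circ> b \<in> A" using assms by (simp_all add: banach_algebra_def)
  show "l \<in> A" if "\<And>m. X m \<in> A" "l \<in> bop H H" "(\<lambda>m. opnorm H H (X m - l)) \<longlonglongrightarrow> 0"
    using assms that unfolding banach_algebra_def by blast
qed

lemma bop_banach_algebra: "hilbert H \<Longrightarrow> banach_algebra H (bop H H)"
  by (rule banach_algebraI) (auto intro: bop_zero_fun bop_plus bop_scaleC bop_comp)

lemma bop_cstar_algebra: "hilbert H \<Longrightarrow> cstar_algebra H (bop H H)"
  by (simp add: cstar_algebra_def bop_banach_algebra adj_bop)

text \<open>Lets the inclusion of a generated C*-algebra in an algebra not known to be closed under
  adjoints be checked on the generators and their adjoints.\<close>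

lemma banach_algebra_star_part:
  assumes H: "hilbert H" and A: "banach_algebra H A"
  shows "cstar_algebra H {a \<in> A. adj H H a \<in> A}"
proof -
  note Ab = subsetD[OF banach_algebra_bop[OF A]]
  note sub = banach_algebra_subspace[OF A]
  have "banach_algebra H {a \<in> A. adj H H a \<in> A}"
  proof (rule banach_algebraI, goal_cases)
    case 1 show ?case using Ab by blast
  next
    case 2
    have "adj H H (0 *\<^sub>C 0) = cnj 0 *\<^sub>C adj H H 0" by (rule adj_scaleC[OF H H bop_zero_fun[OF H H]])
    then have "adj H H 0 = 0" by simp
    then show ?case using complex_vector.subspace_0[OF sub] by (simp only: mem_Collect_eq)
  next
    case (3 a b) then show ?case using Ab by (simp add: adj_plus[OF H H] complex_vector.subspace_add[OF sub])
  next
    case (4 c a) then show ?case using Ab by (simp add: adj_scaleC[OF H H] complex_vector.subspace_scale[OF sub])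
  next
    case (5 a b) then show ?case using Ab by (simp add: adj_comp[OF H H H] banach_algebra_comp[OF A])
  next
    case (6 X l)
    then have X: "\<And>m. X m \<in> bop H H" using Ab by blast
    show ?case using banach_algebra_lim[OF A _ 6(2,3)] banach_algebra_lim[OF A _ adj_bop[OF H H 6(2)] opnorm_lim_adj[OF H H X 6(2,3)]] 6(1)
      by blast
  qed
  then show ?thesis using Ab by (auto simp: cstar_algebra_def adj_adj[OF H H])
qed

lemma banach_gen_min: "banach_algebra H A \<Longrightarrow> S \<subseteq> A \<Longrightarrow> banach_gen H S \<subseteq> A"
  by (auto simp: banach_gen_def)

lemma cstar_gen_min: "cstar_algebra H A \<Longrightarrow> S \<subseteq> A \<Longrightarrow> cstar_gen H S \<subseteq> A"
  by (auto simp: cstar_gen_def)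

lemma banach_gen_incl: "S \<subseteq> banach_gen H S"
  by (auto simp: banach_gen_def)

lemma cstar_gen_incl: "S \<subseteq> cstar_gen H S"
  by (auto simp: cstar_gen_def)

lemma banach_gen_algebra:
  assumes H: "hilbert H" and S: "S \<subseteq> bop H H"
  shows "banach_algebra H (banach_gen H S)"
proof -
  let ?F = "{A. banach_algebra H A \<and> S \<subseteq> A}"
  show ?thesis unfolding banach_gen_def
  proof (rule banach_algebraI, goal_cases)
    \<comment> \<open>The intersection is over a nonempty family, since \<open>bop H H\<close>
      belongs to it.\<close>
    case 1 show ?case using bop_banach_algebra[OF H] S by blast
  next
    case 2 show ?case by (auto dest: banach_algebra_subspace complex_vector.subspace_0)
  next
    case (3 a b) then show ?case by (auto intro!: complex_vector.subspace_add banach_algebra_subspace)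
  next
    case (4 c a) then show ?case by (auto intro!: complex_vector.subspace_scale banach_algebra_subspace)
  next
    case (5 a b) then show ?case by (auto intro: banach_algebra_comp)
  next
    case (6 X l)
    have "l \<in> A" if "banach_algebra H A" "S \<subseteq> A" for A
      using banach_algebra_lim[OF that(1) _ 6(2,3)] 6(1) that by blast
    then show ?case by blast
  qed
qed

lemma cstar_gen_algebra:
  assumes H: "hilbert H" and S: "S \<subseteq> bop H H"
  shows "cstar_algebra H (cstar_gen H S)"
proof -
  have "banach_algebra H (cstar_gen H S)" unfolding cstar_gen_def
  proof (rule banach_algebraI, goal_cases)
    case 1 show ?case using bop_cstar_algebra[OF H] S by blast
  next
    case 2 show ?case by (auto simp: cstar_algebra_def dest: banach_algebra_subspace complex_vector.subspace_0)
  next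
    case (3 a b) then show ?case by (auto simp: cstar_algebra_def intro!: complex_vector.subspace_add banach_algebra_subspace)
  next
    case (4 c a) then show ?case by (auto simp: cstar_algebra_def intro!: complex_vector.subspace_scale banach_algebra_subspace)
  next
    case (5 a b) then show ?case by (auto simp: cstar_algebra_def intro: banach_algebra_comp)
  next
    case (6 X l)
    have "l \<in> A" if "cstar_algebra H A" "S \<subseteq> A" for A
    proof -
      have "banach_algebra H A" using that(1) by (simp add: cstar_algebra_def)
      then show ?thesis using banach_algebra_lim[OF _ _ 6(2,3)] 6(1) that by blast
    qed
    then show ?case by blast
  qed
  then show ?thesis by (auto simp: cstar_algebra_def cstar_gen_def)
qed

lemma
  assumes "cstar_algebra H A"
  shows cstar_banach: "banach_algebra H A" and cstar_adj: "a \<in> A \<Longrightarrow> adj H H a \<in> A"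
  using assms by (auto simp: cstar_algebra_def)

section \<open>The boundary property of the identity, split into three conditions\<close>

definition unique_cp_extension :: "'a::complex_vector hspace \<Rightarrow> ('a \<Rightarrow> 'a) set \<Rightarrow> bool" where
  "unique_cp_extension H S \<longleftrightarrow>
     (\<forall>\<phi>. completely_positive H (cstar_gen H S) H \<phi> \<and> (\<forall>a\<in>banach_gen H S. \<phi> a = a) \<longrightarrow> (\<forall>c\<in>cstar_gen H S. \<phi> c = c))"

text \<open>The identity map is multiplicative, adjoint-preserving and completely positive by
  definition; the conditions that remain are compared separately for the product and its
  factors.\<close>

lemma boundary_identity_iff:
  assumes H: "hilbert H" and S: "S \<subseteq> bop H H"
  shows "boundary_representation H (banach_gen H S) H (\<lambda>a. a) \<longleftrightarrow>
    (\<exists>a\<in>cstar_gen H S. a \<noteq> 0) \<and> acts_irreducibly H (cstar_gen H S) \<and> unique_cp_extension H S"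
proof -
  have "linear_into_bop (cstar_gen H S) H (\<lambda>a. a)"
    using banach_algebra_bop[OF cstar_banach[OF cstar_gen_algebra[OF assms]]] by (auto simp: linear_into_bop_def)
  then show ?thesis
    using H by (simp add: boundary_representation_def cstar_gen_banach_gen Let_def irreducible_representation_def
        representation_def completely_positive_def acts_irreducibly_def unique_cp_extension_def)
qed

text \<open>The identity is a generator, and it vanishes only on the zero space.\<close>

lemma cstar_gen_nonzero_iff:
  assumes "hilbert H" "S \<subseteq> bop H H" "idop H \<in> S"
  shows "(\<exists>a\<in>cstar_gen H S. a \<noteq> 0) \<longleftrightarrow> carr H \<noteq> {0}"
proof
  assume "\<exists>a\<in>cstar_gen H S. a \<noteq> 0"
  then obtain a where a: "a \<in> cstar_gen H S" "a \<noteq> 0" by blast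
  have ab: "a \<in> bop H H" using a banach_algebra_bop[OF cstar_banach[OF cstar_gen_algebra[OF assms(1,2)]]] by blast
  show "carr H \<noteq> {0}"
  proof
    assume "carr H = {0}"
    then have "a = 0" using bop_zero[OF assms(1) ab] bop_off[OF ab] by (intro ext) (metis singletonD zero_fun_apply)
    with a show False by simp
  qed
next
  assume "carr H \<noteq> {0}"
  then obtain x where x: "x \<in> carr H" "x \<noteq> 0" using hilbert.zero_in[OF assms(1)] by blast
  then have "idop H x \<noteq> 0" by (simp add: idop_eq)
  then have "idop H \<noteq> 0" by (auto simp: fun_eq_iff)
  then show "\<exists>a\<in>cstar_gen H S. a \<noteq> 0" using cstar_gen_incl assms(3) by blast
qed

text \<open>The discriminant criterion in the shape in which 2 by 2 positivity arises.
  \<open>\<beta>\<close> is independent of \<open>\<alpha>\<close> because it will come from values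
  at adjoints; the parameters 1, -1 and \<i> force it to be \<open>cnj \<alpha>\<close>.\<close>

lemma nonneg_form_bound:
  fixes p :: real and q \<alpha> \<beta> :: complex
  assumes *: "\<And>t. complex_of_real p + of_real ((cmod t)\<^sup>2) * q + t * \<alpha> + cnj t * \<beta> \<in> \<real>\<^sub>\<ge>\<^sub>0"
  shows "(cmod \<alpha>)\<^sup>2 \<le> p * Re q"
proof -
  have p: "p \<ge> 0" using *[of 0] by (simp add: complex_nonneg_Reals_iff)
  have "Im q + (Im \<alpha> + Im \<beta>) = 0" "Im q - (Im \<alpha> + Im \<beta>) = 0" "Im q + (Re \<alpha> - Re \<beta>) = 0"
    using *[of 1] *[of "-1"] *[of \<i>] by (auto simp: complex_nonneg_Reals_iff)
  then have \<beta>: "\<beta> = cnj \<alpha>" by (auto simp: complex_eq_iff)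
  have re: "0 \<le> p + (cmod t)\<^sup>2 * Re q + 2 * Re (t * \<alpha>)" for t
  proof -
    have "Re (cnj t * cnj \<alpha>) = Re (t * \<alpha>)" by simp
    then show ?thesis using *[of t] unfolding \<beta> by (auto simp: complex_nonneg_Reals_iff algebra_simps)
  qed
  have q: "Re q \<ge> 0"
  proof (rule ccontr)
    assume "\<not> 0 \<le> Re q"
    \<comment> \<open>Chosen so that \<open>t\<^sup>2 * Re q = - (p + 1)\<close>; adding the
      inequalities at \<open>t\<close> and \<open>- t\<close> removes the linear term and gives a
      negative sum.\<close>
    define t where "t = sqrt ((p + 1) / - Re q)"
    have t2: "t\<^sup>2 = (p + 1) / - Re q" using p \<open>\<not> 0 \<le> Re q\<close> by (simp add: t_def divide_nonneg_nonpos divide_nonneg_neg)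
    have "t\<^sup>2 * Re q = - (p + 1)" unfolding t2 using \<open>\<not> 0 \<le> Re q\<close> by simp
    then show False using re[of "of_real t"] re[of "- of_real t"] by simp
  qed
  show ?thesis
  proof (cases "\<alpha> = 0")
    case True then show ?thesis using p q by simp
  next
    case False
    define a where "a = (cmod \<alpha>)\<^sup>2"
    have a: "a > 0" using False by (simp add: a_def)
    \<comment> \<open>A real multiple of \<open>- cnj \<alpha>\<close> as parameter makes the linear
      term real. The minimum is at \<open>1 / Re q\<close>; for \<open>Re q = 0\<close> a large
      \<open>s\<close> contradicts \<open>\<alpha> \<noteq> 0\<close>.\<close>
    have s: "0 \<le> p + s\<^sup>2 * a * Re q - 2 * s * a" for s
    proof -
      have "(- of_real s * cnj \<alpha>) * \<alpha> = of_real (- s * a)"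
        using complex_norm_square[of \<alpha>] by (simp add: a_def mult_ac)
      then have e1: "Re ((- of_real s * cnj \<alpha>) * \<alpha>) = - s * a" by (metis Re_complex_of_real)
      have e2: "(cmod (- of_real s * cnj \<alpha>))\<^sup>2 = s\<^sup>2 * a" by (simp add: a_def norm_mult power_mult_distrib)
      show ?thesis using re[of "- of_real s * cnj \<alpha>"] unfolding e1 e2 by simp
    qed
    show ?thesis
    proof (cases "Re q = 0")
      case True
      have "2 * ((p + 1) / (2 * a)) * a = p + 1" using a by simp
      then show ?thesis using s[of "(p + 1) / (2 * a)"] True by simp
    next
      case False
      then have q: "Re q > 0" using q by simp
      have "(1 / Re q)\<^sup>2 * a * Re q = a / Re q" using q by (simp add: power2_eq_square)
      then have "a / Re q \<le> p" using s[of "1 / Re q"] by simp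
      then show ?thesis using q by (simp add: a_def pos_divide_le_eq)
    qed
  qed
qed

section \<open>Completely positive maps and their multiplicative domain\<close>

lemma cp_linear: "completely_positive H C K \<phi> \<Longrightarrow> linear_into_bop C K \<phi>"
  by (simp add: completely_positive_def)

lemma cp_matrix:
  assumes "completely_positive H C K \<phi>" "\<And>i j. i < m \<Longrightarrow> j < m \<Longrightarrow> a i j \<in> C" "positive_matrix H m a"
  shows "positive_matrix K m (\<lambda>i j. \<phi> (a i j))"
proof -
  have "(\<forall>i<m. \<forall>j<m. a i j \<in> C) \<and> positive_matrix H m a" using assms(2,3) by simp
  then show ?thesis using assms(1) by (simp add: completely_positive_def)
qed

lemma linear_into_bop_diff:
  assumes "linear_into_bop C K \<phi>" "csubspace C" "a \<in> C" "b \<in> C"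
  shows "\<phi> (a - b) = \<phi> a - \<phi> b"
proof -
  have "\<phi> (a + (-1) *\<^sub>C b) = \<phi> a + (-1) *\<^sub>C \<phi> b"
    using assms complex_vector.subspace_scale[of C b "-1"] unfolding linear_into_bop_def by metis
  then show ?thesis by simp
qed

text \<open>Matrices in \<open>completely_positive\<close> are indexed by numbers below
  \<open>m\<close>; a bijection carries the property to any finite index set, in particular to pairs
  of a row and an elementary tensor.\<close>

lemma cp_positive_kernel:
  assumes cp: "completely_positive H C K \<phi>" and J: "finite J" and a: "\<And>i j. i \<in> J \<Longrightarrow> j \<in> J \<Longrightarrow> a i j \<in> C"
    and pos: "\<And>x. (\<And>i. i \<in> J \<Longrightarrow> x i \<in> carr H) \<Longrightarrow> (\<Sum>i\<in>J. \<Sum>j\<in>J. ip H (a i j (x j)) (x i)) \<in> \<real>\<^sub>\<ge>\<^sub>0"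
    and y: "\<And>i. i \<in> J \<Longrightarrow> y i \<in> carr K"
  shows "(\<Sum>i\<in>J. \<Sum>j\<in>J. ip K (\<phi> (a i j) (y j)) (y i)) \<in> \<real>\<^sub>\<ge>\<^sub>0"
proof -
  obtain h where h: "bij_betw h {..<card J} J" using ex_bij_betw_nat_finite[OF J] by (auto simp: atLeast0LessThan)
  then have hJ: "h i \<in> J" if "i < card J" for i using that by (auto simp: bij_betw_def)
  have re: "(\<Sum>i<card J. \<Sum>j<card J. f (h i) (h j)) = (\<Sum>i\<in>J. \<Sum>j\<in>J. f i j)" for f :: "_ \<Rightarrow> _ \<Rightarrow> complex"
    using sum.reindex_bij_betw[OF h, of "\<lambda>i. \<Sum>j\<in>J. f i j"] by (simp add: sum.reindex_bij_betw[OF h])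
  have "positive_matrix H (card J) (\<lambda>i j. a (h i) (h j))"
    unfolding positive_matrix_def
  proof (intro allI impI)
    fix x assume x: "\<forall>i<card J. x i \<in> carr H"
    define g where "g = the_inv_into {..<card J} h"
    have gh: "g (h i) = i" if "i < card J" for i
      using h that by (auto simp: g_def bij_betw_def the_inv_into_f_f)
    have gJ: "g j < card J" if "j \<in> J" for j
    proof -
      obtain i where "i < card J" "j = h i" using h \<open>j \<in> J\<close> by (auto simp: bij_betw_def)
      then show ?thesis using gh by simp
    qed
    have "(\<Sum>i<card J. \<Sum>j<card J. ip H (a (h i) (h j) (x j)) (x i))
       = (\<Sum>i<card J. \<Sum>j<card J. ip H (a (h i) (h j) (x (g (h j)))) (x (g (h i))))"
      using gh by (intro sum.cong refl) simp
    also have "\<dots> = (\<Sum>i\<in>J. \<Sum>j\<in>J. ip H (a i j (x (g j))) (x (g i)))" by (rule re)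
    also have "\<dots> \<in> \<real>\<^sub>\<ge>\<^sub>0" using x gJ by (intro pos) auto
    finally show "(\<Sum>i<card J. \<Sum>j<card J. ip H (a (h i) (h j) (x j)) (x i)) \<in> \<real>\<^sub>\<ge>\<^sub>0" .
  qed
  then have posK: "positive_matrix K (card J) (\<lambda>i j. \<phi> (a (h i) (h j)))"
    using hJ a by (intro cp_matrix[OF cp]) auto
  have "(\<Sum>i<card J. \<Sum>j<card J. ip K (\<phi> (a (h i) (h j)) (y (h j))) (y (h i))) \<in> \<real>\<^sub>\<ge>\<^sub>0"
    by (rule posK[unfolded positive_matrix_def, rule_format]) (use y hJ in auto)
  then show ?thesis using re[of "\<lambda>i j. ip K (\<phi> (a i j) (y j)) (y i)"] by simp
qed

text \<open>The form is continuous and the nonnegative reals are closed, so approximants from the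
  span suffice.\<close>

lemma positive_matrix_dense:
  assumes H: "hilbert H" and a: "\<And>i j. i < m \<Longrightarrow> j < m \<Longrightarrow> a i j \<in> bop H H"
    and S: "S \<subseteq> carr H" "closed_cspan H S = carr H"
    and pos: "\<And>x. (\<And>i. i < m \<Longrightarrow> x i \<in> complex_vector.span S) \<Longrightarrow> (\<Sum>i<m. \<Sum>j<m. ip H (a i j (x j)) (x i)) \<in> \<real>\<^sub>\<ge>\<^sub>0"
  shows "positive_matrix H m a"
  unfolding positive_matrix_def
proof (intro allI impI)
  interpret H: hilbert H by (rule H)
  fix x assume x: "\<forall>i<m. x i \<in> carr H"
  then have "\<forall>i. \<exists>X. i < m \<longrightarrow> (\<forall>n. X n \<in> complex_vector.span S) \<and> (\<lambda>n. hnorm H (X n - x i)) \<longlonglongrightarrow> 0"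
    using H.dense_span[OF S(2,1)] by blast
  from choice[OF this] obtain X where X: "\<And>i n. i < m \<Longrightarrow> X i n \<in> complex_vector.span S"
    "\<And>i. i < m \<Longrightarrow> (\<lambda>n. hnorm H (X i n - x i)) \<longlonglongrightarrow> 0" by blast
  have XH: "X i n \<in> carr H" if "i < m" for i n
    using X(1)[OF that] complex_vector.span_minimal[OF S(1) H.subspace] by blast
  show "(\<Sum>i<m. \<Sum>j<m. ip H (a i j (x j)) (x i)) \<in> \<real>\<^sub>\<ge>\<^sub>0"
  proof (rule closed_sequentially[OF closed_nonneg_Reals_complex])
    show "(\<Sum>i<m. \<Sum>j<m. ip H (a i j (X j n)) (X i n)) \<in> \<real>\<^sub>\<ge>\<^sub>0" for n
      using X(1) by (intro pos)
    show "(\<lambda>n. \<Sum>i<m. \<Sum>j<m. ip H (a i j (X j n)) (X i n)) \<longlonglongrightarrow> (\<Sum>i<m. \<Sum>j<m. ip H (a i j (x j)) (x i))"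
      using x X(2) XH bop_in[OF a] by (intro tendsto_sum H.ip_tendsto bop_tendsto[OF H H a]) auto
  qed
qed

text \<open>The form is the squared norm of the sum of the vectors \<open>y j (x j)\<close>.\<close>

lemma gram_positive:
  assumes H: "hilbert H" and y: "\<And>i. i < m \<Longrightarrow> y i \<in> bop H H"
  shows "positive_matrix H m (\<lambda>i j. adj H H (y i) \<circ> y j)"
  unfolding positive_matrix_def
proof (intro allI impI)
  interpret H: hilbert H by (rule H)
  fix x assume x: "\<forall>i<m. x i \<in> carr H"
  let ?z = "\<Sum>j<m. y j (x j)"
  have yx: "y i (x i) \<in> carr H" if "i < m" for i using x that y bop_in by blast
  have zH: "?z \<in> carr H" by (rule H.sum_in) (use yx in auto)
  have "(\<Sum>i<m. \<Sum>j<m. ip H ((adj H H (y i) \<circ> y j) (x j)) (x i)) = (\<Sum>i<m. \<Sum>j<m. ip H (y j (x j)) (y i (x i)))"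
    using x y yx by (intro sum.cong refl) (simp add: adj_ip'[OF H H])
  also have "\<dots> = (\<Sum>i<m. ip H ?z (y i (x i)))" using yx by (intro sum.cong refl H.ip_sum_left[symmetric]) auto
  also have "\<dots> = ip H ?z ?z" using yx zH by (intro H.ip_sum_right[symmetric]) auto
  finally show "(\<Sum>i<m. \<Sum>j<m. ip H ((adj H H (y i) \<circ> y j) (x j)) (x i)) \<in> \<real>\<^sub>\<ge>\<^sub>0" using H.ip_nonneg[OF zH] by (simp only:)
qed

text \<open>Positivity of this 2 by 2 matrix expresses that the norm of \<open>x\<close> is at most
  \<open>M\<close>; through it, positivity statements yield norm bounds. Only the indices 0 and 1
  are meant.\<close>

definition bound_block :: "'a::complex_vector hspace \<Rightarrow> real \<Rightarrow> ('a \<Rightarrow> 'a) \<Rightarrow> nat \<Rightarrow> nat \<Rightarrow> 'a \<Rightarrow> 'a" where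
  "bound_block H M x i j = (if i = j then of_real M *\<^sub>C idop H else if i = 0 then x else adj H H x)"

lemma bound_block_positive:
  assumes H: "hilbert H" and x: "x \<in> bop H H"
  shows "positive_matrix H 2 (bound_block H (opnorm H H x) x)"
  unfolding positive_matrix_def
proof (intro allI impI)
  interpret H: hilbert H by (rule H)
  fix h :: "nat \<Rightarrow> 'a" assume h: "\<forall>i<2. h i \<in> carr H"
  let ?M = "opnorm H H x"
  have h01 [simp]: "h 0 \<in> carr H" "h 1 \<in> carr H" "h (Suc 0) \<in> carr H" using h by auto
  define z where "z = ip H (x (h 1)) (h 0)"
  have adjz: "ip H (adj H H x (h 0)) (h 1) = cnj z"
    using adj_ip'[OF H H x h01(2,1)] H.ip_cnj[of "x (h 1)" "h 0"] bop_in[OF x] by (simp add: z_def)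
  have "cmod z \<le> (?M * hnorm H (h 1)) * hnorm H (h 0)"
    unfolding z_def using H.Cauchy_Schwarz[of "x (h 1)" "h 0"] bop_in[OF x h01(2)]
      mult_right_mono[OF opnorm_bound[OF H H x h01(2)] H.hnorm_ge_0[OF h01(1)]] by simp
  moreover have "0 \<le> ?M * (hnorm H (h 0) - hnorm H (h 1))\<^sup>2" using opnorm_ge_0[OF H H x] by simp
  ultimately have "0 \<le> ?M * (hnorm H (h 0))\<^sup>2 + ?M * (hnorm H (h 1))\<^sup>2 + 2 * Re z"
    using abs_Re_le_cmod[of z] by (simp add: power2_diff algebra_simps)
  moreover have "(\<Sum>i<2. \<Sum>j<2. ip H (bound_block H ?M x i j (h j)) (h i))
     = of_real (?M * (hnorm H (h 0))\<^sup>2 + ?M * (hnorm H (h 1))\<^sup>2) + (z + cnj z)"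
    by (simp add: numeral_2_eq_2 bound_block_def scaleC_fun_def idop_def H.ip_scale H.ip_self adjz[simplified] z_def)
  ultimately show "(\<Sum>i<2. \<Sum>j<2. ip H (bound_block H ?M x i j (h j)) (h i)) \<in> \<real>\<^sub>\<ge>\<^sub>0"
    by (simp add: complex_nonneg_Reals_iff)
qed

text \<open>A unital completely positive map sends the block matrix of \<open>x\<close>, with
  \<open>opnorm H H x\<close> on the diagonal, to a positive block with the same diagonal.\<close>

lemma cp_contractive:
  assumes H: "hilbert H" and K: "hilbert K" and C: "cstar_algebra H C" "idop H \<in> C"
    and cp: "completely_positive H C K \<phi>" and unital: "\<phi> (idop H) = idop K" and x: "x \<in> C"
  shows "opnorm K K (\<phi> x) \<le> opnorm H H x"
proof (rule opnorm_le[OF K])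
  interpret K: hilbert K by (rule K)
  have xb: "x \<in> bop H H" using banach_algebra_bop[OF cstar_banach[OF C(1)]] x by blast
  let ?M = "opnorm H H x"
  show M0: "0 \<le> ?M" by (rule opnorm_ge_0[OF H H xb])
  have \<phi>b: "\<phi> a \<in> bop K K" if "a \<in> C" for a using cp that by (simp add: completely_positive_def linear_into_bop_def)
  have \<phi>M: "\<phi> (of_real ?M *\<^sub>C idop H) = of_real ?M *\<^sub>C idop K"
    using cp C(2) unital by (simp add: completely_positive_def linear_into_bop_def)
  fix h assume h: "h \<in> carr K"
  \<comment> \<open>Testing the block on the pair \<open>g\<close>, \<open>t *\<^sub>C h\<close>
    with this \<open>g\<close> makes the coefficient of \<open>t\<close> equal to
    \<open>(hnorm K g)\<^sup>2\<close>.\<close>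
  define g where "g = \<phi> x h"
  have g: "g \<in> carr K" using bop_in[OF \<phi>b[OF x] h] by (simp add: g_def)
  have adjx: "adj H H x \<in> C" using cstar_adj[OF C(1) x] .
  have "bound_block H ?M x i j \<in> C" for i j
    using complex_vector.subspace_scale[OF banach_algebra_subspace[OF cstar_banach[OF C(1)]] C(2)] x adjx by (simp add: bound_block_def)
  then have pos: "positive_matrix K 2 (\<lambda>i j. \<phi> (bound_block H ?M x i j))"
    using bound_block_positive[OF H xb] by (intro cp_matrix[OF cp])
  have "complex_of_real (?M * (hnorm K g)\<^sup>2) + of_real ((cmod t)\<^sup>2) * of_real (?M * (hnorm K h)\<^sup>2)
      + t * ip K (\<phi> x h) g + cnj t * ip K (\<phi> (adj H H x) g) h \<in> \<real>\<^sub>\<ge>\<^sub>0" for t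
  proof -
    have "(\<Sum>i<2. \<Sum>j<2. ip K (\<phi> (bound_block H ?M x i j) ((if j = 0 then g else t *\<^sub>C h))) (if i = (0::nat) then g else t *\<^sub>C h)) \<in> \<real>\<^sub>\<ge>\<^sub>0"
      using pos[unfolded positive_matrix_def, rule_format, of "\<lambda>i. if i = 0 then g else t *\<^sub>C h"] g h by simp
    also have "(\<Sum>i<2. \<Sum>j<2. ip K (\<phi> (bound_block H ?M x i j) ((if j = 0 then g else t *\<^sub>C h))) (if i = (0::nat) then g else t *\<^sub>C h))
        = complex_of_real (?M * (hnorm K g)\<^sup>2) + of_real ((cmod t)\<^sup>2) * of_real (?M * (hnorm K h)\<^sup>2)
      + t * ip K (\<phi> x h) g + cnj t * ip K (\<phi> (adj H H x) g) h"
      using g h bop_in[OF \<phi>b[OF x] h] bop_in[OF \<phi>b[OF adjx] g] complex_norm_square[of t]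
      by (simp add: numeral_2_eq_2 bound_block_def \<phi>M scaleC_apply idop_eq K.ip_scale K.ip_scale_right K.ip_self
          bop_scale[OF \<phi>b[OF x] h] mult_ac)
    finally show ?thesis .
  qed
  from nonneg_form_bound[OF this] have "(cmod (ip K g g))\<^sup>2 \<le> (?M * (hnorm K g)\<^sup>2) * (?M * (hnorm K h)\<^sup>2)"
    by (simp add: g_def)
  then have "(hnorm K g)\<^sup>2 * (hnorm K g)\<^sup>2 \<le> (hnorm K g)\<^sup>2 * (?M * hnorm K h)\<^sup>2"
    using g by (simp add: K.ip_self norm_power power_mult_distrib power2_eq_square mult_ac norm_mult)
  then have "(hnorm K g)\<^sup>2 \<le> (?M * hnorm K h)\<^sup>2 \<or> hnorm K g = 0"
    by (metis mult_le_cancel_left_pos zero_less_power2)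
  then show "hnorm K (\<phi> x h) \<le> ?M * hnorm K h"
    using M0 h g unfolding g_def[symmetric] by (auto intro: power2_le_imp_le)
qed

text \<open>
  The Gram matrix of \<open>1, u, x\<close> stays positive under \<open>\<phi>\<close>; testing it on \<open>(- u h, h, t g)\<close> gives
  a form in \<open>t\<close> without constant term, whose linear part must vanish.
\<close>

lemma cp_multiplicative:
  assumes H: "hilbert H" and C: "cstar_algebra H C" "idop H \<in> C"
    and cp: "completely_positive H C H \<phi>" and unital: "\<phi> (idop H) = idop H"
    and u: "u \<in> C" "\<phi> u = u" "\<phi> (adj H H u) = adj H H u" "\<phi> (adj H H u \<circ> u) = adj H H u \<circ> u" and x: "x \<in> C"
  shows "\<phi> (adj H H u \<circ> x) = adj H H u \<circ> \<phi> x"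
proof -
  interpret H: hilbert H by (rule H)
  note CB = cstar_banach[OF C(1)]
  have Cb: "a \<in> bop H H" if "a \<in> C" for a using banach_algebra_bop[OF CB] that by blast
  have \<phi>b: "\<phi> a \<in> bop H H" if "a \<in> C" for a using cp that by (simp add: completely_positive_def linear_into_bop_def)
  note in_C = C(2) u(1) x cstar_adj[OF C(1) u(1)] cstar_adj[OF C(1) x] banach_algebra_comp[OF CB]
  define y where "y i = (if i = 0 then idop H else if i = 1 then u else x)" for i :: nat
  have y: "y i \<in> C" for i using in_C by (simp add: y_def)
  have aC: "adj H H (y i) \<circ> y j \<in> C" for i j using y cstar_adj[OF C(1)] banach_algebra_comp[OF CB] by blast
  have pos: "positive_matrix H 3 (\<lambda>i j. \<phi> (adj H H (y i) \<circ> y j))"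
    by (intro cp_matrix[OF cp] aC gram_positive[OF H] Cb y)
  show ?thesis
  proof (rule bop_eqI_ip'[OF H H \<phi>b bop_comp[OF H H H]])
    fix g h assume gh [simp]: "g \<in> carr H" "h \<in> carr H"
    note [simp] = bop_in[OF Cb[OF u(1)]] bop_in[OF Cb[OF x]] bop_in[OF Cb[OF in_C(4)]] bop_in[OF Cb[OF in_C(5)]]
      bop_in[OF \<phi>b[OF x]] bop_in[OF \<phi>b[OF in_C(5)]]
      bop_in[OF \<phi>b[OF in_C(6)[OF in_C(4,3)]]] bop_in[OF \<phi>b[OF in_C(6)[OF in_C(5,2)]]] bop_in[OF \<phi>b[OF in_C(6)[OF in_C(5,3)]]]
    define \<alpha> where "\<alpha> = ip H (\<phi> (adj H H u \<circ> x) g) h - ip H (\<phi> x g) (u h)"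
    define \<beta> where "\<beta> = ip H (\<phi> (adj H H x \<circ> u) h) g - ip H (\<phi> (adj H H x) (u h)) g"
    define \<gamma> where "\<gamma> = ip H (\<phi> (adj H H x \<circ> x) g) g"
    have "complex_of_real 0 + of_real ((cmod t)\<^sup>2) * \<gamma> + t * \<alpha> + cnj t * \<beta> \<in> \<real>\<^sub>\<ge>\<^sub>0" for t
    proof -
      \<comment> \<open>The constant part consists of four terms equal to plus or minus
        \<open>(hnorm H (u h))\<^sup>2\<close>; they cancel because \<phi> fixes the identity, u,
        adj u and adj u u.\<close>
      define v where "v i = (if i = 0 then - u h else if i = 1 then h else t *\<^sub>C g)" for i :: nat
      have "(\<Sum>i<3. \<Sum>j<3. ip H (\<phi> (adj H H (y i) \<circ> y j) (v j)) (v i)) \<in> \<real>\<^sub>\<ge>\<^sub>0"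
        using pos[unfolded positive_matrix_def, rule_format, of v] by (simp add: v_def)
      also have "(\<Sum>i<3. \<Sum>j<3. ip H (\<phi> (adj H H (y i) \<circ> y j) (v j)) (v i)) =
          of_real ((cmod t)\<^sup>2) * \<gamma> + t * \<alpha> + cnj t * \<beta>"
      proof -
        have uu: "ip H (adj H H u (u h)) h = ip H (u h) (u h)" by (simp add: adj_ip'[OF H H Cb[OF u(1)]])
        have tt: "of_real ((cmod t)\<^sup>2) = t * cnj t" using complex_norm_square[of t] by simp
        have sum3: "(\<Sum>i<3. \<Sum>j<3. f i j) = f 0 0 + f 0 1 + f 0 2 + f 1 0 + f 1 1 + f 1 2 + f 2 0 + f 2 1 + f 2 2"
          for f :: "nat \<Rightarrow> nat \<Rightarrow> complex" by (simp add: eval_nat_numeral)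
        have y012: "y 0 = idop H" "y 1 = u" "y 2 = x" and v012: "v 0 = - u h" "v 1 = h" "v 2 = t *\<^sub>C g"
          by (simp_all add: y_def v_def)
        note es = adj_idop[OF H] idop_comp[OF Cb[OF u(1)] H] idop_comp[OF Cb[OF x] H] idop_comp[OF bop_idop[OF H] H]
          comp_idop[OF Cb[OF in_C(4)] H] comp_idop[OF Cb[OF in_C(5)] H] u(2-4) unital
        have ids: "idop H (- u h) = - u h" by (simp add: idop_def)
        have "adj H H u (- u h) = - adj H H u (u h)" "\<phi> (adj H H x) (- u h) = - \<phi> (adj H H x) (u h)"
          "\<phi> x (t *\<^sub>C g) = t *\<^sub>C \<phi> x g" "\<phi> (adj H H u \<circ> x) (t *\<^sub>C g) = t *\<^sub>C \<phi> (adj H H u \<circ> x) g"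
          "\<phi> (adj H H x \<circ> x) (t *\<^sub>C g) = t *\<^sub>C \<phi> (adj H H x \<circ> x) g"
          by (simp_all add: bop_minus[OF Cb[OF in_C(4)]] bop_minus[OF \<phi>b[OF in_C(5)]] bop_scale[OF \<phi>b[OF x]]
              bop_scale[OF \<phi>b[OF in_C(6)[OF in_C(4,3)]]] bop_scale[OF \<phi>b[OF in_C(6)[OF in_C(5,3)]]])
        note lin = this
        show ?thesis
          unfolding sum3 y012 v012 es ids lin tt \<alpha>_def \<beta>_def \<gamma>_def
          by (simp add: H.ip_scale H.ip_scale_right uu algebra_simps)
      qed
      finally show ?thesis by simp
    qed
    from nonneg_form_bound[OF this] have "\<alpha> = 0" by simp
    then show "ip H (\<phi> (adj H H u \<circ> x) g) h = ip H ((adj H H u \<circ> \<phi> x) g) h"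
      by (simp add: \<alpha>_def adj_ip'[OF H H Cb[OF u(1)]])
  qed (use in_C Cb \<phi>b in auto)
qed

text \<open>The \<open>x\<close> with \<open>\<phi> (x \<circ> y) = x \<circ> \<phi> y\<close> for
  all \<open>y\<close> form a closed algebra since \<open>\<phi>\<close> is contractive. It contains
  \<open>S\<close> and the adjoints of \<open>S\<close>: \<open>cp_multiplicative\<close> is used at
  \<open>u\<close> and at its adjoint, whence both products in the hypotheses.\<close>

lemma cp_fixes_generated:
  assumes H: "hilbert H" and S: "S \<subseteq> bop H H" "idop H \<in> S"
    and cp: "completely_positive H (cstar_gen H S) H \<phi>"
    and fix_S: "\<And>u. u \<in> S \<Longrightarrow> \<phi> u = u" "\<And>u. u \<in> S \<Longrightarrow> \<phi> (adj H H u) = adj H H u"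
      "\<And>u. u \<in> S \<Longrightarrow> \<phi> (adj H H u \<circ> u) = adj H H u \<circ> u" "\<And>u. u \<in> S \<Longrightarrow> \<phi> (u \<circ> adj H H u) = u \<circ> adj H H u"
    and c: "c \<in> cstar_gen H S"
  shows "\<phi> c = c"
proof -
  let ?C = "cstar_gen H S"
  have C: "cstar_algebra H ?C" by (rule cstar_gen_algebra[OF H S(1)])
  note CB = cstar_banach[OF C]
  note Csub = banach_algebra_subspace[OF CB]
  have Cb: "a \<in> bop H H" if "a \<in> ?C" for a using banach_algebra_bop[OF CB] that by blast
  have SC: "u \<in> ?C" if "u \<in> S" for u using cstar_gen_incl that by blast
  have idC: "idop H \<in> ?C" using SC S(2) .
  have unital: "\<phi> (idop H) = idop H" using fix_S(1) S(2) .
  have lin: "linear_into_bop ?C H \<phi>" using cp by (rule cp_linear)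
  have \<phi>b: "\<phi> a \<in> bop H H" if "a \<in> ?C" for a using lin that by (simp add: linear_into_bop_def)
  have \<phi>add: "\<phi> (a + b) = \<phi> a + \<phi> b" if "a \<in> ?C" "b \<in> ?C" for a b using lin that by (simp add: linear_into_bop_def)
  have \<phi>scale: "\<phi> (k *\<^sub>C a) = k *\<^sub>C \<phi> a" if "a \<in> ?C" for a k using lin that by (simp add: linear_into_bop_def)
  let ?E = "{x \<in> ?C. \<forall>y\<in>?C. \<phi> (x \<circ> y) = x \<circ> \<phi> y}"
  have "banach_algebra H ?E"
  proof (rule banach_algebraI, goal_cases)
    case 1 show ?case using Cb by blast
  next
    case 2
    have "\<phi> (0 *\<^sub>C idop H) = 0 *\<^sub>C \<phi> (idop H)" by (rule \<phi>scale[OF idC])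
    then have "\<phi> 0 = 0" by simp
    moreover have "0 \<circ> y = (0 :: 'a \<Rightarrow> 'a)" for y :: "'a \<Rightarrow> 'a" by (simp add: fun_eq_iff)
    ultimately show ?case using complex_vector.subspace_0[OF Csub]
      unfolding mem_Collect_eq by (intro conjI ballI) (simp_all only:)
  next
    case (3 a b) then show ?case
      by (simp add: comp_add_left \<phi>add banach_algebra_comp[OF CB] complex_vector.subspace_add[OF Csub])
  next
    case (4 k a) then show ?case
      by (simp add: comp_scale_left \<phi>scale banach_algebra_comp[OF CB] complex_vector.subspace_scale[OF Csub])
  next
    case (5 a b) then show ?case
      by (simp add: comp_assoc banach_algebra_comp[OF CB])
  next
    case (6 X l)
    have X: "X m \<in> ?C" for m using 6(1) by blast
    have l: "l \<in> ?C" by (rule banach_algebra_lim[OF CB X 6(2,3)])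
    have "\<phi> (l \<circ> y) = l \<circ> \<phi> y" if y: "y \<in> ?C" for y
    proof (rule opnorm_lim_unique[OF H H])
      note comps = banach_algebra_comp[OF CB _ y]
      show "\<phi> (X m \<circ> y) \<in> bop H H" for m using \<phi>b[OF comps[OF X]] .
      show "\<phi> (l \<circ> y) \<in> bop H H" using \<phi>b[OF comps[OF l]] .
      show "l \<circ> \<phi> y \<in> bop H H" using bop_comp[OF H H H Cb[OF l] \<phi>b[OF y]] .
      show "(\<lambda>m. opnorm H H (\<phi> (X m \<circ> y) - (l \<circ> \<phi> y))) \<longlonglongrightarrow> 0"
        using opnorm_lim_comp_right[OF H H H Cb[OF X] Cb[OF l] 6(3) \<phi>b[OF y]] 6(1) y by simp
      have "opnorm H H (\<phi> (X m \<circ> y) - \<phi> (l \<circ> y)) \<le> opnorm H H ((X m \<circ> y) - (l \<circ> y))" for m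
        using cp_contractive[OF H H C idC cp unital complex_vector.subspace_diff[OF Csub comps[OF X] comps[OF l]]]
        unfolding linear_into_bop_diff[OF lin Csub comps[OF X] comps[OF l]] .
      moreover have "0 \<le> opnorm H H (\<phi> (X m \<circ> y) - \<phi> (l \<circ> y))" for m
        by (intro opnorm_ge_0 H bop_diff_fun \<phi>b comps X l)
      ultimately show "(\<lambda>m. opnorm H H (\<phi> (X m \<circ> y) - \<phi> (l \<circ> y))) \<longlonglongrightarrow> 0"
        by (intro Lim_null_comparison[OF _ opnorm_lim_comp_right[OF H H H Cb[OF X] Cb[OF l] 6(3) Cb[OF y]]]) simp
    qed
    with l show ?case by blast
  qed
  then have "cstar_algebra H {x \<in> ?E. adj H H x \<in> ?E}" by (rule banach_algebra_star_part[OF H])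
  moreover have "S \<subseteq> {x \<in> ?E. adj H H x \<in> ?E}"
  proof
    fix u assume u: "u \<in> S"
    have uC: "u \<in> ?C" using SC[OF u] .
    have auC: "adj H H u \<in> ?C" using cstar_adj[OF C uC] .
    have aa: "adj H H (adj H H u) = u" using adj_adj[OF H H Cb[OF uC]] .
    have "\<phi> (u \<circ> y) = u \<circ> \<phi> y" if y: "y \<in> ?C" for y
      using cp_multiplicative[OF H C idC cp unital auC _ _ _ y] fix_S u unfolding aa by blast
    moreover have "\<phi> (adj H H u \<circ> y) = adj H H u \<circ> \<phi> y" if y: "y \<in> ?C" for y
      using cp_multiplicative[OF H C idC cp unital uC _ _ _ y] fix_S u by blast
    ultimately show "u \<in> {x \<in> ?E. adj H H x \<in> ?E}" using uC auC by blast
  qed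
  ultimately have "?C \<subseteq> {x \<in> ?E. adj H H x \<in> ?E}" by (rule cstar_gen_min)
  then have "\<phi> (c \<circ> idop H) = c \<circ> \<phi> (idop H)" using c idC by blast
  then show ?thesis using unital comp_idop[OF Cb[OF c] H] by simp
qed

section \<open>Amplifications of operators on a tensor factor\<close>

definition rank_one :: "'a::complex_vector hspace \<Rightarrow> 'a \<Rightarrow> 'a \<Rightarrow> 'a \<Rightarrow> 'a" where
  "rank_one H u v x = (if x \<in> carr H then ip H x v *\<^sub>C u else 0)"

context hilbert
begin

lemma rank_one_bop: "u \<in> carr H \<Longrightarrow> v \<in> carr H \<Longrightarrow> rank_one H u v \<in> bop H H"
proof (rule bopI[where B = "hnorm H v * hnorm H u"])
  fix x assume "u \<in> carr H" "v \<in> carr H" "x \<in> carr H"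
  then show "hnorm H (rank_one H u v x) \<le> hnorm H v * hnorm H u * hnorm H x"
    using mult_right_mono[OF Cauchy_Schwarz[of x v], of "hnorm H u"] by (simp add: rank_one_def hnorm_scale mult_ac)
qed (auto simp: rank_one_def ip_add ip_scale scaleC_add_left scaleC_scaleC)

lemma rank_one_adj: "u \<in> carr H \<Longrightarrow> v \<in> carr H \<Longrightarrow> adj H H (rank_one H u v) = rank_one H v u"
  by (rule adj_eqI[OF hilbert_axioms hilbert_axioms rank_one_bop])
    (auto simp: rank_one_def ip_scale ip_scale_right ip_cnj[symmetric])

lemma comp_rank_one: "a \<in> bop H H \<Longrightarrow> u \<in> carr H \<Longrightarrow> a \<circ> rank_one H u v = rank_one H (a u) v"
  by (auto simp: fun_eq_iff rank_one_def bop_scale bop_zero[OF hilbert_axioms])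

lemma rank_one_add: "rank_one H (x + y) v = rank_one H x v + rank_one H y v"
  by (auto simp: fun_eq_iff rank_one_def scaleC_add_right)

lemma rank_one_scale: "rank_one H (c *\<^sub>C x) v = c *\<^sub>C rank_one H x v"
  by (auto simp: fun_eq_iff rank_one_def scaleC_fun_def scaleC_scaleC mult.commute)

lemma rank_one_apply: "x \<in> carr H \<Longrightarrow> rank_one H u v x = ip H x v *\<^sub>C u"
  by (simp add: rank_one_def)

lemma proj_in_iff: "closed_csubspace H V \<Longrightarrow> x \<in> carr H \<Longrightarrow> proj H V x = x \<longleftrightarrow> x \<in> V"
proof
  assume V: "closed_csubspace H V" and x: "x \<in> carr H"
  show "x \<in> V" if "proj H V x = x" using proj_props(1)[OF V x] that by simp
  show "proj H V x = x" if "x \<in> V"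
    using proj_eqI[OF V x that] subsetD[OF closed_csubspace_subset[OF V]] by (simp add: orth_def)
qed

lemma proj_ip:
  assumes V: "closed_csubspace H V" and x: "x \<in> carr H" and y: "y \<in> carr H"
  shows "ip H (proj H V x) y = ip H x (proj H V y)"
proof -
  note p = proj_props[OF V x] and q = proj_props[OF V y]
  have in_H: "proj H V x \<in> carr H" "proj H V y \<in> carr H" using p q closed_csubspace_subset[OF V] by auto
  have "ip H (x - proj H V x) (proj H V y) = 0" "ip H (y - proj H V y) (proj H V x) = 0"
    using p q by (auto simp: orth_def)
  then have "ip H x (proj H V y) = ip H (proj H V x) (proj H V y)" "ip H y (proj H V x) = ip H (proj H V y) (proj H V x)"
    using x y in_H by (simp_all add: ip_diff_left)
  then show ?thesis using in_H x y ip_cnj[of y "proj H V x"] ip_cnj[of "proj H V y" "proj H V x"] by simp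
qed

lemma proj_bop: assumes V: "closed_csubspace H V" shows "proj H V \<in> bop H H"
proof (rule bopI[where B = 1])
  note sub = closed_csubspace_csubspace[OF V] closed_csubspace_subset[OF V]
  have in_H: "proj H V x \<in> carr H" if "x \<in> carr H" for x using proj_props[OF V that] sub by auto
  show "proj H V x \<in> carr H" if "x \<in> carr H" for x using in_H that .
  show "proj H V (x + y) = proj H V x + proj H V y" if xy: "x \<in> carr H" "y \<in> carr H" for x y
  proof (rule proj_eqI[OF V])
    have "x + y - (proj H V x + proj H V y) = (x - proj H V x) + (y - proj H V y)" by simp
    also have "\<dots> \<in> orth H V" using proj_props(2)[OF V] xy closed_csubspace_csubspace[OF orth_closed[OF sub(2)]]
      by (intro complex_vector.subspace_add) auto
    finally show "x + y - (proj H V x + proj H V y) \<in> orth H V" .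
  qed (use xy proj_props[OF V] sub in \<open>auto intro: complex_vector.subspace_add\<close>)
  show "proj H V (c *\<^sub>C x) = c *\<^sub>C proj H V x" if x: "x \<in> carr H" for x c
  proof (rule proj_eqI[OF V])
    have "c *\<^sub>C x - c *\<^sub>C proj H V x = c *\<^sub>C (x - proj H V x)" by (simp add: complex_vector.scale_right_diff_distrib)
    also have "\<dots> \<in> orth H V" using proj_props(2)[OF V] x closed_csubspace_csubspace[OF orth_closed[OF sub(2)]]
      by (intro complex_vector.subspace_scale) auto
    finally show "c *\<^sub>C x - c *\<^sub>C proj H V x \<in> orth H V" .
  qed (use x proj_props[OF V] sub in \<open>auto intro: complex_vector.subspace_scale\<close>)
  show "hnorm H (proj H V x) \<le> 1 * hnorm H x" if x: "x \<in> carr H" for x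
  proof -
    have "ip H (proj H V x) (x - proj H V x) = 0"
      using proj_props[OF V x] in_H[OF x] x ip_cnj[of "x - proj H V x" "proj H V x"] by (simp add: orth_def)
    then have "(hnorm H (proj H V x + (x - proj H V x)))\<^sup>2 = (hnorm H (proj H V x))\<^sup>2 + (hnorm H (x - proj H V x))\<^sup>2"
      using in_H[OF x] x by (subst hnorm_add_sq) auto
    then have "(hnorm H (proj H V x))\<^sup>2 \<le> (hnorm H x)\<^sup>2" by simp
    then show ?thesis using x by (simp add: power2_le_imp_le[of "hnorm H (proj H V x)" "hnorm H x"])
  qed
qed (simp add: proj_def)

lemma proj_adj: "closed_csubspace H V \<Longrightarrow> adj H H (proj H V) = proj H V"
  by (rule adj_eqI[OF hilbert_axioms hilbert_axioms proj_bop]) (auto simp: proj_ip)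

text \<open>With P the projection, invariance gives P b P = b P for every \<open>b\<close> in
  \<open>C\<close>. For b = adj a, taking adjoints yields P a P = P a, so P a and a P
  coincide.\<close>

lemma proj_commutes:
  assumes V: "closed_csubspace H V" and C: "C \<subseteq> bop H H" "\<And>a. a \<in> C \<Longrightarrow> adj H H a \<in> C"
    and inv: "\<And>a x. a \<in> C \<Longrightarrow> x \<in> V \<Longrightarrow> a x \<in> V" and a: "a \<in> C"
  shows "a \<circ> proj H V = proj H V \<circ> a"
proof -
  note P = proj_bop[OF V] and hh = hilbert_axioms hilbert_axioms hilbert_axioms
  have *: "proj H V \<circ> (b \<circ> proj H V) = b \<circ> proj H V" if "b \<in> C" for b
  proof (rule bop_ext[of _ H H])
    have b: "b \<in> bop H H" using C that by auto
    show "proj H V \<circ> (b \<circ> proj H V) \<in> bop H H" "b \<circ> proj H V \<in> bop H H" by (intro bop_comp[OF hilbert_axioms hilbert_axioms hilbert_axioms] P b)+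
    fix x assume x: "x \<in> carr H"
    have "b (proj H V x) \<in> V" using inv[OF that proj_props(1)[OF V x]] .
    then show "(proj H V \<circ> (b \<circ> proj H V)) x = (b \<circ> proj H V) x"
      using proj_in_iff[OF V, of "b (proj H V x)"] bop_in[OF b bop_in[OF P x]] by simp
  qed
  have a': "a \<in> bop H H" "adj H H a \<in> bop H H" using C a by auto
  have "adj H H (proj H V \<circ> (adj H H a \<circ> proj H V)) = adj H H (adj H H a \<circ> proj H V)" using *[OF C(2)[OF a]] by simp
  then have "(proj H V \<circ> a) \<circ> proj H V = proj H V \<circ> a"
    unfolding adj_comp[OF hh P bop_comp[OF hh a'(2) P]] adj_comp[OF hh a'(2) P] proj_adj[OF V]
      adj_adj[OF hilbert_axioms hilbert_axioms a'(1)] .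
  then show ?thesis using *[OF a] by (simp add: comp_assoc)
qed

end

lemma commutant_banach:
  assumes H: "hilbert H" and R: "R \<in> bop H H"
  shows "banach_algebra H {x \<in> bop H H. x \<circ> R = R \<circ> x}"
proof (rule banach_algebraI, goal_cases)
  case 2
  have "0 \<circ> R = R \<circ> 0" using bop_zero[OF H R] by (auto simp: fun_eq_iff)
  then show ?case using bop_zero_fun[OF H H] by (simp only: mem_Collect_eq)
next
  case (3 a b) then show ?case using R H by (simp add: bop_plus[OF H H] comp_add_left bop_comp_add_right[of _ H H _ R H])
next
  case (4 c a) then show ?case using R H by (simp add: bop_scaleC[OF H H] comp_scale_left bop_comp_scale_right[of _ H H R H])
next
  case (5 a b)
  then have "a (R x) = R (a x)" "b (R x) = R (b x)" for x unfolding mem_Collect_eq by (metis comp_apply)+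
  then have "(a \<circ> b) \<circ> R = R \<circ> (a \<circ> b)" by (simp add: fun_eq_iff)
  with 5 show ?case by (simp add: bop_comp[OF H H H])
next
  case (6 X l)
  have "(l \<circ> R) x = (R \<circ> l) x" if x: "x \<in> carr H" for x
  proof (rule hilbert.lim_unique[OF H, of "\<lambda>m. X m (R x)"])
    have X: "X m \<in> bop H H" and XR: "X m (R x) = R (X m x)" for m using 6(1)[of m] by (auto simp: fun_eq_iff)
    show "X m (R x) \<in> carr H" for m by (rule bop_in[OF X bop_in[OF R x]])
    show "(\<lambda>m. hnorm H (X m (R x) - (l \<circ> R) x)) \<longlonglongrightarrow> 0"
      using opnorm_tendsto_pointwise[OF H H X 6(2,3) bop_in[OF R x]] by simp
    show "(\<lambda>m. hnorm H (X m (R x) - (R \<circ> l) x)) \<longlonglongrightarrow> 0"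
      unfolding XR comp_apply
      by (rule bop_tendsto[OF H H R bop_in[OF X x] bop_in[OF 6(2) x] opnorm_tendsto_pointwise[OF H H X 6(2,3) x]])
  qed (use 6(2) R x in \<open>auto simp: bop_in\<close>)
  then have "l \<circ> R = R \<circ> l" using 6(2) R by (intro bop_ext[of _ H H]) (auto intro: bop_comp H)
  with 6 show ?case by simp
qed auto

text \<open>
  A unital *-representation \<open>l\<close> of all bounded operators on \<open>A\<close> that is nondegenerate on the rank
  one operators makes \<open>T\<close> the tensor product of \<open>A\<close> and the range \<open>K\<close> of \<open>l (e \<otimes> e\<^sup>*)\<close>, for any
  unit vector \<open>e\<close>; the elementary tensors are the \<open>w u \<xi>\<close>.
\<close>

locale tensor_factor =
  fixes A :: "'a::complex_vector hspace" and T :: "'h::complex_vector hspace"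
    and l :: "('a \<Rightarrow> 'a) \<Rightarrow> 'h \<Rightarrow> 'h" and e :: 'a
  assumes A: "hilbert A" and T: "hilbert T" and e: "e \<in> carr A" "hnorm A e = 1"
    and l_bop: "a \<in> bop A A \<Longrightarrow> l a \<in> bop T T"
    and l_add: "a \<in> bop A A \<Longrightarrow> b \<in> bop A A \<Longrightarrow> l (a + b) = l a + l b"
    and l_scale: "a \<in> bop A A \<Longrightarrow> l (c *\<^sub>C a) = c *\<^sub>C l a"
    and l_comp: "a \<in> bop A A \<Longrightarrow> b \<in> bop A A \<Longrightarrow> l (a \<circ> b) = l a \<circ> l b"
    and l_adj: "a \<in> bop A A \<Longrightarrow> l (adj A A a) = adj T T (l a)"
    and l_id: "l (idop A) = idop T"
    and l_total: "closed_cspan T {l (rank_one A u e) x | u x. u \<in> carr A \<and> x \<in> carr T} = carr T"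
begin

sublocale A: hilbert A by (rule A)
sublocale T: hilbert T by (rule T)

definition K :: "'h set" where
  "K = {\<xi> \<in> carr T. l (rank_one A e e) \<xi> = \<xi>}"

definition w :: "'a \<Rightarrow> 'h \<Rightarrow> 'h" where
  "w u \<xi> = l (rank_one A u e) \<xi>"

lemma ip_ee: "ip A e e = 1"
  using A.ip_self[OF e(1)] e(2) by simp

lemma r_bop [simp]: "u \<in> carr A \<Longrightarrow> l (rank_one A u e) \<in> bop T T"
  by (intro l_bop A.rank_one_bop e)

lemma l_diff: "a \<in> bop A A \<Longrightarrow> b \<in> bop A A \<Longrightarrow> l (a - b) = l a - l b"
  using l_add[of a "(-1) *\<^sub>C b"] l_scale[of b "-1"] bop_scaleC[OF A A, of b "-1"] by simp

lemma K_carr: "\<xi> \<in> K \<Longrightarrow> \<xi> \<in> carr T"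
  by (simp add: K_def)

lemma K_add: "\<xi> \<in> K \<Longrightarrow> \<eta> \<in> K \<Longrightarrow> \<xi> + \<eta> \<in> K"
  by (simp add: K_def bop_add[OF r_bop[OF e(1)]])

lemma K_scale: "\<xi> \<in> K \<Longrightarrow> c *\<^sub>C \<xi> \<in> K"
  by (simp add: K_def bop_scale[OF r_bop[OF e(1)]])

lemma K_diff: "\<xi> \<in> K \<Longrightarrow> \<eta> \<in> K \<Longrightarrow> \<xi> - \<eta> \<in> K"
  using K_add[of \<xi> "(-1) *\<^sub>C \<eta>"] K_scale[of \<eta> "-1"] by simp

lemma w_in [simp]: "u \<in> carr A \<Longrightarrow> \<xi> \<in> carr T \<Longrightarrow> w u \<xi> \<in> carr T"
  by (simp add: w_def bop_in[OF r_bop])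

lemma w_in_K [simp]: "u \<in> carr A \<Longrightarrow> \<xi> \<in> K \<Longrightarrow> w u \<xi> \<in> carr T"
  by (simp add: K_carr)

lemma w_add_left: "u \<in> carr A \<Longrightarrow> v \<in> carr A \<Longrightarrow> w (u + v) \<xi> = w u \<xi> + w v \<xi>"
  by (simp add: w_def A.rank_one_add l_add A.rank_one_bop e)

lemma w_scale_left: "u \<in> carr A \<Longrightarrow> w (c *\<^sub>C u) \<xi> = c *\<^sub>C w u \<xi>"
  by (simp add: w_def A.rank_one_scale l_scale A.rank_one_bop e scaleC_apply)

lemma w_zero_left [simp]: "w 0 \<xi> = 0"
  using w_scale_left[OF A.zero_in, of 0 \<xi>] by simp

lemma w_sum_left: "(\<And>i. i \<in> I \<Longrightarrow> f i \<in> carr A) \<Longrightarrow> w (sum f I) \<xi> = (\<Sum>i\<in>I. w (f i) \<xi>)"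
  by (induction I rule: infinite_finite_induct) (auto simp: w_add_left)

lemma w_add_right: "u \<in> carr A \<Longrightarrow> \<xi> \<in> K \<Longrightarrow> \<eta> \<in> K \<Longrightarrow> w u (\<xi> + \<eta>) = w u \<xi> + w u \<eta>"
  by (simp add: w_def bop_add[OF r_bop] K_carr)

lemma w_scale_right: "u \<in> carr A \<Longrightarrow> \<xi> \<in> K \<Longrightarrow> w u (c *\<^sub>C \<xi>) = c *\<^sub>C w u \<xi>"
  by (simp add: w_def bop_scale[OF r_bop] K_carr)

lemma w_zero_right [simp]: "u \<in> carr A \<Longrightarrow> w u 0 = 0"
  by (simp add: w_def bop_zero[OF T r_bop])

lemma l_w: "a \<in> bop A A \<Longrightarrow> u \<in> carr A \<Longrightarrow> l a (w u \<xi>) = w (a u) \<xi>"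
  using l_comp[of a "rank_one A u e"] A.comp_rank_one[of a u e] by (simp add: w_def A.rank_one_bop e fun_eq_iff)

text \<open>The adjoint of \<open>rank_one A v e\<close> composed with \<open>rank_one A u e\<close>
  is \<open>ip A u v *\<^sub>C rank_one A e e\<close>, and \<open>l (rank_one A e e)\<close> fixes
  \<open>K\<close>; so the inner product factors.\<close>

lemma w_ip:
  assumes u: "u \<in> carr A" and v: "v \<in> carr A" and \<xi>: "\<xi> \<in> K" and \<eta>: "\<eta> \<in> K"
  shows "ip T (w u \<xi>) (w v \<eta>) = ip A u v * ip T \<xi> \<eta>"
proof -
  note r = A.rank_one_bop[OF v e(1)]
  have "adj A A (rank_one A v e) \<circ> rank_one A u e = ip A u v *\<^sub>C rank_one A e e"
    using u v e A.rank_one_bop[OF e(1) v] by (simp add: A.rank_one_adj A.comp_rank_one A.rank_one_apply A.rank_one_scale)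
  then have "l (adj A A (rank_one A v e)) \<circ> l (rank_one A u e) = ip A u v *\<^sub>C l (rank_one A e e)"
    using l_comp[OF adj_bop[OF A A r] A.rank_one_bop[OF u e(1)]] by (simp add: l_scale A.rank_one_bop e)
  then have "adj T T (l (rank_one A v e)) (w u \<xi>) = ip A u v *\<^sub>C \<xi>"
    using \<xi> by (simp add: l_adj[OF r] w_def fun_eq_iff K_def scaleC_apply)
  then have "ip T \<eta> (adj T T (l (rank_one A v e)) (w u \<xi>)) = cnj (ip A u v) * ip T \<eta> \<xi>"
    using \<xi> \<eta> by (simp add: T.ip_scale_right K_carr)
  then have "ip T (w v \<eta>) (w u \<xi>) = cnj (ip A u v) * ip T \<eta> \<xi>"
    using adj_ip[OF T T l_bop[OF r], of \<eta> "w u \<xi>"] u \<xi> \<eta> by (simp add: K_carr w_def[of v])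
  then show ?thesis using T.ip_cnj[of "w v \<eta>" "w u \<xi>"] T.ip_cnj[of \<eta> \<xi>] u v \<xi> \<eta> by (simp add: K_carr)
qed

lemma w_norm:
  assumes "u \<in> carr A" "\<xi> \<in> K" shows "hnorm T (w u \<xi>) = hnorm A u * hnorm T \<xi>"
proof -
  have "complex_of_real ((hnorm T (w u \<xi>))\<^sup>2) = ip T (w u \<xi>) (w u \<xi>)" using T.ip_self[of "w u \<xi>"] assms by simp
  also have "\<dots> = ip A u u * ip T \<xi> \<xi>" using assms by (intro w_ip)
  also have "\<dots> = complex_of_real ((hnorm A u * hnorm T \<xi>)\<^sup>2)"
    using A.ip_self[of u] T.ip_self[of \<xi>] assms by (simp add: power_mult_distrib K_carr)
  finally have "(hnorm T (w u \<xi>))\<^sup>2 = (hnorm A u * hnorm T \<xi>)\<^sup>2" by (simp only: of_real_eq_iff)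
  then show ?thesis using assms by (simp add: K_carr)
qed

text \<open>\<open>rank_one A u e\<close> absorbs \<open>rank_one A e e\<close> on the right, so
  \<open>x\<close> may be replaced by its image in \<open>K\<close>. Nondegeneracy of
  \<open>l\<close> thereby becomes totality of the elementary tensors.\<close>

lemma w_range: "(\<lambda>(u, \<xi>). w u \<xi>) ` (carr A \<times> K) = {l (rank_one A u e) x | u x. u \<in> carr A \<and> x \<in> carr T}"
proof -
  have ree: "rank_one A e e \<in> bop A A" by (intro A.rank_one_bop e)
  have rr: "l (rank_one A u e) (l (rank_one A e e) x) = l (rank_one A u e) x" if "u \<in> carr A" for u x
  proof -
    have "rank_one A u e \<circ> rank_one A e e = rank_one A u e"
      using that e A.rank_one_bop[OF that e(1)] by (simp add: A.comp_rank_one A.rank_one_apply ip_ee scaleC_one)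
    then have "l (rank_one A u e) = l (rank_one A u e) \<circ> l (rank_one A e e)"
      using l_comp[OF A.rank_one_bop[OF that e(1)] ree] by (simp only:)
    then show ?thesis by (metis comp_apply)
  qed
  have "l (rank_one A e e) x \<in> K" if "x \<in> carr T" for x
    using that rr[OF e(1)] bop_in[OF r_bop[OF e(1)]] by (simp add: K_def)
  then have "l (rank_one A u e) x \<in> (\<lambda>(u, \<xi>). w u \<xi>) ` (carr A \<times> K)" if "u \<in> carr A" "x \<in> carr T" for u x
    using rr[OF that(1), of x] that by (intro image_eqI[of _ _ "(u, l (rank_one A e e) x)"]) (auto simp: w_def)
  then show ?thesis by (fastforce simp: w_def dest: K_carr)
qed

lemma w_total: "closed_cspan T ((\<lambda>(u, \<xi>). w u \<xi>) ` (carr A \<times> K)) = carr T"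
  unfolding w_range by (rule l_total)

lemma w_image: "(\<lambda>(u, \<xi>). w u \<xi>) ` (carr A \<times> K) \<subseteq> carr T"
  by auto

lemma K_unit:
  assumes "carr T \<noteq> {0}"
  obtains \<xi> where "\<xi> \<in> K" "hnorm T \<xi> = 1"
proof -
  have "\<exists>\<xi>\<in>K. \<xi> \<noteq> 0"
  proof (rule ccontr)
    assume "\<not> ?thesis"
    then have "(\<lambda>(u, \<xi>). w u \<xi>) ` (carr A \<times> K) \<subseteq> {0}" by auto
    moreover have "closed_csubspace T {0}"
    proof (rule T.closed_csubspaceI, goal_cases)
      case (5 X l)
      then have "hnorm T (- l) = 0" by (simp add: LIMSEQ_const_iff)
      then show ?case using T.hnorm_eq_0[of "- l"] 5 by simp
    qed auto
    ultimately have "carr T \<subseteq> {0}" using w_total unfolding closed_cspan_def by blast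
    then show False using assms T.zero_in by blast
  qed
  then obtain \<xi> where \<xi>: "\<xi> \<in> K" "\<xi> \<noteq> 0" by blast
  then have n: "hnorm T \<xi> > 0" using T.hnorm_eq_0[of \<xi>] T.hnorm_ge_0[of \<xi>] K_carr[of \<xi>] by linarith
  show ?thesis
    by (rule that[of "of_real (1 / hnorm T \<xi>) *\<^sub>C \<xi>"])
      (use \<xi> n in \<open>auto simp: K_scale T.hnorm_scale K_carr norm_divide\<close>)
qed

section \<open>Slices of operators\<close>

definition W :: "'h \<Rightarrow> 'a \<Rightarrow> 'h" where
  "W \<xi> u = (if u \<in> carr A then w u \<xi> else 0)"

lemma W_bop: "\<xi> \<in> K \<Longrightarrow> W \<xi> \<in> bop A T"
  by (rule bopI[where B = "hnorm T \<xi>"]) (auto simp: W_def w_add_left w_scale_left w_norm)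

definition slice :: "'h \<Rightarrow> 'h \<Rightarrow> ('h \<Rightarrow> 'h) \<Rightarrow> 'a \<Rightarrow> 'a" where
  "slice \<xi> \<eta> x = adj A T (W \<xi>) \<circ> (x \<circ> W \<eta>)"

lemma slice_bop: "\<xi> \<in> K \<Longrightarrow> \<eta> \<in> K \<Longrightarrow> x \<in> bop T T \<Longrightarrow> slice \<xi> \<eta> x \<in> bop A A"
  unfolding slice_def by (intro bop_comp[OF A T A] bop_comp[OF A T T] adj_bop[OF A T] W_bop)

lemma slice_in: "\<xi> \<in> K \<Longrightarrow> \<eta> \<in> K \<Longrightarrow> x \<in> bop T T \<Longrightarrow> u \<in> carr A \<Longrightarrow> slice \<xi> \<eta> x u \<in> carr A"
  by (rule bop_in[OF slice_bop])

lemma slice_ip: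
  assumes "\<xi> \<in> K" "\<eta> \<in> K" "x \<in> bop T T" "u \<in> carr A" "v \<in> carr A"
  shows "ip A (slice \<xi> \<eta> x u) v = ip T (x (w u \<eta>)) (w v \<xi>)"
  using assms adj_ip'[OF A T W_bop[OF assms(1)], of v "x (w u \<eta>)"] by (simp add: slice_def W_def bop_in)

text \<open>Slices carry all matrix coefficients at elementary tensors, which are total.\<close>

lemma slice_eqI:
  assumes "x \<in> bop T T" "y \<in> bop T T" "\<And>\<xi> \<eta>. \<xi> \<in> K \<Longrightarrow> \<eta> \<in> K \<Longrightarrow> slice \<xi> \<eta> x = slice \<xi> \<eta> y"
  shows "x = y"
proof (rule bop_eqI_ip[OF T T assms(1,2) w_image w_total w_image w_total])
  fix s t assume "s \<in> (\<lambda>(u, \<xi>). w u \<xi>) ` (carr A \<times> K)" "t \<in> (\<lambda>(u, \<xi>). w u \<xi>) ` (carr A \<times> K)"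
  then show "ip T (x s) t = ip T (y s) t" using assms by (auto simp: slice_ip[symmetric])
qed

lemma eq_by_slice_ip:
  assumes "\<xi> \<in> K" "\<eta> \<in> K" "x \<in> bop T T" "R \<in> bop A A"
    "\<And>u v. u \<in> carr A \<Longrightarrow> v \<in> carr A \<Longrightarrow> ip T (x (w u \<eta>)) (w v \<xi>) = ip A (R u) v"
  shows "slice \<xi> \<eta> x = R"
  by (rule bop_eqI_ip'[OF A A slice_bop[OF assms(1-3)] assms(4)]) (simp add: slice_ip assms)

lemma slice_add:
  assumes "\<xi> \<in> K" "\<eta> \<in> K" "x \<in> bop T T" "y \<in> bop T T"
  shows "slice \<xi> \<eta> (x + y) = slice \<xi> \<eta> x + slice \<xi> \<eta> y"
  using assms by (intro eq_by_slice_ip) (auto simp: bop_plus[OF T T] bop_plus[OF A A] slice_bop slice_ip T.ip_add A.ip_add bop_in slice_in)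

lemma slice_scale:
  assumes "\<xi> \<in> K" "\<eta> \<in> K" "x \<in> bop T T"
  shows "slice \<xi> \<eta> (c *\<^sub>C x) = c *\<^sub>C slice \<xi> \<eta> x"
  using assms by (intro eq_by_slice_ip) (auto simp: bop_scaleC[OF T T] bop_scaleC[OF A A] slice_bop slice_ip scaleC_apply T.ip_scale A.ip_scale bop_in slice_in)

lemma slice_diff:
  assumes "\<xi> \<in> K" "\<eta> \<in> K" "x \<in> bop T T" "y \<in> bop T T"
  shows "slice \<xi> \<eta> (x - y) = slice \<xi> \<eta> x - slice \<xi> \<eta> y"
  using assms by (intro eq_by_slice_ip) (auto simp: bop_diff_fun[OF T T] bop_diff_fun[OF A A] slice_bop slice_ip T.ip_diff_left A.ip_diff_left bop_in slice_in)

lemma slice_id: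
  assumes "\<xi> \<in> K" "\<eta> \<in> K" shows "slice \<xi> \<eta> (idop T) = ip T \<eta> \<xi> *\<^sub>C idop A"
  using assms by (intro eq_by_slice_ip) (auto simp: bop_idop A T bop_scaleC idop_eq scaleC_apply A.ip_scale w_ip)

text \<open>Slicing is a bimodule map over the operators of the first factor: the adjoint of
  \<open>l a\<close> acts on \<open>w v \<xi>\<close> through \<open>v\<close> alone.\<close>

lemma slice_l_left:
  assumes "\<xi> \<in> K" "\<eta> \<in> K" "a \<in> bop A A" "y \<in> bop T T"
  shows "slice \<xi> \<eta> (l a \<circ> y) = a \<circ> slice \<xi> \<eta> y"
proof (rule eq_by_slice_ip)
  fix u v assume u: "u \<in> carr A" and v: "v \<in> carr A"
  note a' = adj_bop[OF A A assms(3)]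
  have yw: "y (w u \<eta>) \<in> carr T" using u assms by (simp add: bop_in)
  have "ip T ((l a \<circ> y) (w u \<eta>)) (w v \<xi>) = ip T (y (w u \<eta>)) (w (adj A A a v) \<xi>)"
    using adj_ip[OF T T l_bop[OF assms(3)] yw, of "w v \<xi>"] l_w[OF a' v] v assms by (simp add: l_adj)
  then show "ip T ((l a \<circ> y) (w u \<eta>)) (w v \<xi>) = ip A ((a \<circ> slice \<xi> \<eta> y) u) v"
    using slice_ip[OF assms(1,2,4) u bop_in[OF a' v]] adj_ip[OF A A assms(3) bop_in[OF slice_bop[OF assms(1,2,4)] u] v] by simp
qed (use assms in \<open>auto intro!: bop_comp A T l_bop slice_bop\<close>)

lemma slice_l_right:
  assumes "\<xi> \<in> K" "\<eta> \<in> K" "a \<in> bop A A" "y \<in> bop T T"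
  shows "slice \<xi> \<eta> (y \<circ> l a) = slice \<xi> \<eta> y \<circ> a"
  using assms by (intro eq_by_slice_ip) (auto intro!: bop_comp A T l_bop slice_bop simp: l_w slice_ip bop_in)

lemma slice_l:
  assumes "\<xi> \<in> K" "\<eta> \<in> K" "a \<in> bop A A" shows "slice \<xi> \<eta> (l a) = ip T \<eta> \<xi> *\<^sub>C a"
  using slice_l_left[OF assms bop_idop[OF T]] assms
  by (simp add: slice_id comp_idop[OF l_bop T] bop_comp_scale_right[OF bop_idop[OF A] _ A] comp_idop[OF _ A])

text \<open>The operators acting on the second factor only; the condition on the adjoint makes
  closure under \<open>adj\<close> immediate.\<close>

definition commutant :: "('h \<Rightarrow> 'h) set" where
  "commutant = {x \<in> bop T T. \<forall>a\<in>bop A A. x \<circ> l a = l a \<circ> x \<and> adj T T x \<circ> l a = l a \<circ> adj T T x}"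

lemma commutant_adj: "x \<in> commutant \<Longrightarrow> adj T T x \<in> commutant"
  by (auto simp: commutant_def adj_adj[OF T T] adj_bop[OF T T])

lemma commutant_w:
  assumes x: "x \<in> commutant" and u: "u \<in> carr A" and \<xi>: "\<xi> \<in> K"
  shows "x \<xi> \<in> K" "x (w u \<xi>) = w u (x \<xi>)"
proof -
  have xb: "x \<in> bop T T" and comm: "\<And>a y. a \<in> bop A A \<Longrightarrow> x (l a y) = l a (x y)"
    using x by (auto simp: commutant_def fun_eq_iff)
  show "x (w u \<xi>) = w u (x \<xi>)" using comm[OF A.rank_one_bop[OF u e(1)]] by (simp add: w_def)
  show "x \<xi> \<in> K" using comm[OF A.rank_one_bop[OF e(1) e(1)], of \<xi>] \<xi> bop_in[OF xb] by (simp add: K_def)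
qed

text \<open>An operator of the second factor only moves the vector at which the slice is taken. No
  algebra on the first factor enters, so such operators preserve \<open>sliced M\<close> for every
  \<open>M\<close>.\<close>

lemma slice_commutant:
  assumes "\<xi> \<in> K" "\<eta> \<in> K" and x: "x \<in> commutant" and y: "y \<in> bop T T"
  shows "slice \<xi> \<eta> (x \<circ> y) = slice (adj T T x \<xi>) \<eta> y"
proof (rule eq_by_slice_ip)
  have xb: "x \<in> bop T T" using x by (simp add: commutant_def)
  note x' = commutant_w[OF commutant_adj[OF x] _ assms(1)]
  note x'K = x'(1)[OF e(1)]
  fix u v assume u: "u \<in> carr A" and v: "v \<in> carr A"
  have "ip T ((x \<circ> y) (w u \<eta>)) (w v \<xi>) = ip T (y (w u \<eta>)) (w v (adj T T x \<xi>))"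
    using adj_ip[OF T T xb, of "y (w u \<eta>)" "w v \<xi>"] x'(2)[OF v] u v assms by (simp add: bop_in)
  then show "ip T ((x \<circ> y) (w u \<eta>)) (w v \<xi>) = ip A (slice (adj T T x \<xi>) \<eta> y u) v"
    using slice_ip[OF x'K assms(2) y u v] by simp
next
  have xb: "x \<in> bop T T" using x by (simp add: commutant_def)
  show "x \<circ> y \<in> bop T T" by (rule bop_comp[OF T T T xb y])
  show "slice (adj T T x \<xi>) \<eta> y \<in> bop A A"
    using commutant_w(1)[OF commutant_adj[OF x] e(1) assms(1)] assms by (intro slice_bop)
qed (use assms in auto)

lemma slice_lim:
  assumes \<xi>: "\<xi> \<in> K" "\<eta> \<in> K" and X: "\<And>m. X m \<in> bop T T" "z \<in> bop T T" "(\<lambda>m. opnorm T T (X m - z)) \<longlonglongrightarrow> 0"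
  shows "(\<lambda>m. opnorm A A (slice \<xi> \<eta> (X m) - slice \<xi> \<eta> z)) \<longlonglongrightarrow> 0"
proof (rule Lim_null_comparison)
  let ?c = "opnorm T A (adj A T (W \<xi>))" and ?d = "opnorm A T (W \<eta>)"
  have "opnorm A A (slice \<xi> \<eta> (X m) - slice \<xi> \<eta> z) \<le> ?c * (opnorm T T (X m - z) * ?d)" for m
  proof -
    note D = bop_diff_fun[OF T T X(1,2), of m]
    have "opnorm A A (slice \<xi> \<eta> (X m - z)) \<le> ?c * opnorm A T ((X m - z) \<circ> W \<eta>)"
      unfolding slice_def by (intro opnorm_comp_le A T adj_bop W_bop \<xi> bop_comp[OF A T T D])
    also have "\<dots> \<le> ?c * (opnorm T T (X m - z) * ?d)"
      by (intro mult_left_mono opnorm_comp_le opnorm_ge_0 A T adj_bop W_bop \<xi> D)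
    finally show ?thesis using slice_diff[OF \<xi> X(1,2)] by simp
  qed
  moreover have "0 \<le> opnorm A A (slice \<xi> \<eta> (X m) - slice \<xi> \<eta> z)" for m
    by (intro opnorm_ge_0 A bop_diff_fun slice_bop \<xi> X)
  ultimately show "\<forall>\<^sub>F m in sequentially. norm (opnorm A A (slice \<xi> \<eta> (X m) - slice \<xi> \<eta> z)) \<le> ?c * (opnorm T T (X m - z) * ?d)"
    by simp
  show "(\<lambda>m. ?c * (opnorm T T (X m - z) * ?d)) \<longlonglongrightarrow> 0"
    using tendsto_mult_left[OF tendsto_mult_right[OF X(3), of ?d], of ?c] by simp
qed

text \<open>
  The operators whose slices lie in an algebra \<open>M\<close> need not form an algebra, but the operators
  that map this space into itself by left multiplication do.
\<close>

definition sliced :: "('a \<Rightarrow> 'a) set \<Rightarrow> ('h \<Rightarrow> 'h) set" where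
  "sliced M = {y \<in> bop T T. \<forall>\<xi>\<in>K. \<forall>\<eta>\<in>K. slice \<xi> \<eta> y \<in> M}"

definition slice_multipliers :: "('a \<Rightarrow> 'a) set \<Rightarrow> ('h \<Rightarrow> 'h) set" where
  "slice_multipliers M = {x \<in> bop T T. \<forall>y\<in>sliced M. x \<circ> y \<in> sliced M}"

lemma slice_multipliers_algebra:
  assumes M: "banach_algebra A M"
  shows "banach_algebra T (slice_multipliers M)"
proof -
  note sub = banach_algebra_subspace[OF M]
  have sb: "y \<in> bop T T" if "y \<in> sliced M" for y using that by (simp add: sliced_def)
  have add: "x + y \<in> sliced M" if "x \<in> sliced M" "y \<in> sliced M" for x y
    using that by (auto simp: sliced_def bop_plus[OF T T] slice_add complex_vector.subspace_add[OF sub])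
  have scale: "c *\<^sub>C x \<in> sliced M" if "x \<in> sliced M" for x c
    using that by (auto simp: sliced_def bop_scaleC[OF T T] slice_scale complex_vector.subspace_scale[OF sub])
  have lim: "z \<in> sliced M" if X: "\<And>m. X m \<in> sliced M" "z \<in> bop T T" "(\<lambda>m. opnorm T T (X m - z)) \<longlonglongrightarrow> 0" for X z
  proof -
    have "slice \<xi> \<eta> z \<in> M" if "\<xi> \<in> K" "\<eta> \<in> K" for \<xi> \<eta>
      using X(1) that by (intro banach_algebra_lim[OF M _ slice_bop[OF that X(2)] slice_lim[OF that sb[OF X(1)] X(2,3)]]) (auto simp: sliced_def)
    then show ?thesis using X(2) by (simp add: sliced_def)
  qed
  show ?thesis
  proof (rule banach_algebraI, goal_cases)
    case 1 show ?case by (auto simp: slice_multipliers_def)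
  next
    case 2
    have "0 \<circ> y \<in> sliced M" if "y \<in> sliced M" for y
    proof -
      have "0 \<circ> y = 0 *\<^sub>C y" by (simp add: fun_eq_iff scaleC_apply)
      then show ?thesis using scale[OF that, of 0] by (simp only:)
    qed
    then show ?case using bop_zero_fun[OF T T] unfolding slice_multipliers_def by blast
  next
    case (3 a b) then show ?case by (auto simp: slice_multipliers_def bop_plus[OF T T] comp_add_left add)
  next
    case (4 c a) then show ?case by (auto simp: slice_multipliers_def bop_scaleC[OF T T] comp_scale_left scale)
  next
    case (5 a b) then show ?case by (auto simp: slice_multipliers_def bop_comp[OF T T T] comp_assoc)
  next
    case (6 X z)
    then have X: "\<And>m. X m \<in> bop T T" "\<And>m y. y \<in> sliced M \<Longrightarrow> X m \<circ> y \<in> sliced M" by (auto simp: slice_multipliers_def)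
    have "z \<circ> y \<in> sliced M" if y: "y \<in> sliced M" for y
      using opnorm_lim_comp_right[OF T T T X(1) 6(2,3) sb[OF y]] by (intro lim[OF X(2)[OF y] bop_comp[OF T T T 6(2) sb[OF y]]])
    with 6 show ?case by (simp add: slice_multipliers_def)
  qed
qed

lemma l_in_multipliers:
  assumes M: "banach_algebra A M" and a: "a \<in> M"
  shows "l a \<in> slice_multipliers M"
proof -
  have ab: "a \<in> bop A A" using banach_algebra_bop[OF M] a by blast
  show ?thesis using ab banach_algebra_comp[OF M a]
    by (auto simp: slice_multipliers_def sliced_def l_bop bop_comp[OF T T T] slice_l_left)
qed

lemma commutant_multipliers: "commutant \<subseteq> slice_multipliers M"
proof
  fix x assume x: "x \<in> commutant"
  then have "x \<in> bop T T" by (simp add: commutant_def)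
  then show "x \<in> slice_multipliers M"
    using slice_commutant[OF _ _ x] commutant_w(1)[OF commutant_adj[OF x] e(1)]
    by (auto simp: slice_multipliers_def sliced_def bop_comp[OF T T T])
qed

text \<open>The multiplier is applied to the identity, whose slices are multiples of
  \<open>idop A\<close>.\<close>

lemma slice_multiplier_in:
  assumes M: "banach_algebra A M" "idop A \<in> M" and x: "x \<in> slice_multipliers M" and "\<xi> \<in> K" "\<eta> \<in> K"
  shows "slice \<xi> \<eta> x \<in> M"
proof -
  have "idop T \<in> sliced M"
    using complex_vector.subspace_scale[OF banach_algebra_subspace[OF M(1)] M(2)] by (auto simp: sliced_def bop_idop T slice_id)
  then have "x \<circ> idop T \<in> sliced M" and xb: "x \<in> bop T T" using x by (auto simp: slice_multipliers_def)
  then show ?thesis using assms by (simp add: sliced_def comp_idop[OF xb T])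
qed

lemma idop_commutant: "idop T \<in> commutant"
  by (auto simp: commutant_def bop_idop T adj_idop idop_comp[OF l_bop T] comp_idop[OF l_bop T])

text \<open>The identity of \<open>defect_operator\<close> is algebraic, hence preserved by
  \<open>l\<close>. It is used for each \<open>M\<close> above the norm of \<open>a\<close>, which
  keeps \<open>M\<close> positive even for \<open>a = 0\<close>; then \<open>M\<close> tends to the
  norm.\<close>

lemma l_contractive:
  assumes a: "a \<in> bop A A" shows "opnorm T T (l a) \<le> opnorm A A a"
proof (rule opnorm_le[OF T _ opnorm_ge_0[OF A A a]])
  fix x assume x: "x \<in> carr T"
  let ?M = "opnorm A A a"
  have bd: "hnorm T (l a x) \<le> M * hnorm T x" if M: "M > ?M" for M
  proof -
    have M0: "M > 0" using M opnorm_ge_0[OF A A a] by linarith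
    obtain s where s: "s \<in> bop A A"
      and sip: "\<And>u v. u \<in> carr A \<Longrightarrow> v \<in> carr A \<Longrightarrow> ip A (s u) (s v) = of_real (M\<^sup>2) * ip A u v - ip A (a u) (a v)"
      using defect_operator[OF A a M0] M by force
    note a' = adj_bop[OF A A a] and s' = adj_bop[OF A A s]
    have aa: "adj A A a \<circ> a \<in> bop A A" and ss: "adj A A s \<circ> s \<in> bop A A" by (intro bop_comp[OF A A A] a a' s s')+
    have "adj A A s \<circ> s = of_real (M\<^sup>2) *\<^sub>C idop A - (adj A A a \<circ> a)"
      by (rule bop_eqI_ip'[OF A A ss bop_diff_fun[OF A A bop_scaleC[OF A A bop_idop[OF A]] aa]])
        (simp add: adj_ip'[OF A A s] adj_ip'[OF A A a] bop_in[OF s] bop_in[OF a] bop_in[OF a'] sip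
          A.ip_diff_left A.ip_scale idop_eq scaleC_apply del: of_real_power)
    from arg_cong[OF this, of l]
    have "adj T T (l s) \<circ> l s = of_real (M\<^sup>2) *\<^sub>C idop T - (adj T T (l a) \<circ> l a)"
      unfolding l_comp[OF s' s] l_diff[OF bop_scaleC[OF A A bop_idop[OF A]] aa] l_comp[OF a' a] l_adj[OF s] l_adj[OF a]
        l_scale[OF bop_idop[OF A]] l_id .
    then have "ip T (adj T T (l s) (l s x)) x = ip T (of_real (M\<^sup>2) *\<^sub>C x - adj T T (l a) (l a x)) x"
      using x by (simp add: fun_eq_iff idop_eq scaleC_apply)
    then have "ip T (l s x) (l s x) = of_real (M\<^sup>2) * ip T x x - ip T (l a x) (l a x)"
      using x a s by (simp add: T.ip_diff_left T.ip_scale adj_ip'[OF T T] l_bop bop_in[OF l_bop] bop_in[OF adj_bop[OF T T l_bop]] del: of_real_power)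
    then have "(hnorm T (l s x))\<^sup>2 = M\<^sup>2 * (hnorm T x)\<^sup>2 - (hnorm T (l a x))\<^sup>2"
      using x a s by (simp add: T.hnorm_sq bop_in[OF l_bop])
    then have "(hnorm T (l a x))\<^sup>2 \<le> (M * hnorm T x)\<^sup>2"
      using zero_le_power2[of "hnorm T (l s x)"] by (simp add: power_mult_distrib)
    then show ?thesis using x M0 by (intro power2_le_imp_le[of "hnorm T (l a x)"]) auto
  qed
  have "((\<lambda>M. M * hnorm T x) \<longlongrightarrow> ?M * hnorm T x) (at_right ?M)" by (intro tendsto_intros)
  moreover have "\<forall>\<^sub>F M in at_right ?M. hnorm T (l a x) \<le> M * hnorm T x"
    using bd by (auto simp: eventually_at_right_field intro: gt_ex)
  ultimately show "hnorm T (l a x) \<le> ?M * hnorm T x" by (rule tendsto_lowerbound) simp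
qed

text \<open>Norm closedness of the preimage rests on \<open>l_contractive\<close>. Inclusions of
  generated algebras can then be checked on the generators of the factor.\<close>

lemma l_pullback_algebra:
  assumes M: "banach_algebra T M"
  shows "banach_algebra A {a \<in> bop A A. l a \<in> M}"
proof -
  note sub = banach_algebra_subspace[OF M]
  show ?thesis
  proof (rule banach_algebraI, goal_cases)
    case 2
    have "l (0 *\<^sub>C idop A) = 0 *\<^sub>C l (idop A)" by (rule l_scale[OF bop_idop[OF A]])
    then have "l 0 = 0" by simp
    then show ?case using bop_zero_fun[OF A A] complex_vector.subspace_0[OF sub] by (simp only: mem_Collect_eq)
  next
    case (3 a b) then show ?case by (simp add: bop_plus[OF A A] l_add complex_vector.subspace_add[OF sub])
  next
    case (4 c a) then show ?case by (simp add: bop_scaleC[OF A A] l_scale complex_vector.subspace_scale[OF sub])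
  next
    case (5 a b) then show ?case by (simp add: bop_comp[OF A A A] l_comp banach_algebra_comp[OF M])
  next
    case (6 X z)
    then have X: "X m \<in> bop A A" "l (X m) \<in> M" for m by auto
    have "(\<lambda>m. opnorm T T (l (X m) - l z)) \<longlonglongrightarrow> 0"
    proof (rule Lim_null_comparison[OF _ 6(3)])
      have "opnorm T T (l (X m) - l z) \<le> opnorm A A (X m - z)" for m
        using l_contractive[OF bop_diff_fun[OF A A X(1) 6(2)]] unfolding l_diff[OF X(1) 6(2)] .
      moreover have "0 \<le> opnorm T T (l (X m) - l z)" for m by (intro opnorm_ge_0 T bop_diff_fun l_bop X 6)
      ultimately show "\<forall>\<^sub>F m in sequentially. norm (opnorm T T (l (X m) - l z)) \<le> opnorm A A (X m - z)" by simp
    qed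
    then have "l z \<in> M" by (rule banach_algebra_lim[OF M X(2) l_bop[OF 6(2)]])
    with 6 show ?case by simp
  qed auto
qed

text \<open>Gram-Schmidt in the second tensor factor reduces to the case of orthogonal \<open>\<eta> s\<close>.\<close>

lemma l_positive_finite:
  assumes a: "\<And>i j. i < m \<Longrightarrow> j < m \<Longrightarrow> a i j \<in> bop A A" and pos: "positive_matrix A m a" and F: "finite F"
    and \<eta>: "\<And>s. s \<in> F \<Longrightarrow> \<eta> s \<in> K" and v: "\<And>i s. i < m \<Longrightarrow> s \<in> F \<Longrightarrow> v i s \<in> carr A"
  shows "(\<Sum>i<m. \<Sum>j<m. ip T (l (a i j) (\<Sum>s\<in>F. w (v j s) (\<eta> s))) (\<Sum>s\<in>F. w (v i s) (\<eta> s))) \<in> \<real>\<^sub>\<ge>\<^sub>0"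
  using F \<eta> v
proof (induction F arbitrary: \<eta> v rule: finite_induct)
  case empty
  have "ip T (l (a i j) 0) 0 = 0" if "i < m" "j < m" for i j using a[OF that] by (simp add: bop_zero[OF T l_bop])
  then show ?case by simp
next
  case (insert s0 F)
  define \<eta>0 where "\<eta>0 = \<eta> s0"
  have \<eta>0: "\<eta>0 \<in> K" using insert.prems by (simp add: \<eta>0_def)
  have \<eta>K: "\<eta> s \<in> K" if "s \<in> F" for s using insert.prems that by simp
  have vA: "v i s \<in> carr A" "v i s0 \<in> carr A" if "i < m" "s \<in> F" for i s using insert.prems that by simp_all
  have v0A: "v i s0 \<in> carr A" if "i < m" for i using insert.prems that by simp
  show ?case
  proof (cases "\<eta>0 = 0")
    case True
    have "(\<Sum>s\<in>insert s0 F. w (v i s) (\<eta> s)) = (\<Sum>s\<in>F. w (v i s) (\<eta> s))" if "i < m" for i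
      using insert.hyps True v0A[OF that] by (simp add: \<eta>0_def)
    then show ?thesis using insert.IH[OF \<eta>K vA(1)] by simp
  next
    case False
    \<comment> \<open>Each \<open>\<eta> s\<close> splits into its component along
      \<open>\<eta>0\<close> and the orthogonal rest \<open>\<zeta> s\<close>; \<open>u i\<close>
      collects all that stands in front of \<open>\<eta>0\<close>.\<close>
    define \<alpha> where "\<alpha> s = ip T (\<eta> s) \<eta>0 / ip T \<eta>0 \<eta>0" for s
    define \<zeta> where "\<zeta> s = \<eta> s - \<alpha> s *\<^sub>C \<eta>0" for s
    define u where "u i = v i s0 + (\<Sum>s\<in>F. \<alpha> s *\<^sub>C v i s)" for i
    define y where "y i = (\<Sum>s\<in>F. w (v i s) (\<zeta> s))" for i
    have \<zeta>: "\<zeta> s \<in> K" if "s \<in> F" for s using \<eta>K[OF that] \<eta>0 by (simp add: \<zeta>_def K_diff K_scale)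
    have nz: "ip T \<eta>0 \<eta>0 \<noteq> 0" using T.ip_eq_0[of \<eta>0] False K_carr[OF \<eta>0] by blast
    have \<zeta>0: "ip T (\<zeta> s) \<eta>0 = 0" if "s \<in> F" for s
      using \<eta>K[OF that] \<eta>0 nz by (simp add: \<zeta>_def T.ip_diff_left T.ip_scale K_carr \<alpha>_def)
    have u: "u i \<in> carr A" if "i < m" for i
      unfolding u_def using vA that v0A by (intro A.add_in A.sum_in A.scale_in) auto
    have y: "y i \<in> carr T" if "i < m" for i
      unfolding y_def using vA that \<zeta> by (intro T.sum_in) auto
    have split: "(\<Sum>s\<in>insert s0 F. w (v i s) (\<eta> s)) = y i + w (u i) \<eta>0" if i: "i < m" for i
    proof -
      have "w (v i s) (\<eta> s) = w (v i s) (\<zeta> s) + w (\<alpha> s *\<^sub>C v i s) \<eta>0" if s: "s \<in> F" for s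
      proof -
        have "\<eta> s = \<zeta> s + \<alpha> s *\<^sub>C \<eta>0" by (simp add: \<zeta>_def)
        then show ?thesis using vA(1)[OF i s] \<zeta>[OF s] \<eta>0
          by (simp add: w_add_right K_scale w_scale_right w_scale_left)
      qed
      then have "(\<Sum>s\<in>F. w (v i s) (\<eta> s)) = y i + (\<Sum>s\<in>F. w (\<alpha> s *\<^sub>C v i s) \<eta>0)"
        by (simp add: y_def sum.distrib)
      also have "(\<Sum>s\<in>F. w (\<alpha> s *\<^sub>C v i s) \<eta>0) = w (\<Sum>s\<in>F. \<alpha> s *\<^sub>C v i s) \<eta>0"
        using vA[OF i] by (intro w_sum_left[symmetric]) auto
      finally show ?thesis using insert.hyps v0A[OF i] vA[OF i]
        by (simp add: u_def w_add_left \<eta>0_def[symmetric] add_ac)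
    qed
    have la: "l (a i j) \<in> bop T T" if "i < m" "j < m" for i j using a that by (simp add: l_bop)
    have ly: "l (a i j) (y j) = (\<Sum>s\<in>F. w (a i j (v j s)) (\<zeta> s))" if ij: "i < m" "j < m" for i j
      unfolding y_def using vA ij \<zeta> by (subst bop_sum[OF T la[OF ij]]) (auto simp: l_w a)
    have c1: "ip T (l (a i j) (y j)) (w (u i) \<eta>0) = 0" if ij: "i < m" "j < m" for i j
      unfolding ly[OF ij] using vA ij \<zeta> \<zeta>0 u[OF ij(1)] \<eta>0 bop_in[OF a[OF ij]]
      by (subst T.ip_sum_left) (auto simp: w_ip)
    have c2: "ip T (l (a i j) (w (u j) \<eta>0)) (y i) = 0" if ij: "i < m" "j < m" for i j
    proof -
      have "ip T \<eta>0 (\<zeta> s) = 0" if "s \<in> F" for s using \<zeta>0[OF that] T.ip_cnj[of "\<zeta> s" \<eta>0] \<zeta>[OF that] \<eta>0 by (simp add: K_carr)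
      then show ?thesis unfolding y_def using vA ij \<zeta> u[OF ij(2)] \<eta>0 bop_in[OF a[OF ij]] bop_in[OF la[OF ij]]
        by (subst T.ip_sum_right) (auto simp: w_ip l_w a)
    qed
    \<comment> \<open>The cross terms vanish, so the form is the one for the smaller set
      \<open>F\<close> plus \<open>ip T \<eta>0 \<eta>0\<close> times the positive form of
      \<open>a\<close> at \<open>u\<close>.\<close>
    have "ip T (l (a i j) (y j + w (u j) \<eta>0)) (y i + w (u i) \<eta>0)
        = ip T (l (a i j) (y j)) (y i) + ip A (a i j (u j)) (u i) * ip T \<eta>0 \<eta>0" if ij: "i < m" "j < m" for i j
      using c1[OF ij] c2[OF ij] y[OF ij(1)] y[OF ij(2)] u[OF ij(1)] u[OF ij(2)] \<eta>0 bop_in[OF la[OF ij]] bop_in[OF a[OF ij]]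
      by (simp add: bop_add[OF la[OF ij]] T.ip_add T.ip_add_right l_w[OF a[OF ij]] w_ip)
    then have "(\<Sum>i<m. \<Sum>j<m. ip T (l (a i j) (\<Sum>s\<in>insert s0 F. w (v j s) (\<eta> s))) (\<Sum>s\<in>insert s0 F. w (v i s) (\<eta> s)))
       = (\<Sum>i<m. \<Sum>j<m. ip T (l (a i j) (y j)) (y i)) + (\<Sum>i<m. \<Sum>j<m. ip A (a i j (u j)) (u i)) * ip T \<eta>0 \<eta>0"
      by (simp add: split sum.distrib sum_distrib_right)
    moreover have "(\<Sum>i<m. \<Sum>j<m. ip T (l (a i j) (y j)) (y i)) \<in> \<real>\<^sub>\<ge>\<^sub>0"
      unfolding y_def using \<zeta> vA by (intro insert.IH) auto
    moreover have "(\<Sum>i<m. \<Sum>j<m. ip A (a i j (u j)) (u i)) \<in> \<real>\<^sub>\<ge>\<^sub>0"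
      using pos u by (auto simp: positive_matrix_def)
    ultimately show ?thesis using T.ip_nonneg[of \<eta>0] K_carr[OF \<eta>0] by (simp add: nonneg_Reals_add_I nonneg_Reals_mult_I)
  qed
qed

text \<open>Finitely many vectors of the span are written over one common set of elementary tensors,
  with the coefficients absorbed into the first factor; this is the situation of
  \<open>l_positive_finite\<close>.\<close>

lemma l_positive:
  assumes a: "\<And>i j. i < m \<Longrightarrow> j < m \<Longrightarrow> a i j \<in> bop A A" and pos: "positive_matrix A m a"
  shows "positive_matrix T m (\<lambda>i j. l (a i j))"
proof (rule positive_matrix_dense[OF T _ w_image w_total])
  fix x :: "nat \<Rightarrow> 'h"
  assume x: "\<And>i. i < m \<Longrightarrow> x i \<in> complex_vector.span ((\<lambda>(u, \<xi>). w u \<xi>) ` (carr A \<times> K))"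
  let ?g = "\<lambda>(u, \<xi>). w u \<xi>"
  have "\<exists>F c. finite F \<and> F \<subseteq> carr A \<times> K \<and> (\<forall>i\<in>{..<m}. x i = (\<Sum>s\<in>F. c i s *\<^sub>C ?g s))"
    by (rule span_image_common) (use x in simp_all)
  then obtain F c where F: "finite F" "F \<subseteq> carr A \<times> K" "\<forall>i\<in>{..<m}. x i = (\<Sum>s\<in>F. c i s *\<^sub>C ?g s)"
    by blast
  have FA: "fst s \<in> carr A" "snd s \<in> K" if "s \<in> F" for s using F(2) that by auto
  have "x i = (\<Sum>s\<in>F. w (c i s *\<^sub>C fst s) (snd s))" if "i < m" for i
    using F(3)[rule_format, of i] that FA by (simp add: w_scale_left case_prod_beta)
  then show "(\<Sum>i<m. \<Sum>j<m. ip T (l (a i j) (x j)) (x i)) \<in> \<real>\<^sub>\<ge>\<^sub>0"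
    using l_positive_finite[OF a pos F(1), of snd "\<lambda>i s. c i s *\<^sub>C fst s"] FA by simp
qed (use a l_bop in auto)

end

section \<open>Boundary representations and tensor factors\<close>

text \<open>One factor inside the full product: \<open>c\<close> generates the algebra of the
  factor, \<open>S\<close> the algebra on \<open>T\<close>, and every generator other than
  \<open>l c\<close> acts on the second factor.\<close>

locale generated_factor = tensor_factor A T l e
  for A :: "'a::complex_vector hspace" and T :: "'h::complex_vector hspace" and l e +
  fixes c :: "'a \<Rightarrow> 'a" and S :: "('h \<Rightarrow> 'h) set"
  assumes c: "c \<in> bop A A" and S_bop: "S \<subseteq> bop T T" and S_c: "l c \<in> S" and S_id: "idop T \<in> S"
    and S_sub: "S \<subseteq> insert (l c) commutant"
begin

abbreviation gens :: "('a \<Rightarrow> 'a) set" where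
  "gens \<equiv> {idop A, c}"

lemma gens_bop: "gens \<subseteq> bop A A"
  using c bop_idop[OF A] by simp

lemmas CA_cstar = cstar_gen_algebra[OF A gens_bop]
lemmas CA_algebra = cstar_banach[OF CA_cstar]
lemmas CA_bop = subsetD[OF banach_algebra_bop[OF CA_algebra]]
lemmas BA_algebra = banach_gen_algebra[OF A gens_bop]
lemmas BA_bop = subsetD[OF banach_algebra_bop[OF BA_algebra]]
lemmas CT_cstar = cstar_gen_algebra[OF T S_bop]
lemmas CT_algebra = cstar_banach[OF CT_cstar]
lemmas CT_bop = subsetD[OF banach_algebra_bop[OF CT_algebra]]
lemmas BT_algebra = banach_gen_algebra[OF T S_bop]
lemmas BT_bop = subsetD[OF banach_algebra_bop[OF BT_algebra]]

lemma idA_CA: "idop A \<in> cstar_gen A gens" and c_CA: "c \<in> cstar_gen A gens"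
  and idA_BA: "idop A \<in> banach_gen A gens" and c_BA: "c \<in> banach_gen A gens"
  using cstar_gen_incl[of gens A] banach_gen_incl[of gens A] by auto

lemma idT_CT: "idop T \<in> cstar_gen T S" and idT_BT: "idop T \<in> banach_gen T S"
  using cstar_gen_incl[of S T] banach_gen_incl[of S T] S_id by auto

section \<open>Generated algebras under embedding and slicing\<close>

lemma l_BA: "a \<in> banach_gen A gens \<Longrightarrow> l a \<in> banach_gen T S"
proof -
  have "gens \<subseteq> {a \<in> bop A A. l a \<in> banach_gen T S}"
    using gens_bop idT_BT banach_gen_incl[of S T] S_c by (auto simp: l_id)
  then have "banach_gen A gens \<subseteq> {a \<in> bop A A. l a \<in> banach_gen T S}"
    by (rule banach_gen_min[OF l_pullback_algebra[OF BT_algebra]])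
  then show "a \<in> banach_gen A gens \<Longrightarrow> l a \<in> banach_gen T S" by blast
qed

lemma l_CA: "a \<in> cstar_gen A gens \<Longrightarrow> l a \<in> cstar_gen T S"
proof -
  have "cstar_algebra A {a \<in> bop A A. l a \<in> cstar_gen T S}"
    using l_pullback_algebra[OF CT_algebra] cstar_adj[OF CT_cstar]
    by (auto simp: cstar_algebra_def adj_bop[OF A A] l_adj)
  moreover have "gens \<subseteq> {a \<in> bop A A. l a \<in> cstar_gen T S}"
    using gens_bop idT_CT cstar_gen_incl[of S T] S_c by (auto simp: l_id)
  ultimately have "cstar_gen A gens \<subseteq> {a \<in> bop A A. l a \<in> cstar_gen T S}" by (rule cstar_gen_min)
  then show "a \<in> cstar_gen A gens \<Longrightarrow> l a \<in> cstar_gen T S" by blast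
qed

text \<open>Both kinds of generators are slice multipliers for the algebra of the factor; minimality
  of the generated algebra passes this on to all its elements.\<close>

lemma slice_BT:
  assumes x: "x \<in> banach_gen T S" and "\<xi> \<in> K" "\<eta> \<in> K"
  shows "slice \<xi> \<eta> x \<in> banach_gen A gens"
proof -
  have "S \<subseteq> slice_multipliers (banach_gen A gens)"
    using S_sub l_in_multipliers[OF BA_algebra c_BA] commutant_multipliers by blast
  then have "banach_gen T S \<subseteq> slice_multipliers (banach_gen A gens)"
    by (rule banach_gen_min[OF slice_multipliers_algebra[OF BA_algebra]])
  then show ?thesis using slice_multiplier_in[OF BA_algebra idA_BA] assms by blast
qed

lemma slice_CT:
  assumes x: "x \<in> cstar_gen T S" and "\<xi> \<in> K" "\<eta> \<in> K"
  shows "slice \<xi> \<eta> x \<in> cstar_gen A gens"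
proof -
  let ?D = "slice_multipliers (cstar_gen A gens)"
  have "x \<in> ?D \<and> adj T T x \<in> ?D" if "x \<in> S" for x
  proof -
    have "x = l c \<or> x \<in> commutant" using that S_sub by blast
    then show ?thesis
    proof
      assume "x = l c"
      then show ?thesis using l_in_multipliers[OF CA_algebra c_CA] l_in_multipliers[OF CA_algebra cstar_adj[OF CA_cstar c_CA]]
        by (simp add: l_adj c)
    next
      assume "x \<in> commutant"
      then show ?thesis using commutant_multipliers commutant_adj by blast
    qed
  qed
  then have "S \<subseteq> {x \<in> ?D. adj T T x \<in> ?D}" by blast
  then have "cstar_gen T S \<subseteq> {x \<in> ?D. adj T T x \<in> ?D}"
    by (rule cstar_gen_min[OF banach_algebra_star_part[OF T slice_multipliers_algebra[OF CA_algebra]]])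
  then show ?thesis using slice_multiplier_in[OF CA_algebra idA_CA] assms by blast
qed

text \<open>The matrix coefficient that the amplification of \<open>\<phi>\<close> at
  \<open>x\<close> should have between the elementary tensors given by the pairs \<open>s\<close>
  and \<open>t\<close>; the vector of \<open>t\<close> enters the slice on the left, where it is
  conjugated.\<close>

definition form :: "(('a \<Rightarrow> 'a) \<Rightarrow> 'a \<Rightarrow> 'a) \<Rightarrow> ('h \<Rightarrow> 'h) \<Rightarrow> 'a \<times> 'h \<Rightarrow> 'a \<times> 'h \<Rightarrow> complex" where
  "form \<phi> x s t = ip A (\<phi> (slice (snd t) (snd s) x) (fst s)) (fst t)"

text \<open>The slices of a positive matrix on \<open>T\<close> form a positive matrix over the
  algebra of the factor, indexed by row and elementary tensor; complete positivity of
  \<open>\<phi>\<close> is used at that larger size.\<close>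

lemma form_positive:
  assumes cp: "completely_positive A (cstar_gen A gens) A \<phi>"
    and X: "\<And>p q. p < m \<Longrightarrow> q < m \<Longrightarrow> X p q \<in> cstar_gen T S" and pos: "positive_matrix T m X"
    and F: "finite F" "F \<subseteq> carr A \<times> K"
  shows "(\<Sum>p<m. \<Sum>t\<in>F. \<Sum>q<m. \<Sum>s\<in>F. d q s * cnj (d p t) * form \<phi> (X p q) s t) \<in> \<real>\<^sub>\<ge>\<^sub>0"
proof -
  let ?J = "{..<m} \<times> F"
  define a where "a i j = slice (snd (snd i)) (snd (snd j)) (X (fst i) (fst j))" for i j :: "nat \<times> 'a \<times> 'h"
  define y where "y i = d (fst i) (snd i) *\<^sub>C fst (snd i)" for i :: "nat \<times> 'a \<times> 'h"
  have FA: "fst s \<in> carr A" "snd s \<in> K" if "s \<in> F" for s using F(2) that by auto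
  have a: "a i j \<in> cstar_gen A gens" if "i \<in> ?J" "j \<in> ?J" for i j
    using that FA X unfolding a_def by (intro slice_CT) auto
  have \<phi>b: "\<phi> b \<in> bop A A" if "b \<in> cstar_gen A gens" for b
    using cp_linear[OF cp] that by (simp add: linear_into_bop_def)
  have "(\<Sum>i\<in>?J. \<Sum>j\<in>?J. ip A (\<phi> (a i j) (y j)) (y i)) \<in> \<real>\<^sub>\<ge>\<^sub>0"
  proof (rule cp_positive_kernel[OF cp])
    fix x :: "nat \<times> 'a \<times> 'h \<Rightarrow> 'a" assume x: "\<And>i. i \<in> ?J \<Longrightarrow> x i \<in> carr A"
    \<comment> \<open>Testing the slices at the vectors \<open>x (p, s)\<close> amounts to testing
      \<open>X\<close> at these sums of elementary tensors.\<close>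
    define Y where "Y p = (\<Sum>s\<in>F. w (x (p, s)) (snd s))" for p
    have wT: "w (x (p, s)) (snd s) \<in> carr T" if "p < m" "s \<in> F" for p s
      using x[of "(p, s)"] FA that by simp
    have Y: "Y p \<in> carr T" if "p < m" for p unfolding Y_def using wT that by (intro T.sum_in) auto
    have XY: "ip T (X p q (Y q)) (Y p) = (\<Sum>t\<in>F. \<Sum>s\<in>F. ip A (a (p, t) (q, s) (x (q, s))) (x (p, t)))"
      if pq: "p < m" "q < m" for p q
    proof -
      note Xb = CT_bop[OF X[OF pq]]
      have Xw: "X p q (w (x (q, s)) (snd s)) \<in> carr T" if "s \<in> F" for s using bop_in[OF Xb wT[OF pq(2) that]] .
      have "ip T (X p q (Y q)) (Y p) = (\<Sum>t\<in>F. ip T (X p q (Y q)) (w (x (p, t)) (snd t)))"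
        unfolding Y_def[of p] using wT pq bop_in[OF Xb Y[OF pq(2)]] by (intro T.ip_sum_right) auto
      also have "\<dots> = (\<Sum>t\<in>F. \<Sum>s\<in>F. ip T (X p q (w (x (q, s)) (snd s))) (w (x (p, t)) (snd t)))"
      proof (intro sum.cong refl)
        fix t assume t: "t \<in> F"
        have "X p q (Y q) = (\<Sum>s\<in>F. X p q (w (x (q, s)) (snd s)))"
          unfolding Y_def using wT pq by (intro bop_sum[OF T Xb]) auto
        then show "ip T (X p q (Y q)) (w (x (p, t)) (snd t)) = (\<Sum>s\<in>F. ip T (X p q (w (x (q, s)) (snd s))) (w (x (p, t)) (snd t)))"
          using Xw wT[OF pq(1) t] by (simp add: T.ip_sum_left)
      qed
      also have "\<dots> = (\<Sum>t\<in>F. \<Sum>s\<in>F. ip A (a (p, t) (q, s) (x (q, s))) (x (p, t)))"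
        using x FA pq by (intro sum.cong refl) (simp add: a_def slice_ip[OF _ _ Xb])
      finally show ?thesis .
    qed
    have "(\<Sum>i\<in>?J. \<Sum>j\<in>?J. ip A (a i j (x j)) (x i))
        = (\<Sum>p<m. \<Sum>t\<in>F. \<Sum>q<m. \<Sum>s\<in>F. ip A (a (p, t) (q, s) (x (q, s))) (x (p, t)))"
      by (simp add: sum.cartesian_product' case_prod_beta)
    also have "\<dots> = (\<Sum>p<m. \<Sum>q<m. \<Sum>t\<in>F. \<Sum>s\<in>F. ip A (a (p, t) (q, s) (x (q, s))) (x (p, t)))"
      by (intro sum.cong refl sum.swap)
    also have "\<dots> = (\<Sum>p<m. \<Sum>q<m. ip T (X p q (Y q)) (Y p))" using XY by simp
    also have "\<dots> \<in> \<real>\<^sub>\<ge>\<^sub>0" using pos Y by (simp add: positive_matrix_def)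
    finally show "(\<Sum>i\<in>?J. \<Sum>j\<in>?J. ip A (a i j (x j)) (x i)) \<in> \<real>\<^sub>\<ge>\<^sub>0" .
  qed (use F a FA in \<open>auto simp: y_def\<close>)
  also have "(\<Sum>i\<in>?J. \<Sum>j\<in>?J. ip A (\<phi> (a i j) (y j)) (y i))
    = (\<Sum>i\<in>?J. \<Sum>j\<in>?J. d (fst j) (snd j) * cnj (d (fst i) (snd i)) * form \<phi> (X (fst i) (fst j)) (snd j) (snd i))"
  proof (intro sum.cong refl)
    fix i j assume ij: "i \<in> ?J" "j \<in> ?J"
    have "fst (snd j) \<in> carr A" "fst (snd i) \<in> carr A" using ij FA by auto
    then show "ip A (\<phi> (a i j) (y j)) (y i) = d (fst j) (snd j) * cnj (d (fst i) (snd i)) * form \<phi> (X (fst i) (fst j)) (snd j) (snd i)"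
      using bop_in[OF \<phi>b[OF a[OF ij]]]
      by (simp add: y_def form_def a_def[symmetric] bop_scale[OF \<phi>b[OF a[OF ij]]] A.ip_scale A.ip_scale_right)
  qed
  also have "\<dots> = (\<Sum>p<m. \<Sum>t\<in>F. \<Sum>q<m. \<Sum>s\<in>F. d q s * cnj (d p t) * form \<phi> (X p q) s t)"
    by (simp add: sum.cartesian_product' case_prod_beta)
  finally show ?thesis .
qed

text \<open>This is \<open>form_positive\<close> for the block matrix of \<open>x\<close>; the
  diagonal blocks reproduce the inner product of \<open>T\<close> because \<open>\<phi>\<close> is
  unital.\<close>

lemma form_bound:
  assumes cp: "completely_positive A (cstar_gen A gens) A \<phi>" and unital: "\<phi> (idop A) = idop A"
    and x: "x \<in> cstar_gen T S" and F: "finite F" "F \<subseteq> carr A \<times> K"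
  shows "cmod (\<Sum>s\<in>F. \<Sum>t\<in>F. g s * cnj (h t) * form \<phi> x s t)
     \<le> opnorm T T x * hnorm T (\<Sum>s\<in>F. g s *\<^sub>C w (fst s) (snd s)) * hnorm T (\<Sum>t\<in>F. h t *\<^sub>C w (fst t) (snd t))"
proof -
  let ?M = "opnorm T T x"
  note xb = CT_bop[OF x]
  have M0: "0 \<le> ?M" by (rule opnorm_ge_0[OF T T xb])
  have FA: "fst s \<in> carr A" "snd s \<in> K" if "s \<in> F" for s using F(2) that by auto
  define Y where "Y k = (\<Sum>s\<in>F. k s *\<^sub>C w (fst s) (snd s))" for k :: "'a \<times> 'h \<Rightarrow> complex"
  have Y: "Y k \<in> carr T" for k unfolding Y_def using FA by (intro T.sum_in T.scale_in) auto
  define \<alpha> where "\<alpha> = (\<Sum>s\<in>F. \<Sum>t\<in>F. g s * cnj (h t) * form \<phi> x s t)"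
  define \<beta> where "\<beta> = (\<Sum>s\<in>F. \<Sum>t\<in>F. h s * cnj (g t) * form \<phi> (adj T T x) s t)"
  have diag: "(\<Sum>t\<in>F. \<Sum>s\<in>F. k s * cnj (k t) * form \<phi> (of_real ?M *\<^sub>C idop T) s t) = of_real (?M * (hnorm T (Y k))\<^sup>2)" for k
  proof -
    have \<phi>id: "\<phi> (z *\<^sub>C idop A) = z *\<^sub>C idop A" for z
      using cp_linear[OF cp] idA_CA unital by (simp add: linear_into_bop_def)
    have "form \<phi> (of_real ?M *\<^sub>C idop T) s t = of_real ?M * ip T (w (fst s) (snd s)) (w (fst t) (snd t))" if "s \<in> F" "t \<in> F" for s t
      using FA[OF that(1)] FA[OF that(2)]
      by (simp add: form_def slice_scale bop_idop T slice_id scaleC_scaleC \<phi>id scaleC_apply idop_eq A.ip_scale w_ip)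
    then have "(\<Sum>t\<in>F. \<Sum>s\<in>F. k s * cnj (k t) * form \<phi> (of_real ?M *\<^sub>C idop T) s t)
       = (\<Sum>t\<in>F. \<Sum>s\<in>F. of_real ?M * (k s * cnj (k t) * ip T (w (fst s) (snd s)) (w (fst t) (snd t))))"
      by (intro sum.cong refl) (simp add: mult_ac)
    also have "\<dots> = of_real ?M * (\<Sum>s\<in>F. \<Sum>t\<in>F. k s * cnj (k t) * ip T (w (fst s) (snd s)) (w (fst t) (snd t)))"
      by (subst sum.swap) (simp add: sum_distrib_left)
    also have "(\<Sum>s\<in>F. \<Sum>t\<in>F. k s * cnj (k t) * ip T (w (fst s) (snd s)) (w (fst t) (snd t))) = ip T (Y k) (Y k)"
      unfolding Y_def using FA by (intro T.ip_lincomb[symmetric]) auto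
    finally show ?thesis using Y by (simp add: T.ip_self)
  qed
  have "complex_of_real (?M * (hnorm T (Y h))\<^sup>2) + of_real ((cmod z)\<^sup>2) * of_real (?M * (hnorm T (Y g))\<^sup>2) + z * \<alpha> + cnj z * \<beta> \<in> \<real>\<^sub>\<ge>\<^sub>0" for z
  proof -
    \<comment> \<open>With \<open>h\<close> in the first row and \<open>z\<close> times
      \<open>g\<close> in the second, the coefficient of \<open>z\<close> is the sum to be
      estimated.\<close>
    define d where "d p s = (if p = 0 then h s else z * g s)" for p :: nat and s
    have d0: "d 0 = h" and d1: "d 1 = (\<lambda>s. z * g s)" by (simp_all add: d_def fun_eq_iff)
    let ?B = "bound_block T ?M x"
    have "?B p q \<in> cstar_gen T S" for p q
      using complex_vector.subspace_scale[OF banach_algebra_subspace[OF CT_algebra] idT_CT] x cstar_adj[OF CT_cstar x]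
      by (simp add: bound_block_def)
    then have pos: "(\<Sum>p<2. \<Sum>t\<in>F. \<Sum>q<2. \<Sum>s\<in>F. d q s * cnj (d p t) * form \<phi> (?B p q) s t) \<in> \<real>\<^sub>\<ge>\<^sub>0"
      by (intro form_positive[OF cp _ bound_block_positive[OF T xb] F])
    have B: "?B 0 0 = of_real ?M *\<^sub>C idop T" "?B 1 1 = of_real ?M *\<^sub>C idop T" "?B 0 1 = x" "?B 1 0 = adj T T x"
      by (simp_all add: bound_block_def)
    have YG: "Y (\<lambda>s. z * g s) = z *\<^sub>C Y g"
      by (simp add: Y_def complex_vector.scale_sum_right scaleC_scaleC)
    have sum2: "(\<Sum>p<2. f p) = f 0 + f 1" for f :: "nat \<Rightarrow> complex" by (simp add: numeral_2_eq_2)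
    have "(\<Sum>p<2. \<Sum>t\<in>F. \<Sum>q<2. \<Sum>s\<in>F. d q s * cnj (d p t) * form \<phi> (?B p q) s t) =
       (\<Sum>t\<in>F. \<Sum>s\<in>F. h s * cnj (h t) * form \<phi> (of_real ?M *\<^sub>C idop T) s t)
       + (\<Sum>t\<in>F. \<Sum>s\<in>F. (z * g s) * cnj (z * g t) * form \<phi> (of_real ?M *\<^sub>C idop T) s t)
       + (\<Sum>t\<in>F. \<Sum>s\<in>F. (z * g s) * cnj (h t) * form \<phi> x s t)
       + (\<Sum>t\<in>F. \<Sum>s\<in>F. h s * cnj (z * g t) * form \<phi> (adj T T x) s t)"
      unfolding sum2 sum.distrib B d0 d1 by (simp only: add_ac)
    also have "(\<Sum>t\<in>F. \<Sum>s\<in>F. (z * g s) * cnj (h t) * form \<phi> x s t) = z * \<alpha>"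
      unfolding \<alpha>_def by (subst sum.swap) (simp add: sum_distrib_left mult.assoc)
    also have "(\<Sum>t\<in>F. \<Sum>s\<in>F. h s * cnj (z * g t) * form \<phi> (adj T T x) s t) = cnj z * \<beta>"
      unfolding \<beta>_def by (subst sum.swap) (simp add: sum_distrib_left mult_ac)
    finally show ?thesis using pos Y unfolding diag YG
      by (simp add: T.hnorm_scale power_mult_distrib mult_ac)
  qed
  from nonneg_form_bound[OF this] have "(cmod \<alpha>)\<^sup>2 \<le> (?M * hnorm T (Y g) * hnorm T (Y h))\<^sup>2"
    by (simp add: power_mult_distrib power2_eq_square mult_ac)
  then have "cmod \<alpha> \<le> ?M * hnorm T (Y g) * hnorm T (Y h)"
    using M0 Y by (intro power2_le_imp_le[of "cmod \<alpha>"]) auto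
  then show ?thesis by (simp add: \<alpha>_def Y_def)
qed

lemma span_w_common:
  fixes m :: nat
  assumes "\<And>i. i < m \<Longrightarrow> x i \<in> complex_vector.span ((\<lambda>(u, \<xi>). w u \<xi>) ` (carr A \<times> K))"
  shows "\<exists>F d. finite F \<and> F \<subseteq> carr A \<times> K \<and> (\<forall>i<m. x i = (\<Sum>s\<in>F. d i s *\<^sub>C w (fst s) (snd s)))"
proof -
  let ?g = "\<lambda>(u, \<xi>). w u \<xi>"
  have "\<exists>F c. finite F \<and> F \<subseteq> carr A \<times> K \<and> (\<forall>i\<in>{..<m}. x i = (\<Sum>s\<in>F. c i s *\<^sub>C ?g s))"
    by (rule span_image_common) (use assms in simp_all)
  then show ?thesis by (simp add: case_prod_beta Ball_def)
qed

text \<open>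
  A completely positive map on \<open>C\<^sup>*(c)\<close> fixing \<open>B(c)\<close> is amplified slice by slice to one that
  fixes \<open>B(S)\<close>.
\<close>

lemma unique_extension_descends:
  assumes T0: "carr T \<noteq> {0}" and uniq: "unique_cp_extension T S"
  shows "unique_cp_extension A gens"
  unfolding unique_cp_extension_def
proof (intro allI impI ballI, elim conjE)
  fix \<phi> a
  assume cp: "completely_positive A (cstar_gen A gens) A \<phi>" and fix_B': "\<forall>b\<in>banach_gen A gens. \<phi> b = b"
    and a: "a \<in> cstar_gen A gens"
  have fix_B: "\<phi> b = b" if "b \<in> banach_gen A gens" for b using fix_B' that by blast
  let ?C = "cstar_gen T S" and ?g = "\<lambda>s. w (fst s) (snd s)" and ?E = "carr A \<times> K"
  have unital: "\<phi> (idop A) = idop A" using fix_B idA_BA by blast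
  have gE: "(\<lambda>(u, \<xi>). w u \<xi>) ` ?E = ?g ` ?E" by (simp add: case_prod_beta)
  have gT: "?g ` ?E \<subseteq> carr T" and tot: "closed_cspan T (?g ` ?E) = carr T"
    using w_image w_total by (simp_all only: gE)
  have ex: "\<exists>y\<in>bop T T. \<forall>s\<in>?E. \<forall>t\<in>?E. ip T (y (?g s)) (?g t) = form \<phi> x s t" if x: "x \<in> ?C" for x
    by (rule bop_of_bounded_kernel[OF T gT tot form_bound[OF cp unital x]])
  define amp where "amp x y \<longleftrightarrow> y \<in> bop T T \<and> (\<forall>s\<in>?E. \<forall>t\<in>?E. ip T (y (?g s)) (?g t) = form \<phi> x s t)" for x y
  \<comment> \<open>A choice in form only: the coefficients determine the operator, and
    \<open>\<Phi>I\<close> derives linearity of \<open>\<Phi>\<close> from this.\<close>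
  define \<Phi> where "\<Phi> x = (SOME y. amp x y)" for x
  have "amp x (\<Phi> x)" if "x \<in> ?C" for x
    unfolding \<Phi>_def by (rule someI_ex[of "amp x"]) (use ex[OF that] in \<open>unfold amp_def, blast\<close>)
  then have \<Phi>b: "\<Phi> x \<in> bop T T" and \<Phi>: "\<And>s t. s \<in> ?E \<Longrightarrow> t \<in> ?E \<Longrightarrow> ip T (\<Phi> x (?g s)) (?g t) = form \<phi> x s t" if "x \<in> ?C" for x
    using that unfolding amp_def by blast+
  have \<Phi>I: "\<Phi> x = y" if x: "x \<in> ?C" and y: "y \<in> bop T T" and eq: "\<And>s t. s \<in> ?E \<Longrightarrow> t \<in> ?E \<Longrightarrow> ip T (y (?g s)) (?g t) = form \<phi> x s t" for x y
    by (rule bop_eqI_ip[OF T T \<Phi>b[OF x] y gT tot gT tot]) (use \<Phi>[OF x] eq in auto)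
  have gin: "?g s \<in> carr T" if "s \<in> ?E" for s using gT that by blast
  have \<phi>lin: "linear_into_bop (cstar_gen A gens) A \<phi>" by (rule cp_linear[OF cp])
  have \<phi>b: "\<phi> b \<in> bop A A" if "b \<in> cstar_gen A gens" for b using \<phi>lin that by (simp add: linear_into_bop_def)
  have sl: "slice (snd t) (snd s) x \<in> cstar_gen A gens" if "s \<in> ?E" "t \<in> ?E" "x \<in> ?C" for s t x
    using that by (intro slice_CT) auto
  have "\<Phi> (x + y) = \<Phi> x + \<Phi> y" if xy: "x \<in> ?C" "y \<in> ?C" for x y
  proof (rule \<Phi>I)
    show "x + y \<in> ?C" using xy by (intro complex_vector.subspace_add[OF banach_algebra_subspace[OF CT_algebra]])
    show "\<Phi> x + \<Phi> y \<in> bop T T" using xy by (intro bop_plus T \<Phi>b)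
    fix s t assume st: "s \<in> ?E" "t \<in> ?E"
    have "slice (snd t) (snd s) (x + y) = slice (snd t) (snd s) x + slice (snd t) (snd s) y"
      using st xy by (intro slice_add CT_bop) auto
    then have "form \<phi> (x + y) s t = form \<phi> x s t + form \<phi> y s t"
      using \<phi>lin sl[OF st xy(1)] sl[OF st xy(2)] st bop_in[OF \<phi>b[OF sl[OF st xy(1)]]] bop_in[OF \<phi>b[OF sl[OF st xy(2)]]]
      by (auto simp: form_def linear_into_bop_def A.ip_add)
    then show "ip T ((\<Phi> x + \<Phi> y) (?g s)) (?g t) = form \<phi> (x + y) s t"
      using \<Phi>[OF xy(1) st] \<Phi>[OF xy(2) st] bop_in[OF \<Phi>b[OF xy(1)] gin[OF st(1)]] bop_in[OF \<Phi>b[OF xy(2)] gin[OF st(1)]] gin[OF st(2)]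
      by (simp add: T.ip_add)
  qed
  moreover have "\<Phi> (k *\<^sub>C x) = k *\<^sub>C \<Phi> x" if x: "x \<in> ?C" for k x
  proof (rule \<Phi>I)
    show "k *\<^sub>C x \<in> ?C" using x by (intro complex_vector.subspace_scale[OF banach_algebra_subspace[OF CT_algebra]])
    show "k *\<^sub>C \<Phi> x \<in> bop T T" using x by (intro bop_scaleC T \<Phi>b)
    fix s t assume st: "s \<in> ?E" "t \<in> ?E"
    have "slice (snd t) (snd s) (k *\<^sub>C x) = k *\<^sub>C slice (snd t) (snd s) x"
      using st x by (intro slice_scale CT_bop) auto
    then have "form \<phi> (k *\<^sub>C x) s t = k * form \<phi> x s t"
      using \<phi>lin sl[OF st x] st bop_in[OF \<phi>b[OF sl[OF st x]]]
      by (auto simp: form_def linear_into_bop_def A.ip_scale scaleC_apply)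
    then show "ip T ((k *\<^sub>C \<Phi> x) (?g s)) (?g t) = form \<phi> (k *\<^sub>C x) s t"
      using \<Phi>[OF x st] bop_in[OF \<Phi>b[OF x] gin[OF st(1)]] gin[OF st(2)] by (simp add: T.ip_scale scaleC_apply)
  qed
  moreover have "positive_matrix T m (\<lambda>i j. \<Phi> (X i j))"
    if X: "\<And>i j. i < m \<Longrightarrow> j < m \<Longrightarrow> X i j \<in> ?C" and pos: "positive_matrix T m X" for m X
  proof (rule positive_matrix_dense[OF T _ w_image w_total])
    fix x assume "\<And>i. i < m \<Longrightarrow> x i \<in> complex_vector.span ((\<lambda>(u, \<xi>). w u \<xi>) ` ?E)"
    then obtain F d where F: "finite F" "F \<subseteq> ?E" "\<And>i. i < m \<Longrightarrow> x i = (\<Sum>s\<in>F. d i s *\<^sub>C ?g s)"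
      using span_w_common[of m x] by blast
    have FE: "s \<in> ?E" if "s \<in> F" for s using F(2) that by blast
    have "ip T (\<Phi> (X i j) (x j)) (x i) = (\<Sum>s\<in>F. \<Sum>t\<in>F. d j s * cnj (d i t) * form \<phi> (X i j) s t)" if ij: "i < m" "j < m" for i j
    proof -
      note \<Phi>X = \<Phi>b[OF X[OF ij]]
      have "\<Phi> (X i j) (x j) = (\<Sum>s\<in>F. d j s *\<^sub>C \<Phi> (X i j) (?g s))"
        unfolding F(3)[OF ij(2)] using gin[OF FE] by (subst bop_sum[OF T \<Phi>X]) (auto simp: bop_scale[OF \<Phi>X] simp del: w_in_K)
      then have "ip T (\<Phi> (X i j) (x j)) (x i) = (\<Sum>s\<in>F. \<Sum>t\<in>F. d j s * cnj (d i t) * ip T (\<Phi> (X i j) (?g s)) (?g t))"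
        unfolding F(3)[OF ij(1)] using gin[OF FE] bop_in[OF \<Phi>X gin[OF FE]] by (simp only: T.ip_lincomb)
      also have "\<dots> = (\<Sum>s\<in>F. \<Sum>t\<in>F. d j s * cnj (d i t) * form \<phi> (X i j) s t)"
        by (intro sum.cong refl) (simp only: \<Phi>[OF X[OF ij] FE FE])
      finally show ?thesis .
    qed
    then have "(\<Sum>i<m. \<Sum>j<m. ip T (\<Phi> (X i j) (x j)) (x i))
       = (\<Sum>i<m. \<Sum>j<m. \<Sum>t\<in>F. \<Sum>s\<in>F. d j s * cnj (d i t) * form \<phi> (X i j) s t)"
      by (auto intro!: sum.cong sum.swap)
    also have "\<dots> = (\<Sum>i<m. \<Sum>t\<in>F. \<Sum>j<m. \<Sum>s\<in>F. d j s * cnj (d i t) * form \<phi> (X i j) s t)"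
      by (intro sum.cong refl sum.swap)
    also have "\<dots> \<in> \<real>\<^sub>\<ge>\<^sub>0" by (rule form_positive[OF cp X pos F(1,2)])
    finally show "(\<Sum>i<m. \<Sum>j<m. ip T (\<Phi> (X i j) (x j)) (x i)) \<in> \<real>\<^sub>\<ge>\<^sub>0" .
  qed (use X \<Phi>b in auto)
  ultimately have cp\<Phi>: "completely_positive T ?C T \<Phi>"
    using \<Phi>b unfolding completely_positive_def linear_into_bop_def by blast
  have BC: "x \<in> ?C" if "x \<in> banach_gen T S" for x
    using banach_gen_min[OF CT_algebra cstar_gen_incl] that by blast
  \<comment> \<open>Slices of \<open>x\<close> lie where \<open>\<phi>\<close> is the identity, so
    \<open>\<Phi> x\<close> has the coefficients of \<open>x\<close>.\<close>
  have "\<Phi> x = x" if x: "x \<in> banach_gen T S" for x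
  proof (rule \<Phi>I[OF BC[OF x] BT_bop[OF x]])
    fix s t assume st: "s \<in> ?E" "t \<in> ?E"
    then show "ip T (x (?g s)) (?g t) = form \<phi> x s t"
      using fix_B[OF slice_BT[OF x]] slice_ip[OF _ _ BT_bop[OF x]] by (auto simp: form_def)
  qed
  then have \<Phi>l: "\<Phi> (l a) = l a" using uniq cp\<Phi> l_CA[OF a] unfolding unique_cp_extension_def by blast
  obtain \<xi> where \<xi>: "\<xi> \<in> K" "hnorm T \<xi> = 1" using K_unit[OF T0] .
  \<comment> \<open>For a unit vector \<open>\<xi>\<close> slicing undoes the embedding
    \<open>l\<close>, so \<open>\<phi> a\<close> can be read off from
    \<open>\<Phi> (l a)\<close>.\<close>
  have sla: "slice \<xi> \<xi> (l a) = a" using \<xi> T.ip_self[of \<xi>] CA_bop[OF a] by (simp add: slice_l K_carr scaleC_one)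
  show "\<phi> a = a"
  proof (rule bop_eqI_ip'[OF A A \<phi>b[OF a] CA_bop[OF a]])
    fix u v assume uv: "u \<in> carr A" "v \<in> carr A"
    have "ip A (\<phi> a u) v = ip T (l a (w u \<xi>)) (w v \<xi>)"
      using \<Phi>[OF l_CA[OF a], of "(u, \<xi>)" "(v, \<xi>)"] uv \<xi> by (simp add: form_def sla \<Phi>l)
    also have "\<dots> = ip A (a u) v" using slice_ip[OF \<xi>(1) \<xi>(1) l_bop[OF CA_bop[OF a]] uv] by (simp add: sla)
    finally show "ip A (\<phi> a u) v = ip A (a u) v" .
  qed
qed

text \<open>
  Conversely the slices \<open>a \<mapsto> slice \<xi> \<xi> (\<Phi> (l a))\<close> fix \<open>B(c)\<close> up to a scalar; polarization recovers
  \<open>\<Phi> (l a)\<close> from them.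
\<close>

lemma unique_extension_lifts:
  assumes uniq: "unique_cp_extension A gens"
    and cp: "completely_positive T (cstar_gen T S) T \<Phi>" and fix_B: "\<And>x. x \<in> banach_gen T S \<Longrightarrow> \<Phi> x = x"
    and a: "a \<in> cstar_gen A gens"
  shows "\<Phi> (l a) = l a"
proof -
  have lin: "linear_into_bop (cstar_gen T S) T \<Phi>" by (rule cp_linear[OF cp])
  have \<Phi>b: "\<Phi> (l b) \<in> bop T T" if "b \<in> cstar_gen A gens" for b using lin l_CA[OF that] by (simp add: linear_into_bop_def)
  have unit: "slice \<xi> \<xi> (\<Phi> (l a)) = a" if \<xi>: "\<xi> \<in> K" "hnorm T \<xi> = 1" for \<xi>
  proof -
    have \<xi>\<xi>: "ip T \<xi> \<xi> = 1" using T.ip_self[OF K_carr[OF \<xi>(1)]] \<xi> by simp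
    have "slice \<xi> \<xi> (\<Phi> (l b)) = b" if "b \<in> banach_gen A gens" for b
      using fix_B[OF l_BA[OF that]] BA_bop[OF that] \<xi> by (simp add: slice_l \<xi>\<xi> scaleC_one)
    \<comment> \<open>The map is composed of \<open>l\<close>, positive on matrices by
      \<open>l_positive\<close>, of \<open>\<Phi>\<close>, and of compression by
      \<open>W \<xi>\<close>.\<close>
    moreover have "completely_positive A (cstar_gen A gens) A (\<lambda>b. slice \<xi> \<xi> (\<Phi> (l b)))"
      unfolding completely_positive_def
    proof (intro conjI allI impI)
      show "linear_into_bop (cstar_gen A gens) A (\<lambda>b. slice \<xi> \<xi> (\<Phi> (l b)))"
        using lin l_CA \<Phi>b \<xi> by (auto simp: linear_into_bop_def slice_bop CA_bop l_add l_scale slice_add slice_scale)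
      fix m and b :: "nat \<Rightarrow> nat \<Rightarrow> 'a \<Rightarrow> 'a"
      assume "(\<forall>i<m. \<forall>j<m. b i j \<in> cstar_gen A gens) \<and> positive_matrix A m b"
      then have b: "\<And>i j. i < m \<Longrightarrow> j < m \<Longrightarrow> b i j \<in> cstar_gen A gens" and pos: "positive_matrix A m b" by auto
      have "positive_matrix T m (\<lambda>i j. \<Phi> (l (b i j)))"
        by (intro cp_matrix[OF cp] l_positive pos l_CA CA_bop b)
      then show "positive_matrix A m (\<lambda>i j. slice \<xi> \<xi> (\<Phi> (l (b i j))))"
        using b \<Phi>b \<xi> by (simp add: positive_matrix_def slice_ip)
    qed
    ultimately show ?thesis using a uniq[unfolded unique_cp_extension_def, rule_format, of "\<lambda>b. slice \<xi> \<xi> (\<Phi> (l b))" a] by blast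
  qed
  \<comment> \<open>The discrepancy of matrix coefficients, linear in \<open>\<eta>\<close> and
    conjugate linear in \<open>\<xi>\<close>; it vanishes for equal vectors and is polarized with
    the factors 1 and \<i>.\<close>
  define D where "D \<xi> \<eta> u v = ip T (\<Phi> (l a) (w u \<eta>)) (w v \<xi>) - ip T (l a (w u \<eta>)) (w v \<xi>)" for \<xi> \<eta> u v
  note Lb = l_bop[OF CA_bop[OF a]]
  note ops = bop_in[OF \<Phi>b[OF a]] bop_in[OF Lb] bop_add[OF \<Phi>b[OF a]] bop_add[OF Lb] bop_scale[OF \<Phi>b[OF a]] bop_scale[OF Lb]
  have diag: "D \<xi> \<xi> u v = 0" if \<xi>: "\<xi> \<in> K" and uv: "u \<in> carr A" "v \<in> carr A" for \<xi> u v
  proof (cases "\<xi> = 0")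
    case True then show ?thesis using uv by (simp add: D_def bop_zero[OF T \<Phi>b[OF a]] bop_zero[OF T Lb])
  next
    case False
    then have n: "hnorm T \<xi> > 0" using T.hnorm_eq_0[of \<xi>] T.hnorm_ge_0[of \<xi>] K_carr[OF \<xi>] by linarith
    define \<zeta> where "\<zeta> = of_real (1 / hnorm T \<xi>) *\<^sub>C \<xi>"
    have \<zeta>: "\<zeta> \<in> K" "hnorm T \<zeta> = 1" using \<xi> n by (auto simp: \<zeta>_def K_scale T.hnorm_scale K_carr norm_divide)
    have \<xi>\<zeta>: "\<xi> = of_real (hnorm T \<xi>) *\<^sub>C \<zeta>" using n by (simp add: \<zeta>_def scaleC_scaleC scaleC_one)
    have \<zeta>\<zeta>: "ip T \<zeta> \<zeta> = 1" using T.ip_self[OF K_carr[OF \<zeta>(1)]] \<zeta> by simp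
    have "slice \<zeta> \<zeta> (\<Phi> (l a)) = slice \<zeta> \<zeta> (l a)"
      using unit[OF \<zeta>] \<zeta> CA_bop[OF a] by (simp add: slice_l \<zeta>\<zeta> scaleC_one)
    then have "D \<zeta> \<zeta> u v = 0"
      using slice_ip[OF \<zeta>(1) \<zeta>(1) \<Phi>b[OF a] uv] slice_ip[OF \<zeta>(1) \<zeta>(1) Lb uv] by (simp add: D_def)
    moreover have "D \<xi> \<xi> u v = (of_real (hnorm T \<xi>))\<^sup>2 * D \<zeta> \<zeta> u v"
      unfolding D_def by (subst (1 2 3 4) \<xi>\<zeta>)
        (use uv \<zeta> in \<open>simp add: w_scale_right ops T.ip_scale T.ip_scale_right power2_eq_square algebra_simps\<close>)
    ultimately show ?thesis by simp
  qed
  have D0: "D \<xi> \<eta> u v = 0" if \<xi>: "\<xi> \<in> K" "\<eta> \<in> K" and uv: "u \<in> carr A" "v \<in> carr A" for \<xi> \<eta> u v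
  proof -
    have expand: "D (\<xi> + z *\<^sub>C \<eta>) (\<xi> + z *\<^sub>C \<eta>) u v = D \<xi> \<xi> u v + z * D \<xi> \<eta> u v + cnj z * D \<eta> \<xi> u v + (z * cnj z) * D \<eta> \<eta> u v" for z
      using \<xi> uv unfolding D_def
      by (simp add: w_add_right w_scale_right K_scale ops T.ip_add T.ip_add_right T.ip_scale T.ip_scale_right)
        (simp add: algebra_simps)
    have "z * D \<xi> \<eta> u v + cnj z * D \<eta> \<xi> u v = 0" for z
      using expand[of z] diag[OF K_add[OF \<xi>(1) K_scale[OF \<xi>(2)]] uv, of z] diag[OF \<xi>(1) uv] diag[OF \<xi>(2) uv] by simp
    from this[of 1] this[of \<i>] have 1: "D \<xi> \<eta> u v + D \<eta> \<xi> u v = 0" and 2: "\<i> * (D \<xi> \<eta> u v - D \<eta> \<xi> u v) = 0"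
      by (simp_all add: algebra_simps)
    from 2 have "D \<xi> \<eta> u v = D \<eta> \<xi> u v" by simp
    with 1 have "2 * D \<xi> \<eta> u v = 0" by simp
    then show ?thesis by simp
  qed
  show ?thesis
  proof (rule slice_eqI[OF \<Phi>b[OF a] Lb])
    fix \<xi> \<eta> assume \<xi>: "\<xi> \<in> K" "\<eta> \<in> K"
    show "slice \<xi> \<eta> (\<Phi> (l a)) = slice \<xi> \<eta> (l a)"
      by (rule eq_by_slice_ip[OF \<xi> \<Phi>b[OF a] slice_bop[OF \<xi> Lb]])
        (use D0[OF \<xi>] in \<open>simp add: D_def slice_ip[OF \<xi> Lb]\<close>)
  qed
qed

text \<open>With \<open>P\<close> the projection onto an invariant \<open>V\<close>, the operator
  \<open>l P\<close> commutes with all of \<open>cstar_gen T S\<close>, so its fixed vectors form an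
  invariant subspace of \<open>T\<close>. A unit vector \<open>\<xi>\<close> in \<open>K\<close>
  carries the alternative back to \<open>V\<close>.\<close>

lemma irreducible_descends:
  assumes T0: "carr T \<noteq> {0}" and irr: "acts_irreducibly T (cstar_gen T S)"
  shows "acts_irreducibly A (cstar_gen A gens)"
  unfolding acts_irreducibly_def
proof (intro allI impI, elim conjE)
  fix V assume V: "closed_csubspace A V" and inv: "\<forall>a\<in>cstar_gen A gens. \<forall>x\<in>V. a x \<in> V"
  define P where "P = proj A V"
  have P: "P \<in> bop A A" unfolding P_def by (rule A.proj_bop[OF V])
  have comm: "a \<circ> P = P \<circ> a" if "a \<in> cstar_gen A gens" for a
    unfolding P_def using inv that CA_bop cstar_adj[OF CA_cstar] by (intro A.proj_commutes[OF V, of "cstar_gen A gens"]) auto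
  note lP = l_bop[OF P]
  let ?E = "{x \<in> bop T T. x \<circ> l P = l P \<circ> x}"
  have "x \<in> ?E \<and> adj T T x \<in> ?E" if x: "x \<in> S" for x
  proof -
    have "x = l c \<or> x \<in> commutant" using x S_sub by blast
    then show ?thesis
    proof
      assume "x = l c"
      moreover have "l b \<circ> l P = l P \<circ> l b" if "b \<in> cstar_gen A gens" for b
        using comm[OF that] l_comp[OF P CA_bop[OF that]] l_comp[OF CA_bop[OF that] P] by simp
      ultimately show ?thesis using c_CA cstar_adj[OF CA_cstar c_CA] c by (simp add: l_bop l_adj[symmetric] adj_bop[OF A A])
    next
      assume "x \<in> commutant"
      then show ?thesis using P by (simp add: commutant_def adj_bop[OF T T])
    qed
  qed
  then have "S \<subseteq> {x \<in> ?E. adj T T x \<in> ?E}" by blast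
  then have "cstar_gen T S \<subseteq> {x \<in> ?E. adj T T x \<in> ?E}"
    by (rule cstar_gen_min[OF banach_algebra_star_part[OF T commutant_banach[OF T lP]]])
  then have CT: "x (l P y) = l P (x y)" if "x \<in> cstar_gen T S" for x y using that 
  proof -
    have "x \<circ> l P = l P \<circ> x" using that \<open>cstar_gen T S \<subseteq> _\<close> by blast
    then show ?thesis by (metis comp_apply)
  qed
  let ?V = "{y \<in> carr T. (idop T - l P) y = 0}"
  have Viff: "y \<in> ?V \<longleftrightarrow> y \<in> carr T \<and> l P y = y" for y by (auto simp: idop_eq)
  have "closed_csubspace T ?V" by (rule kernel_closed[OF T T bop_diff_fun[OF T T bop_idop[OF T] lP]])
  moreover have "x y \<in> ?V" if "x \<in> cstar_gen T S" "y \<in> ?V" for x y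
    using that CT[OF that(1), of y] bop_in[OF CT_bop[OF that(1)]] unfolding Viff by auto
  ultimately have VV: "?V = {0} \<or> ?V = carr T" using irr unfolding acts_irreducibly_def by blast
  obtain \<xi> where \<xi>: "\<xi> \<in> K" "hnorm T \<xi> = 1" using K_unit[OF T0] .
  have w0: "u = 0" if "u \<in> carr A" "w u \<xi> = 0" for u
    using w_norm[OF that(1) \<xi>(1)] that \<xi> A.hnorm_eq_0[OF that(1)] by simp
  have PV: "P v = v \<longleftrightarrow> v \<in> V" if "v \<in> carr A" for v unfolding P_def by (rule A.proj_in_iff[OF V that])
  have lPw: "l P (w u \<xi>) = w (P u) \<xi>" if "u \<in> carr A" for u by (rule l_w[OF P that])
  from VV show "V = {0} \<or> V = carr A"
  proof
    assume V0: "?V = {0}"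
    have "v = 0" if v: "v \<in> V" for v
    proof (rule w0)
      show vA: "v \<in> carr A" using v closed_csubspace_subset[OF V] by blast
      have "w v \<xi> \<in> ?V" unfolding Viff using lPw[OF vA] PV[OF vA] v vA \<xi> by simp
      then show "w v \<xi> = 0" using V0 by blast
    qed
    then show ?thesis using complex_vector.subspace_0[OF closed_csubspace_csubspace[OF V]] by blast
  next
    assume V1: "?V = carr T"
    have "u \<in> V" if u: "u \<in> carr A" for u
    proof -
      have "w u \<xi> \<in> carr T" using u \<xi> by simp
      then have "w u \<xi> \<in> ?V" using V1 by simp
      then have "w (P u) \<xi> = w u \<xi>" unfolding Viff using lPw[OF u] by simp
      then have "w (P u + (-1) *\<^sub>C u) \<xi> = 0"
        using u bop_in[OF P u] w_scale_left[OF u, of "-1" \<xi>] by (subst w_add_left) auto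
      then have "P u + (-1) *\<^sub>C u = 0" using u bop_in[OF P u] by (intro w0) auto
      then show ?thesis using PV[OF u] by simp
    qed
    then show ?thesis using closed_csubspace_subset[OF V] by blast
  qed
qed

text \<open>A scalar slice \<open>z\<close> turns both sides into \<open>z *\<^sub>C b\<close>; the
  scalar may depend on the vectors at which the slice is taken.\<close>

lemma commutes_with_factor:
  assumes irr: "acts_irreducibly A (cstar_gen A gens)"
    and P: "P \<in> bop T T" and comm: "\<And>x. x \<in> cstar_gen T S \<Longrightarrow> x \<circ> P = P \<circ> x" and b: "b \<in> bop A A"
  shows "P \<circ> l b = l b \<circ> P"
proof (rule slice_eqI[OF bop_comp[OF T T T P l_bop[OF b]] bop_comp[OF T T T l_bop[OF b] P]])
  fix \<xi> \<eta> assume \<xi>: "\<xi> \<in> K" "\<eta> \<in> K"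
  let ?R = "slice \<xi> \<eta> P"
  have R: "?R \<in> bop A A" by (rule slice_bop[OF \<xi> P])
  have "\<exists>z. ?R = z *\<^sub>C idop A"
  proof (rule Schur[OF A _ _ irr R])
    fix a assume a: "a \<in> cstar_gen A gens"
    show "a \<circ> ?R = ?R \<circ> a"
      using slice_l_left[OF \<xi> CA_bop[OF a] P] slice_l_right[OF \<xi> CA_bop[OF a] P] comm[OF l_CA[OF a]] by simp
  qed (use CA_bop cstar_adj[OF CA_cstar] in auto)
  then obtain z where z: "?R = z *\<^sub>C idop A" by blast
  show "slice \<xi> \<eta> (P \<circ> l b) = slice \<xi> \<eta> (l b \<circ> P)"
    unfolding slice_l_left[OF \<xi> b P] slice_l_right[OF \<xi> b P] z
    using b by (simp add: comp_scale_left bop_comp_scale_right[OF bop_idop[OF A] b A] A)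
qed

end

section \<open>Tensor products of several factors\<close>

locale tensor_product =
  fixes I :: "'i set" and A :: "'i \<Rightarrow> 'a::complex_vector hspace" and T :: "'h::complex_vector hspace"
    and \<tau> :: "('i \<Rightarrow> 'a) \<Rightarrow> 'h"
  assumes fin: "finite I" and A: "i \<in> I \<Longrightarrow> hilbert (A i)" and tensor: "hilbert_tensor I A T \<tau>"
begin

abbreviation E :: "('i \<Rightarrow> 'a) set" where
  "E \<equiv> \<Pi>\<^sub>E i\<in>I. carr (A i)"

lemma T: "hilbert T"
  and \<tau>_in: "f \<in> E \<Longrightarrow> \<tau> f \<in> carr T"
  and \<tau>_add: "f \<in> E \<Longrightarrow> i \<in> I \<Longrightarrow> x \<in> carr (A i) \<Longrightarrow> y \<in> carr (A i) \<Longrightarrow> \<tau> (f(i := x + y)) = \<tau> (f(i := x)) + \<tau> (f(i := y))"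
  and \<tau>_scale: "f \<in> E \<Longrightarrow> i \<in> I \<Longrightarrow> x \<in> carr (A i) \<Longrightarrow> \<tau> (f(i := k *\<^sub>C x)) = k *\<^sub>C \<tau> (f(i := x))"
  and \<tau>_ip: "f \<in> E \<Longrightarrow> g \<in> E \<Longrightarrow> ip T (\<tau> f) (\<tau> g) = (\<Prod>i\<in>I. ip (A i) (f i) (g i))"
  and \<tau>_total: "closed_cspan T (\<tau> ` E) = carr T"
  using tensor unfolding hilbert_tensor_def by (elim conjE, blast)+

sublocale T: hilbert T by (rule T)

lemma \<tau>_image: "\<tau> ` E \<subseteq> carr T"
  using \<tau>_in by blast

lemma upd_in: "f \<in> E \<Longrightarrow> i \<in> I \<Longrightarrow> x \<in> carr (A i) \<Longrightarrow> f(i := x) \<in> E"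
  by (auto simp: PiE_iff extensional_def)

lemma E_nth: "f \<in> E \<Longrightarrow> i \<in> I \<Longrightarrow> f i \<in> carr (A i)"
  by (auto simp: PiE_iff)

text \<open>What the other factors contribute to an inner product of elementary tensors; it stays
  fixed while the entries at \<open>i\<close> change.\<close>

definition rest_ip :: "'i \<Rightarrow> ('i \<Rightarrow> 'a) \<Rightarrow> ('i \<Rightarrow> 'a) \<Rightarrow> complex" where
  "rest_ip i f g = (\<Prod>j\<in>I - {i}. ip (A j) (f j) (g j))"

lemma \<tau>_upd_ip:
  assumes "f \<in> E" "g \<in> E" "i \<in> I" "x \<in> carr (A i)" "y \<in> carr (A i)"
  shows "ip T (\<tau> (f(i := x))) (\<tau> (g(i := y))) = ip (A i) x y * rest_ip i f g"
proof -
  have "(\<Prod>j\<in>I. ip (A j) ((f(i := x)) j) ((g(i := y)) j)) = ip (A i) x y * (\<Prod>j\<in>I - {i}. ip (A j) ((f(i := x)) j) ((g(i := y)) j))"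
    using assms fin by (subst prod.remove[of _ i]) auto
  also have "(\<Prod>j\<in>I - {i}. ip (A j) ((f(i := x)) j) ((g(i := y)) j)) = rest_ip i f g"
    unfolding rest_ip_def by (intro prod.cong) auto
  finally show ?thesis using assms by (simp add: \<tau>_ip upd_in del: fun_upd_apply)
qed

lemma \<tau>_ip_split:
  assumes "f \<in> E" "g \<in> E" "i \<in> I"
  shows "ip T (\<tau> f) (\<tau> g) = ip (A i) (f i) (g i) * rest_ip i f g"
  using \<tau>_upd_ip[OF assms E_nth[OF assms(1,3)] E_nth[OF assms(2,3)]] by simp

definition amp :: "'i \<Rightarrow> ('a \<Rightarrow> 'a) \<Rightarrow> 'h \<Rightarrow> 'h" where
  "amp i a = tensor_factor_op I A T \<tau> i a"

text \<open>Boundedness: the defect operator \<open>s\<close> turns \<open>M\<^sup>2 \<parallel>x\<parallel>\<^sup>2 - \<parallel>(a \<otimes> 1) x\<parallel>\<^sup>2\<close> into \<open>\<parallel>(s \<otimes> 1) x\<parallel>\<^sup>2\<close>.\<close>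

lemma amp_exists:
  assumes i: "i \<in> I" and a: "a \<in> bop (A i) (A i)"
  shows "\<exists>B\<in>bop T T. \<forall>f\<in>E. B (\<tau> f) = \<tau> (f(i := a (f i)))"
proof -
  define M where "M = opnorm (A i) (A i) a + 1"
  have M: "M > 0" "opnorm (A i) (A i) a \<le> M" using opnorm_ge_0[OF A[OF i] A[OF i] a] by (auto simp: M_def)
  obtain s where s: "s \<in> bop (A i) (A i)"
    and sip: "\<And>u v. u \<in> carr (A i) \<Longrightarrow> v \<in> carr (A i) \<Longrightarrow> ip (A i) (s u) (s v) = of_real (M\<^sup>2) * ip (A i) u v - ip (A i) (a u) (a v)"
    using defect_operator[OF A[OF i] a M] by blast
  let ?t = "\<lambda>a f. \<tau> (f(i := a (f i)))"
  let ?G = "(\<lambda>f. (\<tau> f, ?t a f)) ` E"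
  have t_in: "?t b f \<in> carr T" if "f \<in> E" "b \<in> bop (A i) (A i)" for b f
    by (rule \<tau>_in[OF upd_in[OF that(1) i bop_in[OF that(2) E_nth[OF that(1) i]]]])
  have "\<exists>B\<in>bop T T. (\<forall>(x, y)\<in>?G. B x = y) \<and> (\<forall>x\<in>carr T. hnorm T (B x) \<le> M * hnorm T x)"
  proof (rule bop_extension[OF T T])
    show "?G \<subseteq> carr T \<times> carr T" using \<tau>_in t_in a by auto
    show "closed_cspan T (fst ` ?G) = carr T" using \<tau>_total by (simp add: image_image)
    fix x y assume "(x, y) \<in> complex_vector.span ?G"
    then obtain F k where F: "finite F" "F \<subseteq> E" "(x, y) = (\<Sum>f\<in>F. k f *\<^sub>C (\<tau> f, ?t a f))" by (rule span_imageE)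
    have FE: "f \<in> E" if "f \<in> F" for f using F(2) that by blast
    have x: "x = (\<Sum>f\<in>F. k f *\<^sub>C \<tau> f)" and y: "y = (\<Sum>f\<in>F. k f *\<^sub>C ?t a f)"
      using arg_cong[OF F(3), of fst] arg_cong[OF F(3), of snd] by (simp_all add: fst_sum snd_sum scaleC_prod_def)
    define z where "z = (\<Sum>f\<in>F. k f *\<^sub>C ?t s f)"
    have in_T: "x \<in> carr T" "y \<in> carr T" "z \<in> carr T"
      unfolding x y z_def by (intro T.sum_in T.scale_in \<tau>_in[OF FE] t_in[OF FE a] t_in[OF FE s]; assumption)+
    have "ip T z z = (\<Sum>f\<in>F. \<Sum>g\<in>F. k f * cnj (k g) * ip T (?t s f) (?t s g))"
      unfolding z_def using t_in[OF FE s] by (intro T.ip_lincomb)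
    also have "\<dots> = (\<Sum>f\<in>F. \<Sum>g\<in>F. of_real (M\<^sup>2) * (k f * cnj (k g) * ip T (\<tau> f) (\<tau> g)) - k f * cnj (k g) * ip T (?t a f) (?t a g))"
    proof (intro sum.cong refl)
      fix f g assume "f \<in> F" "g \<in> F"
      note fg = FE[OF this(1)] FE[OF this(2)]
      have "ip T (?t s f) (?t s g) = of_real (M\<^sup>2) * ip T (\<tau> f) (\<tau> g) - ip T (?t a f) (?t a g)"
        unfolding \<tau>_upd_ip[OF fg i bop_in[OF s E_nth[OF fg(1) i]] bop_in[OF s E_nth[OF fg(2) i]]]
          \<tau>_upd_ip[OF fg i bop_in[OF a E_nth[OF fg(1) i]] bop_in[OF a E_nth[OF fg(2) i]]] \<tau>_ip_split[OF fg i]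
          sip[OF E_nth[OF fg(1) i] E_nth[OF fg(2) i]] by (simp add: left_diff_distrib mult.assoc)
      then show "k f * cnj (k g) * ip T (?t s f) (?t s g)
        = of_real (M\<^sup>2) * (k f * cnj (k g) * ip T (\<tau> f) (\<tau> g)) - k f * cnj (k g) * ip T (?t a f) (?t a g)"
        by (simp add: right_diff_distrib mult_ac)
    qed
    also have "\<dots> = of_real (M\<^sup>2) * (\<Sum>f\<in>F. \<Sum>g\<in>F. k f * cnj (k g) * ip T (\<tau> f) (\<tau> g)) - (\<Sum>f\<in>F. \<Sum>g\<in>F. k f * cnj (k g) * ip T (?t a f) (?t a g))"
      by (simp only: sum_subtractf sum_distrib_left)
    also have "(\<Sum>f\<in>F. \<Sum>g\<in>F. k f * cnj (k g) * ip T (\<tau> f) (\<tau> g)) = ip T x x"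
      unfolding x using \<tau>_in[OF FE] by (intro T.ip_lincomb[symmetric])
    also have "(\<Sum>f\<in>F. \<Sum>g\<in>F. k f * cnj (k g) * ip T (?t a f) (?t a g)) = ip T y y"
      unfolding y using t_in[OF FE a] by (intro T.ip_lincomb[symmetric])
    finally have "(hnorm T z)\<^sup>2 = M\<^sup>2 * (hnorm T x)\<^sup>2 - (hnorm T y)\<^sup>2"
      using in_T by (simp add: T.hnorm_sq)
    then have "(hnorm T y)\<^sup>2 \<le> (M * hnorm T x)\<^sup>2" using zero_le_power2[of "hnorm T z"] by (simp add: power_mult_distrib)
    then show "hnorm T y \<le> M * hnorm T x" using M in_T by (intro power2_le_imp_le[of "hnorm T y"]) auto
  qed
  then show ?thesis by auto
qed

text \<open>\<open>tensor_factor_op\<close> is a definite description; it is unique because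
  elementary tensors are total, so identities between amplifications are checked there.\<close>

lemma amp_eqI:
  assumes "i \<in> I" and B: "B \<in> bop T T" and eq: "\<And>f. f \<in> E \<Longrightarrow> B (\<tau> f) = \<tau> (f(i := a (f i)))"
  shows "amp i a = B"
  unfolding amp_def tensor_factor_op_def
proof (rule the_equality)
  fix C assume C: "C \<in> bop T T \<and> (\<forall>f\<in>E. C (\<tau> f) = \<tau> (f(i := a (f i))))"
  show "C = B"
    by (rule bop_eqI_total[OF T T _ B \<tau>_image \<tau>_total]) (use C eq in auto)
qed (use B eq in auto)

lemma
  assumes i: "i \<in> I" and a: "a \<in> bop (A i) (A i)"
  shows amp_bop: "amp i a \<in> bop T T" and amp_\<tau>: "f \<in> E \<Longrightarrow> amp i a (\<tau> f) = \<tau> (f(i := a (f i)))"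
proof -
  obtain B where B: "B \<in> bop T T" "\<And>f. f \<in> E \<Longrightarrow> B (\<tau> f) = \<tau> (f(i := a (f i)))" using amp_exists[OF assms] by blast
  then have "amp i a = B" by (intro amp_eqI i)
  then show "amp i a \<in> bop T T" "f \<in> E \<Longrightarrow> amp i a (\<tau> f) = \<tau> (f(i := a (f i)))" using B by auto
qed

lemma amp_add:
  assumes i: "i \<in> I" and a: "a \<in> bop (A i) (A i)" and b: "b \<in> bop (A i) (A i)"
  shows "amp i (a + b) = amp i a + amp i b"
  by (rule amp_eqI[OF i bop_plus[OF T T amp_bop[OF i a] amp_bop[OF i b]]])
    (simp add: amp_\<tau>[OF i a] amp_\<tau>[OF i b] \<tau>_add i bop_in[OF a E_nth] bop_in[OF b E_nth])

lemma amp_scale: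
  assumes i: "i \<in> I" and a: "a \<in> bop (A i) (A i)"
  shows "amp i (k *\<^sub>C a) = k *\<^sub>C amp i a"
  by (rule amp_eqI[OF i bop_scaleC[OF T T amp_bop[OF i a]]])
    (simp add: amp_\<tau>[OF i a] \<tau>_scale i bop_in[OF a E_nth] scaleC_apply)

lemma amp_comp:
  assumes i: "i \<in> I" and a: "a \<in> bop (A i) (A i)" and b: "b \<in> bop (A i) (A i)"
  shows "amp i (a \<circ> b) = amp i a \<circ> amp i b"
  by (rule amp_eqI[OF i bop_comp[OF T T T amp_bop[OF i a] amp_bop[OF i b]]])
    (simp add: amp_\<tau>[OF i a] amp_\<tau>[OF i b] upd_in i bop_in[OF b E_nth])

lemma amp_id: "i \<in> I \<Longrightarrow> amp i (idop (A i)) = idop T"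
  by (rule amp_eqI[OF _ bop_idop[OF T]]) (simp_all add: idop_eq \<tau>_in E_nth)

lemma amp_adj:
  assumes i: "i \<in> I" and a: "a \<in> bop (A i) (A i)"
  shows "amp i (adj (A i) (A i) a) = adj T T (amp i a)"
proof (rule bop_eqI_ip[OF T T _ _ \<tau>_image \<tau>_total \<tau>_image \<tau>_total])
  note a' = adj_bop[OF A[OF i] A[OF i] a]
  show "amp i (adj (A i) (A i) a) \<in> bop T T" "adj T T (amp i a) \<in> bop T T"
    by (intro amp_bop i a' adj_bop T a)+
  fix x y assume "x \<in> \<tau> ` E" "y \<in> \<tau> ` E"
  then obtain f g where f: "f \<in> E" "x = \<tau> f" and g: "g \<in> E" "y = \<tau> g" by blast
  note fi = E_nth[OF f(1) i] and gi = E_nth[OF g(1) i]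
  have "ip T (amp i (adj (A i) (A i) a) x) y = ip (A i) (adj (A i) (A i) a (f i)) (g i) * rest_ip i f g"
    using \<tau>_upd_ip[OF f(1) g(1) i bop_in[OF a' fi] gi] f g by (simp add: amp_\<tau>[OF i a'])
  also have "\<dots> = ip (A i) (f i) (a (g i)) * rest_ip i f g" using adj_ip'[OF A[OF i] A[OF i] a gi fi] by simp
  also have "\<dots> = ip T x (amp i a y)"
    using \<tau>_upd_ip[OF f(1) g(1) i fi bop_in[OF a gi]] f g by (simp add: amp_\<tau>[OF i a])
  also have "\<dots> = ip T (adj T T (amp i a) x) y"
    using adj_ip'[OF T T amp_bop[OF i a]] f g by (simp add: \<tau>_in)
  finally show "ip T (amp i (adj (A i) (A i) a) x) y = ip T (adj T T (amp i a) x) y" .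
qed

lemma amp_commute:
  assumes i: "i \<in> I" and a: "a \<in> bop (A i) (A i)" and j: "j \<in> I" and b: "b \<in> bop (A j) (A j)" and ij: "i \<noteq> j"
  shows "amp i a \<circ> amp j b = amp j b \<circ> amp i a"
proof (rule bop_eqI_total[OF T T _ _ \<tau>_image \<tau>_total])
  show "amp i a \<circ> amp j b \<in> bop T T" "amp j b \<circ> amp i a \<in> bop T T"
    by (intro bop_comp[OF T T T] amp_bop i a j b)+
  fix x assume "x \<in> \<tau> ` E"
  then obtain f where f: "f \<in> E" "x = \<tau> f" by blast
  show "(amp i a \<circ> amp j b) x = (amp j b \<circ> amp i a) x"
    using f ij upd_in[OF f(1) i bop_in[OF a E_nth[OF f(1) i]]] upd_in[OF f(1) j bop_in[OF b E_nth[OF f(1) j]]]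
    by (simp add: amp_\<tau>[OF i a] amp_\<tau>[OF j b] fun_upd_twist)
qed

text \<open>Reduces many factors to two. For nondegeneracy, \<open>\<tau> f\<close> is recovered
  from \<open>\<tau> (f(i := e))\<close> by the rank one operator that sends \<open>e\<close> to
  \<open>f i\<close>.\<close>

lemma factor:
  assumes i: "i \<in> I" and e: "e \<in> carr (A i)" "hnorm (A i) e = 1"
  shows "tensor_factor (A i) T (amp i) e"
proof -
  note Ai = A[OF i]
  have ee: "ip (A i) e e = 1" using hilbert.ip_self[OF Ai e(1)] e(2) by simp
  let ?S = "{amp i (rank_one (A i) u e) x | u x. u \<in> carr (A i) \<and> x \<in> carr T}"
  have "\<tau> f \<in> ?S" if f: "f \<in> E" for f
  proof -
    have "amp i (rank_one (A i) (f i) e) (\<tau> (f(i := e))) = \<tau> f"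
      using amp_\<tau>[OF i hilbert.rank_one_bop[OF Ai E_nth[OF f i] e(1)] upd_in[OF f i e(1)]] e
      by (simp add: hilbert.rank_one_apply[OF Ai] ee scaleC_one)
    from this[symmetric] show ?thesis using E_nth[OF f i] \<tau>_in[OF upd_in[OF f i e(1)]] by (intro CollectI exI conjI)
  qed
  then have "\<tau> ` E \<subseteq> ?S" by (rule image_subsetI)
  moreover have "?S \<subseteq> carr T" using bop_in[OF amp_bop[OF i hilbert.rank_one_bop[OF Ai _ e(1)]]] by auto
  ultimately have "closed_cspan T ?S = carr T" using \<tau>_total by (rule closed_cspan_mono[OF T])
  then show ?thesis
    using i Ai T e by (intro tensor_factor.intro) (simp_all add: amp_bop amp_add amp_scale amp_comp amp_adj amp_id)
qed

lemma carr_zero_if_factor_zero: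
  assumes "i \<in> I" "carr (A i) = {0}" shows "carr T = {0}"
proof -
  have "\<tau> f = 0" if "f \<in> E" for f
  proof -
    have "ip (A i) (f i) (f i) = 0" using E_nth[OF that assms(1)] assms hilbert.ip_zero_left[OF A[OF assms(1)]] by simp
    then have "ip T (\<tau> f) (\<tau> f) = 0" using \<tau>_ip_split[OF that that assms(1)] by simp
    then show ?thesis using T.ip_eq_0 \<tau>_in[OF that] by blast
  qed
  then have "x = 0" if "x \<in> carr T" for x
    using that by (intro T.total_orth_zero[OF \<tau>_total \<tau>_image]) auto
  then show ?thesis using T.zero_in by blast
qed

text \<open>The matrix coefficient \<open>\<langle>P (\<tau> f), \<tau> g\<rangle>\<close> is computed by replacing the entries of \<open>f\<close> and \<open>g\<close> by
  those of a fixed \<open>e\<close>, one at a time.\<close>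

lemma commutant_scalar:
  assumes P: "P \<in> bop T T" and comm: "\<And>i a. i \<in> I \<Longrightarrow> a \<in> bop (A i) (A i) \<Longrightarrow> P \<circ> amp i a = amp i a \<circ> P"
    and e: "\<And>i. i \<in> I \<Longrightarrow> e i \<in> carr (A i)" "\<And>i. i \<in> I \<Longrightarrow> hnorm (A i) (e i) = 1"
  shows "\<exists>z. P = z *\<^sub>C idop T"
proof -
  have step: "ip T (P (\<tau> f)) (\<tau> g) = ip (A i) (f i) (g i) * ip T (P (\<tau> (f(i := e i)))) (\<tau> (g(i := e i)))"
    if f: "f \<in> E" and g: "g \<in> E" and i: "i \<in> I" for f g i
  proof -
    note Ai = A[OF i] and fi = E_nth[OF f i] and gi = E_nth[OF g i] and ei = e(1)[OF i]
    \<comment> \<open>\<open>r\<close> sends \<open>e i\<close> to \<open>f i\<close> and is moved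
      past \<open>P\<close>; on the other side of the inner product its adjoint sends
      \<open>g i\<close> to a multiple of \<open>e i\<close>.\<close>
    define r where "r = rank_one (A i) (f i) (e i)"
    have r: "r \<in> bop (A i) (A i)" unfolding r_def by (intro hilbert.rank_one_bop Ai fi ei)
    note r' = adj_bop[OF Ai Ai r]
    have ee: "ip (A i) (e i) (e i) = 1" using hilbert.ip_self[OF Ai ei] e(2)[OF i] by simp
    have fe: "f(i := e i) \<in> E" and ge: "g(i := e i) \<in> E" using f g i ei by (simp_all add: upd_in)
    have "amp i r (\<tau> (f(i := e i))) = \<tau> f"
      using amp_\<tau>[OF i r fe] by (simp add: r_def hilbert.rank_one_apply[OF Ai ei] ee scaleC_one)
    then have "P (\<tau> f) = amp i r (P (\<tau> (f(i := e i))))" using comm[OF i r] by (metis comp_apply)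
    moreover have "adj T T (amp i r) (\<tau> g) = ip (A i) (g i) (f i) *\<^sub>C \<tau> (g(i := e i))"
    proof -
      have "adj (A i) (A i) r (g i) = ip (A i) (g i) (f i) *\<^sub>C e i"
        unfolding r_def hilbert.rank_one_adj[OF Ai fi ei] by (rule hilbert.rank_one_apply[OF Ai gi])
      then show ?thesis using amp_\<tau>[OF i r' g] \<tau>_scale[OF g i ei] by (simp add: amp_adj[OF i r])
    qed
    ultimately have "ip T (P (\<tau> f)) (\<tau> g) = cnj (ip (A i) (g i) (f i)) * ip T (P (\<tau> (f(i := e i)))) (\<tau> (g(i := e i)))"
      using adj_ip[OF T T amp_bop[OF i r] bop_in[OF P \<tau>_in[OF fe]] \<tau>_in[OF g]] bop_in[OF P \<tau>_in[OF fe]] \<tau>_in[OF ge]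
      by (simp add: T.ip_scale_right)
    then show ?thesis using hilbert.ip_cnj[OF Ai gi fi] by simp
  qed
  have ov: "override_on f e J \<in> E" if "f \<in> E" "J \<subseteq> I" for f J
    using that e by (auto simp: PiE_iff extensional_def override_on_def)
  \<comment> \<open>Entries in \<open>J\<close> are already those of \<open>e\<close>; at
    \<open>J = I\<close> nothing of \<open>f\<close> and \<open>g\<close> is left in the
    coefficient.\<close>
  have replace: "ip T (P (\<tau> f)) (\<tau> g) = (\<Prod>i\<in>J. ip (A i) (f i) (g i)) * ip T (P (\<tau> (override_on f e J))) (\<tau> (override_on g e J))"
    if f: "f \<in> E" and g: "g \<in> E" and J: "J \<subseteq> I" for f g J
    using finite_subset[OF J fin] J
  proof (induction J rule: finite_induct)
    case (insert j J)
    then have j: "j \<in> I" and J: "J \<subseteq> I" by auto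
    have "(override_on h e J)(j := e j) = override_on h e (insert j J)" "override_on h e J j = h j" for h
      using insert.hyps by (auto simp: override_on_def fun_eq_iff)
    then show ?case
      using insert.IH[OF J] step[OF ov[OF f J] ov[OF g J] j] insert.hyps by (simp add: mult_ac)
  qed simp
  define e0 where "e0 = restrict e I"
  define z where "z = ip T (P (\<tau> e0)) (\<tau> e0)"
  have "override_on f e I = e0" if "f \<in> E" for f
    using that by (auto simp: e0_def override_on_def fun_eq_iff PiE_iff extensional_def)
  then have "ip T (P (\<tau> f)) (\<tau> g) = ip T ((z *\<^sub>C idop T) (\<tau> f)) (\<tau> g)" if "f \<in> E" "g \<in> E" for f g
    using replace[OF that subset_refl] that by (simp add: z_def[symmetric] \<tau>_ip scaleC_apply idop_eq \<tau>_in T.ip_scale mult.commute)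
  then have "P = z *\<^sub>C idop T"
    by (intro bop_eqI_ip[OF T T P bop_scaleC[OF T T bop_idop[OF T]] \<tau>_image \<tau>_total \<tau>_image \<tau>_total]) auto
  then show ?thesis by blast
qed

end

locale generated_tensor = tensor_product I A T \<tau>
  for I :: "'i set" and A :: "'i \<Rightarrow> 'a::complex_vector hspace" and T :: "'h::complex_vector hspace" and \<tau> +
  fixes c :: "'i \<Rightarrow> 'a \<Rightarrow> 'a"
  assumes c: "i \<in> I \<Longrightarrow> c i \<in> bop (A i) (A i)"
begin

abbreviation gens :: "('h \<Rightarrow> 'h) set" where
  "gens \<equiv> insert (idop T) ((\<lambda>i. amp i (c i)) ` I)"

lemma gens_bop: "gens \<subseteq> bop T T"
  using c amp_bop bop_idop[OF T] by auto

text \<open>Generators of the other factors and their adjoints commute with every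
  \<open>amp i a\<close>, hence lie in the commutant.\<close>

lemma generated_factor:
  assumes i: "i \<in> I" and e: "e \<in> carr (A i)" "hnorm (A i) e = 1"
  shows "generated_factor (A i) T (amp i) e (c i) gens"
proof -
  interpret F: tensor_factor "A i" T "amp i" e by (rule factor[OF assms])
  have "amp j (c j) \<in> F.commutant" if j: "j \<in> I" "j \<noteq> i" for j
    using amp_commute[OF j(1) c[OF j(1)] i _ j(2)] amp_commute[OF j(1) adj_bop[OF A A c, OF j(1) j(1) j(1)] i _ j(2)]
    by (simp add: F.commutant_def amp_bop c j amp_adj[symmetric])
  then have "gens \<subseteq> insert (amp i (c i)) F.commutant" using F.idop_commutant by auto
  then show ?thesis using i c gens_bop by unfold_locales auto
qed

text \<open>The equivalence for abstract Hilbert spaces with one bounded operator each;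
  nonvanishing, irreducibility and uniqueness are matched one at a time.\<close>

theorem boundary_iff_factors:
  "boundary_representation T (banach_gen T gens) T (\<lambda>a. a) \<longleftrightarrow>
   (\<forall>i\<in>I. boundary_representation (A i) (banach_gen (A i) {idop (A i), c i}) (A i) (\<lambda>a. a))"
proof -
  have fgens: "{idop (A i), c i} \<subseteq> bop (A i) (A i)" if "i \<in> I" for i using that c bop_idop[OF A] by simp
  have iff_i: "boundary_representation (A i) (banach_gen (A i) {idop (A i), c i}) (A i) (\<lambda>a. a) \<longleftrightarrow>
    carr (A i) \<noteq> {0} \<and> acts_irreducibly (A i) (cstar_gen (A i) {idop (A i), c i}) \<and> unique_cp_extension (A i) {idop (A i), c i}" if i: "i \<in> I" for i
    using boundary_identity_iff[OF A[OF i] fgens[OF i]] cstar_gen_nonzero_iff[OF A[OF i] fgens[OF i]] by simp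
  have iff_T: "boundary_representation T (banach_gen T gens) T (\<lambda>a. a) \<longleftrightarrow>
    carr T \<noteq> {0} \<and> acts_irreducibly T (cstar_gen T gens) \<and> unique_cp_extension T gens"
    using boundary_identity_iff[OF T gens_bop] cstar_gen_nonzero_iff[OF T gens_bop] by simp
  show ?thesis
  proof
    assume L: "boundary_representation T (banach_gen T gens) T (\<lambda>a. a)"
    then have T0: "carr T \<noteq> {0}" and irr: "acts_irreducibly T (cstar_gen T gens)" and uniq: "unique_cp_extension T gens" by (simp_all add: iff_T)
    show "\<forall>i\<in>I. boundary_representation (A i) (banach_gen (A i) {idop (A i), c i}) (A i) (\<lambda>a. a)"
    proof
      fix i assume i: "i \<in> I"
      have A0: "carr (A i) \<noteq> {0}" using carr_zero_if_factor_zero[OF i] T0 by blast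
      obtain e where e: "e \<in> carr (A i)" "hnorm (A i) e = 1" using hilbert.ex_unit[OF A[OF i] A0] by blast
      interpret F: generated_factor "A i" T "amp i" e "c i" gens by (rule generated_factor[OF i e])
      show "boundary_representation (A i) (banach_gen (A i) {idop (A i), c i}) (A i) (\<lambda>a. a)"
        unfolding iff_i[OF i]
        by (intro conjI A0 F.irreducible_descends[OF T0 irr] F.unique_extension_descends[OF T0 uniq])
    qed
  next
    assume R: "\<forall>i\<in>I. boundary_representation (A i) (banach_gen (A i) {idop (A i), c i}) (A i) (\<lambda>a. a)"
    have A0: "carr (A i) \<noteq> {0}" and irr: "acts_irreducibly (A i) (cstar_gen (A i) {idop (A i), c i})"
      and uniq: "unique_cp_extension (A i) {idop (A i), c i}" if i: "i \<in> I" for i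
      using R[rule_format, OF i] i by (simp_all add: iff_i)
    \<comment> \<open>Unit vectors are chosen in all factors at once; their elementary tensor has
      norm 1, so \<open>T\<close> is not zero.\<close>
    have "\<forall>i\<in>I. \<exists>e\<in>carr (A i). hnorm (A i) e = 1" 
    proof
      fix i assume "i \<in> I"
      then show "\<exists>e\<in>carr (A i). hnorm (A i) e = 1" by (intro hilbert.ex_unit A A0)
    qed
    then obtain e where e: "\<And>i. i \<in> I \<Longrightarrow> e i \<in> carr (A i)" "\<And>i. i \<in> I \<Longrightarrow> hnorm (A i) (e i) = 1" by metis
    note gf = generated_factor[OF _ e]
    let ?C = "cstar_gen T gens"
    have C: "cstar_algebra T ?C" by (rule cstar_gen_algebra[OF T gens_bop])
    have Cb: "?C \<subseteq> bop T T" by (rule banach_algebra_bop[OF cstar_banach[OF C]])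
    have e0: "restrict e I \<in> E" using e by auto
    have "ip T (\<tau> (restrict e I)) (\<tau> (restrict e I)) = 1"
      using e hilbert.ip_self[OF A e(1)] by (simp add: \<tau>_ip[OF e0 e0])
    then have T0: "carr T \<noteq> {0}" using \<tau>_in[OF e0] T.ip_zero_left[OF T.zero_in] by force
    have irrT: "acts_irreducibly T ?C"
      unfolding acts_irreducibly_def
    proof (intro allI impI, elim conjE)
      fix V assume V: "closed_csubspace T V" and inv: "\<forall>a\<in>?C. \<forall>x\<in>V. a x \<in> V"
      let ?P = "proj T V"
      have P: "?P \<in> bop T T" by (rule T.proj_bop[OF V])
      have comm: "x \<circ> ?P = ?P \<circ> x" if "x \<in> ?C" for x
        using inv that Cb cstar_adj[OF C] by (intro T.proj_commutes[OF V, of ?C]) auto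
      \<comment> \<open>The projection commutes with all operators on every single factor, hence is
        scalar, and a subspace with scalar projection is trivial.\<close>
      have "?P \<circ> amp i a = amp i a \<circ> ?P" if "i \<in> I" "a \<in> bop (A i) (A i)" for i a
        by (rule generated_factor.commutes_with_factor[OF gf[OF that(1) that(1) that(1)] irr[OF that(1)] P comm that(2)])
      then obtain z where z: "?P = z *\<^sub>C idop T" using commutant_scalar[OF P _ e] by blast
      have Pz: "?P x = z *\<^sub>C x" if "x \<in> carr T" for x using that by (simp add: z scaleC_apply idop_eq)
      have VT: "V \<subseteq> carr T" by (rule closed_csubspace_subset[OF V])
      show "V = {0} \<or> V = carr T"
      proof (cases "z = 0")
        case True
        have "v = 0" if v: "v \<in> V" for v
        proof -
          have vT: "v \<in> carr T" using v VT by blast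
          have "?P v = v" using v T.proj_in_iff[OF V vT] by blast
          then show ?thesis using Pz[OF vT] True by simp
        qed
        then show ?thesis using complex_vector.subspace_0[OF closed_csubspace_csubspace[OF V]] by blast
      next
        case False
        have "x \<in> V" if x: "x \<in> carr T" for x
        proof -
          have "(1 / z) *\<^sub>C ?P x \<in> V"
            using T.proj_props(1)[OF V x] by (intro complex_vector.subspace_scale[OF closed_csubspace_csubspace[OF V]])
          then show ?thesis using False by (simp add: Pz[OF x] scaleC_scaleC scaleC_one)
        qed
        then show ?thesis using VT by blast
      qed
    qed
    have "unique_cp_extension T gens"
      unfolding unique_cp_extension_def
    proof (intro allI impI ballI, elim conjE)
      fix \<Phi> y
      assume cp: "completely_positive T ?C T \<Phi>" and fix_B': "\<forall>x\<in>banach_gen T gens. \<Phi> x = x" and y: "y \<in> ?C"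
      have fix_B: "\<Phi> x = x" if "x \<in> banach_gen T gens" for x using fix_B' that by blast
      have fix_l: "\<Phi> (amp i a) = amp i a" if i: "i \<in> I" and a: "a \<in> cstar_gen (A i) {idop (A i), c i}" for i a
        by (rule generated_factor.unique_extension_lifts[OF gf[OF i i i] uniq[OF i] cp fix_B a])
      have id_fix: "\<Phi> (idop T) = idop T" using fix_B banach_gen_incl by blast
      \<comment> \<open>Besides the generator, its adjoint and both products belong to the
        C*-algebra of the same factor, where \<open>\<Phi>\<close> is known to be the identity; this
        meets the hypotheses of \<open>cp_fixes_generated\<close>.\<close>
      have all: "\<Phi> u = u \<and> \<Phi> (adj T T u) = adj T T u \<and> \<Phi> (adj T T u \<circ> u) = adj T T u \<circ> u \<and> \<Phi> (u \<circ> adj T T u) = u \<circ> adj T T u"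
        if "u \<in> gens" for u
      proof -
        have "u = idop T \<or> (\<exists>i\<in>I. u = amp i (c i))" using that by blast
        then show ?thesis
        proof
          assume "u = idop T"
          then show ?thesis using id_fix by (simp add: adj_idop T idop_comp[OF bop_idop[OF T] T])
        next
          assume "\<exists>i\<in>I. u = amp i (c i)"
          then obtain i where i: "i \<in> I" and u: "u = amp i (c i)" by blast
          note Ci = cstar_gen_algebra[OF A[OF i] fgens[OF i]]
          have ci: "c i \<in> cstar_gen (A i) {idop (A i), c i}" using cstar_gen_incl by blast
          note ci' = cstar_adj[OF Ci ci] and mul = banach_algebra_comp[OF cstar_banach[OF Ci]]
          note cb = c[OF i] and cb' = adj_bop[OF A[OF i] A[OF i] c[OF i]]
          show ?thesis
            using fix_l[OF i ci] fix_l[OF i ci'] fix_l[OF i mul[OF ci' ci]] fix_l[OF i mul[OF ci ci']]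
            unfolding u amp_adj[OF i cb] amp_comp[OF i cb' cb] amp_comp[OF i cb cb'] by blast
        qed
      qed
      show "\<Phi> y = y"
        by (rule cp_fixes_generated[OF T gens_bop _ cp _ _ _ _ y]) (use all in blast)+
    qed
    then show "boundary_representation T (banach_gen T gens) T (\<lambda>a. a)"
      unfolding iff_T using T0 irrT by blast
  qed
qed

end

section \<open>Compressions\<close>

lemma sub_hspace_simps [simp]: "carr (sub_hspace H V) = V" "ip (sub_hspace H V) = ip H" "hnorm (sub_hspace H V) = hnorm H"
  by (auto simp: sub_hspace_def hnorm_def fun_eq_iff)

lemma hilbert_sub_hspace:
  assumes H: "hilbert H" and V: "closed_csubspace H V"
  shows "hilbert (sub_hspace H V)"
proof -
  interpret H: hilbert H by (rule H)
  have VH: "v \<in> carr H" if "v \<in> V" for v using closed_csubspace_subset[OF V] that by blast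
  show ?thesis
  proof
    fix X :: "nat \<Rightarrow> 'a"
    assume X: "\<And>m. X m \<in> carr (sub_hspace H V)" "\<And>e. e > 0 \<Longrightarrow> \<exists>N. \<forall>p\<ge>N. \<forall>q\<ge>N. hnorm (sub_hspace H V) (X p - X q) < e"
    then obtain l where l: "l \<in> carr H" "(\<lambda>m. hnorm H (X m - l)) \<longlonglongrightarrow> 0"
      using H.complete[of X] VH by auto
    then have "l \<in> V" using closed_csubspace_lim[OF V, of X l] X(1) by simp
    then show "\<exists>l\<in>carr (sub_hspace H V). (\<lambda>m. hnorm (sub_hspace H V) (X m - l)) \<longlonglongrightarrow> 0" using l by auto
  qed (use VH closed_csubspace_csubspace[OF V] in \<open>auto simp: H.ip_add H.ip_scale H.ip_cnj[symmetric] H.ip_nonneg H.ip_eq_0\<close>)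
qed

lemma compression_bop:
  assumes H: "hilbert H" and V: "closed_csubspace H V" and M: "M \<in> bop H H"
  shows "compression H V M \<in> bop (sub_hspace H V) (sub_hspace H V)"
proof -
  interpret H: hilbert H by (rule H)
  have VH: "v \<in> carr H" if "v \<in> V" for v using closed_csubspace_subset[OF V] that by blast
  note sub = closed_csubspace_csubspace[OF V]
  have PM: "proj H V \<circ> M \<in> bop H H" by (rule bop_comp[OF H H H H.proj_bop[OF V] M])
  obtain B where B: "\<And>x. x \<in> carr H \<Longrightarrow> hnorm H ((proj H V \<circ> M) x) \<le> B * hnorm H x" using bop_boundE[OF PM H] by blast
  show ?thesis
    using VH H.proj_props(1)[OF V bop_in[OF M VH]] bop_add[OF PM] bop_scale[OF PM] B
      complex_vector.subspace_add[OF sub] complex_vector.subspace_scale[OF sub]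
    by (intro bopI[where B = B]) (auto simp: compression_def)
qed

context tensor_product
begin

context
  fixes V :: "'i \<Rightarrow> 'a set" and Q :: "'h set"
  assumes V: "\<And>i. i \<in> I \<Longrightarrow> closed_csubspace (A i) (V i)" and Q: "Q = tensor_subspace I T \<tau> V"
begin

lemma VE: "f \<in> (\<Pi>\<^sub>E i\<in>I. V i) \<Longrightarrow> f \<in> E"
  by (rule subsetD[OF PiE_mono[OF closed_csubspace_subset[OF V]]])

lemma Q_closed: "closed_csubspace T Q"
  unfolding Q tensor_subspace_def by (rule T.closed_csubspace_cspan) (use VE \<tau>_in in blast)

lemma \<tau>_in_Q: "f \<in> (\<Pi>\<^sub>E i\<in>I. V i) \<Longrightarrow> \<tau> f \<in> Q"
  by (auto simp: Q tensor_subspace_def closed_cspan_def)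

text \<open>The orthogonal complement of \<open>y\<close> is closed, so containing the elementary
  tensors it contains their closed span \<open>Q\<close>.\<close>

lemma orth_Q:
  assumes y: "y \<in> carr T" "\<And>f. f \<in> (\<Pi>\<^sub>E i\<in>I. V i) \<Longrightarrow> ip T y (\<tau> f) = 0"
  shows "y \<in> orth T Q"
proof -
  have "\<tau> ` (\<Pi>\<^sub>E i\<in>I. V i) \<subseteq> orth T {y}"
  proof
    fix s assume "s \<in> \<tau> ` (\<Pi>\<^sub>E i\<in>I. V i)"
    then obtain f where f: "f \<in> (\<Pi>\<^sub>E i\<in>I. V i)" "s = \<tau> f" by blast
    have "ip T (\<tau> f) y = 0" using T.ip_cnj[OF y(1) \<tau>_in[OF VE[OF f(1)]]] y(2)[OF f(1)] by simp
    then show "s \<in> orth T {y}" using \<tau>_in[OF VE[OF f(1)]] f(2) by (simp add: orth_def)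
  qed
  moreover have "closed_csubspace T (orth T {y})" using T.orth_closed[of "{y}"] y(1) by simp
  ultimately have "Q \<subseteq> orth T {y}" unfolding Q tensor_subspace_def closed_cspan_def by blast
  then have "ip T y q = 0" if "q \<in> Q" for q
    using that T.ip_cnj[of q y] y(1) by (force simp: orth_def)
  then show ?thesis using y(1) by (simp add: orth_def)
qed

text \<open>\<open>closed_cspan\<close> is relative to the ambient space, so totality in
  \<open>Q\<close> is derived anew: a vector of \<open>Q\<close> orthogonal to the elementary
  tensors is orthogonal to itself.\<close>

lemma sub_tensor: "tensor_product I (\<lambda>i. sub_hspace (A i) (V i)) (sub_hspace T Q) \<tau>"
proof (rule tensor_product.intro)
  have HQ: "hilbert (sub_hspace T Q)" by (rule hilbert_sub_hspace[OF T Q_closed])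
  have "closed_cspan (sub_hspace T Q) (\<tau> ` (\<Pi>\<^sub>E i\<in>I. V i)) = Q"
  proof -
    have "closed_cspan (sub_hspace T Q) (\<tau> ` (\<Pi>\<^sub>E i\<in>I. V i)) = carr (sub_hspace T Q)"
    proof (rule hilbert.total_if_orth_zero[OF HQ])
      fix y assume y: "y \<in> carr (sub_hspace T Q)" "\<And>s. s \<in> \<tau> ` (\<Pi>\<^sub>E i\<in>I. V i) \<Longrightarrow> ip (sub_hspace T Q) y s = 0"
      then have yT: "y \<in> carr T" using closed_csubspace_subset[OF Q_closed] by auto
      have "y \<in> orth T Q" by (rule orth_Q[OF yT]) (use y in auto)
      then show "y = 0" using y(1) yT T.ip_eq_0[of y] by (auto simp: orth_def)
    qed (use \<tau>_in_Q in auto)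
    then show ?thesis by simp
  qed
  moreover have Vc: "x \<in> carr (A i)" if "i \<in> I" "x \<in> V i" for i x using closed_csubspace_subset[OF V[OF that(1)]] that by blast
  ultimately show "hilbert_tensor I (\<lambda>i. sub_hspace (A i) (V i)) (sub_hspace T Q) \<tau>"
    unfolding hilbert_tensor_def sub_hspace_simps
    using HQ \<tau>_in_Q VE \<tau>_add \<tau>_scale \<tau>_ip by (intro conjI ballI allI) auto
qed (auto intro: fin hilbert_sub_hspace A V)

text \<open>Projecting onto \<open>Q\<close> an elementary tensor whose entries lie in the
  \<open>V j\<close> except at \<open>i\<close> projects that one entry: the difference has an entry
  at \<open>i\<close> orthogonal to \<open>V i\<close>, which makes it orthogonal to
  \<open>Q\<close>.\<close>

lemma compression_amp:
  assumes i: "i \<in> I" and M: "M \<in> bop (A i) (A i)"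
  shows "compression T Q (tensor_factor_op I A T \<tau> i M) =
    tensor_factor_op I (\<lambda>i. sub_hspace (A i) (V i)) (sub_hspace T Q) \<tau> i (compression (A i) (V i) M)"
proof -
  interpret S: tensor_product I "\<lambda>i. sub_hspace (A i) (V i)" "sub_hspace T Q" \<tau> by (rule sub_tensor)
  interpret H: hilbert "A i" by (rule A[OF i])
  have "S.amp i (compression (A i) (V i) M) = compression T Q (amp i M)"
  proof (rule S.amp_eqI[OF i compression_bop[OF T Q_closed amp_bop[OF i M]]])
    fix f assume "f \<in> (\<Pi>\<^sub>E i\<in>I. carr (sub_hspace (A i) (V i)))"
    then have f: "f \<in> (\<Pi>\<^sub>E i\<in>I. V i)" by simp
    have fi: "f i \<in> V i" using f i by (auto simp: PiE_iff)
    note fE = VE[OF f]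
    let ?x = "M (f i)" and ?p = "proj (A i) (V i) (M (f i))"
    have x: "?x \<in> carr (A i)" by (rule bop_in[OF M E_nth[OF fE i]])
    note p = H.proj_props[OF V[OF i] x]
    have pA: "?p \<in> carr (A i)" using p(1) closed_csubspace_subset[OF V[OF i]] by blast
    have fp: "f(i := ?p) \<in> (\<Pi>\<^sub>E i\<in>I. V i)" using f i p(1) by (auto simp: PiE_iff extensional_def)
    have "\<tau> (f(i := ?x)) = \<tau> (f(i := (?x - ?p) + ?p))" by simp
    also have "\<dots> = \<tau> (f(i := ?x - ?p)) + \<tau> (f(i := ?p))" using x pA by (intro \<tau>_add[OF fE i]) auto
    finally have diff: "\<tau> (f(i := ?x)) - \<tau> (f(i := ?p)) = \<tau> (f(i := ?x - ?p))" by simp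
    have dE: "f(i := ?x - ?p) \<in> E" using x pA by (intro upd_in[OF fE i]) auto
    have "proj T Q (\<tau> (f(i := ?x))) = \<tau> (f(i := ?p))"
    proof (rule T.proj_eqI[OF Q_closed \<tau>_in[OF upd_in[OF fE i x]] \<tau>_in_Q[OF fp]])
      show "\<tau> (f(i := ?x)) - \<tau> (f(i := ?p)) \<in> orth T Q"
        unfolding diff
      proof (rule orth_Q[OF \<tau>_in[OF dE]])
        fix g assume g: "g \<in> (\<Pi>\<^sub>E i\<in>I. V i)"
        then have "ip (A i) (?x - ?p) (g i) = 0" using p(2) i by (auto simp: orth_def PiE_iff)
        then show "ip T (\<tau> (f(i := ?x - ?p))) (\<tau> g) = 0" using \<tau>_ip_split[OF dE VE[OF g] i] by simp
      qed
    qed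
    then show "compression T Q (amp i M) (\<tau> f) = \<tau> (f(i := compression (A i) (V i) M (f i)))"
      using \<tau>_in_Q[OF f] fi by (simp add: compression_def amp_\<tau>[OF i M fE])
  qed
  then show ?thesis by (simp add: amp_def S.amp_def)
qed

text \<open>By \<open>compression_amp\<close> the compressed generators on \<open>Q\<close> are
  amplifications of the compressed generators on the \<open>V i\<close>, so the abstract equivalence
  applies.\<close>

theorem quotient_boundary_iff:
  assumes M: "\<And>i. i \<in> I \<Longrightarrow> M i \<in> bop (A i) (A i)"
  shows "identity_is_boundary I T (\<lambda>i. tensor_factor_op I A T \<tau> i (M i)) Q \<longleftrightarrow>
    (\<forall>i\<in>I. identity_is_boundary {i} (A i) (\<lambda>_. M i) (V i))"
proof -
  interpret S: generated_tensor I "\<lambda>i. sub_hspace (A i) (V i)" "sub_hspace T Q" \<tau> "\<lambda>i. compression (A i) (V i) (M i)"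
    by (intro generated_tensor.intro sub_tensor generated_tensor_axioms.intro compression_bop A V M)
  have "quotient_generators I T (\<lambda>i. tensor_factor_op I A T \<tau> i (M i)) Q = S.gens"
    using M by (simp add: quotient_generators_def compression_amp S.amp_def)
  then show ?thesis
    using S.boundary_iff_factors
    by (simp add: identity_is_boundary_def quotient_banach_algebra_def) (simp add: quotient_generators_def)
qed

end

end

theorem theorem4p2:
  fixes n :: nat
    and k :: "nat \<Rightarrow> complex \<Rightarrow> complex \<Rightarrow> complex"
    and H :: "nat \<Rightarrow> (complex \<Rightarrow> complex) hspace"
    and T :: "'h::complex_vector hspace"
    and \<tau> :: "(nat \<Rightarrow> complex \<Rightarrow> complex) \<Rightarrow> 'h"
    and Qs :: "nat \<Rightarrow> (complex \<Rightarrow> complex) set"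
    and Q :: "'h set"
  assumes "n \<ge> 1"
    and "\<And>i. i \<in> {1..n} \<Longrightarrow> analytic_hilbert_module (k i) (H i)"
    and "hilbert_tensor {1..n} H T \<tau>"
    and "\<And>i. i \<in> {1..n} \<Longrightarrow> quotient_module {i} (H i) (\<lambda>_. Mz (H i)) (Qs i)"
    and "Q = tensor_subspace {1..n} T \<tau> Qs"
    and "quotient_module {1..n} T (Mzi {1..n} H T \<tau>) Q"
    and "doubly_commuting {1..n} T (Mzi {1..n} H T \<tau>) Q"
  shows "identity_is_boundary {1..n} T (Mzi {1..n} H T \<tau>) Q
    \<longleftrightarrow> (\<forall>i\<in>{1..n}. identity_is_boundary {i} (H i) (\<lambda>_. Mz (H i)) (Qs i))"
proof -
  have H: "hilbert (H i)" "Mz (H i) \<in> bop (H i) (H i)" if "i \<in> {1..n}" for i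
    using assms(2)[OF that] by (auto simp: analytic_hilbert_module_def rkhs_def)
  interpret tensor_product "{1..n}" H T \<tau>
    by (rule tensor_product.intro) (use H(1) assms(3) in auto)
  have "Mzi {1..n} H T \<tau> = (\<lambda>i. tensor_factor_op {1..n} H T \<tau> i (Mz (H i)))"
    by (simp add: fun_eq_iff Mzi_def)
  moreover have "closed_csubspace (H i) (Qs i)" if "i \<in> {1..n}" for i
    using assms(4)[OF that] by (simp add: quotient_module_def)
  ultimately show ?thesis using quotient_boundary_iff[OF _ assms(5) H(2)] by simp
qed

end
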